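(* Let $0<T\le2\pi^2$. Then $$\frac{2\pi^{-1/2}e^{-\pi/4}}{\sqrt{\frac12t\vee(\pi-\phi)}}\,\frac{1}{4\pi t}\exp\Big(-\frac{\phi^2}{4t}\Big)\le K_t^2(\phi)\le\frac{\sqrt2\,\pi^{3/2}e^{T/4}}{\sqrt{\frac{\pi^2}{8}t\vee(\pi-\phi)}}\,\frac{1}{4\pi t}\exp\Big(-\frac{\phi^2}{4t}\Big)$$ for all $\phi\in[0,\pi]$ and $0<t\le T$.
   Context: $a\vee b=\max(a,b)$. Let $S^2\subset\mathbb{R}^3$ be the Euclidean unit sphere equipped with the standard non-normalized surface area measure. Its heat kernel (the integral kernel, with respect to this measure, of the semigroup $e^{t\Delta}$, $\Delta$ the Laplace--Beltrami operator) depends on its arguments $\xi,\eta$ only through their geodesic distance $\phi=\arccos\langle\xi,\eta\rangle\in[0,\pi]$; viewed as a function of $\phi$ it is denoted $K_t^2(\phi)$. *)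

theory Defs
  imports "HOL-Analysis.Analysis"
begin

abbreviation S2 :: "(real^3) set" where
  "S2 \<equiv> sphere 0 1"

definition sphere_param :: "real \<times> real \<Rightarrow> real^3" where
  "sphere_param = (\<lambda>(\<theta>, \<psi>). vector [sin \<theta> * cos \<psi>, sin \<theta> * sin \<psi>, cos \<theta>])"

text \<open>The Riemannian area element of the parametrization above, i.e. the norm of the cross
  product of its two partial derivatives, is \<open>sin \<theta>\<close>.  The measure lives on \<^term>\<open>S2\<close> itself, so
  measurability, integrals and almost-everywhere statements ignore values off the sphere.\<close>

definition sphere_area :: "(real^3) measure" where
  "sphere_area =
     distr (density lborel
              (\<lambda>z. ennreal (indicator ({0..pi} \<times> {0..2*pi}) z * sin (fst z))))
           (restrict_space borel S2) sphere_param"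

lemma sphere_param_in_S2: "sphere_param z \<in> S2"
proof -
  obtain a b where z: "z = (a, b)" by (cases z)
  have "(sin a * cos b)\<^sup>2 + (sin a * sin b)\<^sup>2 + (cos a)\<^sup>2
      = (sin a)\<^sup>2 * ((sin b)\<^sup>2 + (cos b)\<^sup>2) + (cos a)\<^sup>2"
    by (simp only: power_mult_distrib distrib_left add.commute)
  then have "(sin a * cos b)\<^sup>2 + (sin a * sin b)\<^sup>2 + (cos a)\<^sup>2 = 1"
    by simp
  then show ?thesis
    by (simp add: z sphere_param_def norm_vec_def L2_set_def sum_3)
qed

lemma continuous_on_sphere_param: "continuous_on A sphere_param"
proof -
  have "continuous_on A (\<lambda>z. sphere_param z $ i)" for i
  proof -
    consider "i = 1" | "i = 2" | "i = 3" using exhaust_3 by blast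
    then show ?thesis
      by cases (simp_all add: sphere_param_def case_prod_beta continuous_intros)
  qed
  then have "continuous_on A (\<lambda>z. \<chi> i. sphere_param z $ i)"
    by (intro continuous_on_vec_lambda)
  then show ?thesis by simp
qed

lemma measurable_sphere_param:
  "sphere_param \<in> measurable borel (restrict_space borel S2)"
  by (intro measurable_restrict_space2 borel_measurable_continuous_onI
        continuous_on_sphere_param) (use sphere_param_in_S2 in auto)

definition L2_sphere :: "(real^3 \<Rightarrow> real) set" where
  "L2_sphere = {f \<in> borel_measurable sphere_area. integrable sphere_area (\<lambda>x. (f x)\<^sup>2)}"

definition L2_sphere_norm :: "(real^3 \<Rightarrow> real) \<Rightarrow> real" where
  "L2_sphere_norm f = sqrt (\<integral>x. (f x)\<^sup>2 \<partial>sphere_area)"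

definition C2_on :: "'a::euclidean_space set \<Rightarrow> ('a \<Rightarrow> real) \<Rightarrow> bool" where
  "C2_on U F \<longleftrightarrow>
     (\<exists>G H. \<forall>i\<in>Basis.
        (\<forall>x\<in>U. ((\<lambda>s. F (x + s *\<^sub>R i)) has_real_derivative G i x) (at 0)) \<and>
        continuous_on U (G i) \<and>
        (\<forall>j\<in>Basis.
           (\<forall>x\<in>U. ((\<lambda>s. G i (x + s *\<^sub>R j)) has_real_derivative H i j x) (at 0)) \<and>
           continuous_on U (H i j)))"

definition laplacian :: "('a::euclidean_space \<Rightarrow> real) \<Rightarrow> 'a \<Rightarrow> real" where
  "laplacian F x = (\<Sum>i\<in>Basis. (deriv ^^ 2) (\<lambda>s. F (x + s *\<^sub>R i)) 0)"

text \<open>A function on the sphere is differentiated through its extension to the complement of the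
  origin that is constant along rays; the Euclidean Laplacian of this extension, evaluated
  on the sphere, is the Laplace--Beltrami operator.\<close>

definition radial_ext :: "(real^3 \<Rightarrow> real) \<Rightarrow> real^3 \<Rightarrow> real" where
  "radial_ext f x = f (x /\<^sub>R norm x)"

definition C2_sphere :: "(real^3 \<Rightarrow> real) set" where
  "C2_sphere = {f. C2_on (- {0}) (radial_ext f)}"

definition laplace_beltrami :: "(real^3 \<Rightarrow> real) \<Rightarrow> real^3 \<Rightarrow> real" where
  "laplace_beltrami f x = laplacian (radial_ext f) x"

text \<open>Elements of the Hilbert space of square integrable functions are represented by functions,
  hence equations between them hold almost everywhere.\<close>

definition bounded_operator_L2 :: "((real^3 \<Rightarrow> real) \<Rightarrow> real^3 \<Rightarrow> real) \<Rightarrow> bool" where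
  "bounded_operator_L2 A \<longleftrightarrow>
     (\<forall>f\<in>L2_sphere. A f \<in> L2_sphere) \<and>
     (\<forall>f\<in>L2_sphere. \<forall>g\<in>L2_sphere. AE x in sphere_area. A (\<lambda>y. f y + g y) x = A f x + A g x) \<and>
     (\<forall>f\<in>L2_sphere. \<forall>c. AE x in sphere_area. A (\<lambda>y. c * f y) x = c * A f x) \<and>
     (\<exists>C. \<forall>f\<in>L2_sphere. L2_sphere_norm (A f) \<le> C * L2_sphere_norm f)"

definition C0_semigroup_L2 :: "(real \<Rightarrow> (real^3 \<Rightarrow> real) \<Rightarrow> real^3 \<Rightarrow> real) \<Rightarrow> bool" where
  "C0_semigroup_L2 S \<longleftrightarrow>
     (\<forall>t\<ge>0. bounded_operator_L2 (S t)) \<and>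
     (\<forall>f\<in>L2_sphere. AE x in sphere_area. S 0 f x = f x) \<and>
     (\<forall>s\<ge>0. \<forall>t\<ge>0. \<forall>f\<in>L2_sphere. AE x in sphere_area. S (s + t) f x = S s (S t f) x) \<and>
     (\<forall>f\<in>L2_sphere. \<forall>t\<ge>0.
        ((\<lambda>s. L2_sphere_norm (\<lambda>x. S s f x - S t f x)) \<longlongrightarrow> 0) (at t within {0..}))"

text \<open>The strongly continuous semigroup generated by the (self-adjoint) Laplace--Beltrami
  operator.  It suffices to ask that the generator extends the classical operator on twice
  continuously differentiable functions: the latter is essentially self-adjoint, its closure
  generates a semigroup, and a generator has no proper extension that is a generator.  So there is
  exactly one such semigroup, up to equality almost everywhere.\<close>

definition heat_semigroup :: "(real \<Rightarrow> (real^3 \<Rightarrow> real) \<Rightarrow> real^3 \<Rightarrow> real) \<Rightarrow> bool" where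
  "heat_semigroup S \<longleftrightarrow>
     C0_semigroup_L2 S \<and>
     (\<forall>f\<in>C2_sphere.
        ((\<lambda>h. L2_sphere_norm (\<lambda>x. (S h f x - f x) / h - laplace_beltrami f x)) \<longlongrightarrow> 0)
          (at_right 0))"

text \<open>An integral kernel is determined only almost everywhere; continuity selects the pointwise
  defined heat kernel.\<close>

definition heat_kernel :: "(real \<Rightarrow> real^3 \<Rightarrow> real^3 \<Rightarrow> real) \<Rightarrow> bool" where
  "heat_kernel p \<longleftrightarrow>
     (\<forall>t>0. continuous_on (S2 \<times> S2) (\<lambda>(\<xi>, \<eta>). p t \<xi> \<eta>)) \<and>
     (\<exists>S. heat_semigroup S \<and>
        (\<forall>t>0. \<forall>f\<in>L2_sphere.
           AE \<xi> in sphere_area. S t f \<xi> = (\<integral>\<eta>. p t \<xi> \<eta> * f \<eta> \<partial>sphere_area)))"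

text \<open>The heat kernel as a function of the geodesic distance.\<close>

definition heat_kernel_profile :: "(real \<Rightarrow> real \<Rightarrow> real) \<Rightarrow> bool" where
  "heat_kernel_profile K \<longleftrightarrow>
     (\<exists>p. heat_kernel p \<and>
        (\<forall>t>0. \<forall>\<xi>\<in>S2. \<forall>\<eta>\<in>S2. p t \<xi> \<eta> = K t (arccos (\<xi> \<bullet> \<eta>))))"

end

theory Submission
  imports Defs "HOL-Probability.Probability"
begin

text \<open>
  Let \<open>y = (1 - cos \<phi>) / 2\<close>.  A zonal polynomial \<open>q\<close> in \<open>y\<close> with \<open>\<Delta> q = - n (n + 1) q\<close>
  satisfies \<open>S t q = exp (- n (n + 1) t) q\<close>, and evaluating this at the north pole gives the
  Legendre moments of \<open>K t\<close>.  The Abel transform maps the \<open>n\<close>-th Legendre polynomial to a multiple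
  of \<open>sin ((n + 1/2) s)\<close>, so that for every sequence \<open>h N\<close> with the right limiting sine moments
  \<open>\<integral> K t \<phi> q sin \<phi> d\<phi>\<close> is, up to a constant, the limit of \<open>\<integral> h N s (abel q s) ds\<close>.  Two such sequences
  are used: finite sums of Gaussian images (short times) and finite sine sums (long times).  Both
  compare pointwise with \<open>s exp (- s\<^sup>2 / (4 t))\<close>, and for this single Gaussian the order of
  integration can be exchanged and the inner integral estimated by elementary bounds for
  \<open>cos \<phi> - cos s\<close>.  Inequalities between integrals against all nonnegative \<open>q\<close> are pointwise
  inequalities because \<open>K t\<close> is continuous, so the kernel itself need never be written as a series.
\<close>

section \<open>Square integrable functions on the sphere\<close>

text \<open>Behind the duality with \<open>abel q\<close> stands a Mehler-type formula: up to a
  constant, \<open>K t \<phi>\<close> is the integral over s in [\<phi>, \<pi>] of H(s) / sqrt (cos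
  \<phi> - cos s), where H(s) is the sum over all integers j of (-1)^j (s + 2 \<pi> j) exp (-(s + 2
  \<pi> j)^2 / (4 t)), a differentiated theta function. Poisson summation turns H into a sine
  series; the images are efficient for small t, the sines for large t. The obstacle is the
  alternating sign in H, which must be compared with its single term g(s) = s exp (-s^2 / (4 t))
  uniformly in s. The bound H \<le> 2 g is available up to t = 2 \<pi>^2: hence the restriction on T
  and a factor 2. The bound g \<le> H is used up to t = \<pi>; beyond, exp (-t/4) g \<le> H. This
  loss cancels the factor exp (t/4) that comes from (n + 1/2)^2 = n (n + 1) + 1/4; in the upper
  bound that factor survives as exp (T/4). The weight 1 / sqrt (\<pi> - \<phi>) comes from the
  vanishing of cos \<phi> - cos s near the antipode, and exp (-\<pi>/4) from the decay of the
  Gaussian while s exceeds \<phi> by at most t/2.\<close>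

lemma L2_sphere_mult_integrable:
  assumes "f \<in> L2_sphere" "g \<in> L2_sphere"
  shows "integrable sphere_area (\<lambda>x. f x * g x)"
proof -
  have m[measurable]: "f \<in> borel_measurable sphere_area" "g \<in> borel_measurable sphere_area"
    and i: "integrable sphere_area (\<lambda>x. (f x)\<^sup>2)" "integrable sphere_area (\<lambda>x. (g x)\<^sup>2)"
    using assms by (auto simp: L2_sphere_def)
  have "\<bar>f x * g x\<bar> \<le> (f x)\<^sup>2 + (g x)\<^sup>2" for x
    proof -
    have "0 \<le> \<bar>f x\<bar> * \<bar>g x\<bar>" by simp
    then show ?thesis
      using sum_squares_bound[of "\<bar>f x\<bar>" "\<bar>g x\<bar>"] unfolding abs_mult power2_abs by linarith
  qed
  then show ?thesis
    by (intro Bochner_Integration.integrable_bound[OF Bochner_Integration.integrable_add[OF i]]) auto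
qed

lemma L2_sphere_scale: "f \<in> L2_sphere \<Longrightarrow> (\<lambda>x. c * f x) \<in> L2_sphere"
  by (auto simp: L2_sphere_def power_mult_distrib)

lemma L2_sphere_add:
  assumes "f \<in> L2_sphere" "g \<in> L2_sphere" shows "(\<lambda>x. f x + g x) \<in> L2_sphere"
  using assms L2_sphere_mult_integrable[OF assms]
  by (auto simp: L2_sphere_def power2_sum mult.assoc)

lemma L2_sphere_diff:
  assumes "f \<in> L2_sphere" "g \<in> L2_sphere" shows "(\<lambda>x. f x - g x) \<in> L2_sphere"
  using L2_sphere_add[OF assms(1) L2_sphere_scale[OF assms(2), of "-1"]] by simp

lemma L2_sphere_norm_nonneg [simp]: "0 \<le> L2_sphere_norm f"
  by (simp add: L2_sphere_norm_def)

lemma L2_sphere_norm_scale: "L2_sphere_norm (\<lambda>x. c * f x) = \<bar>c\<bar> * L2_sphere_norm f"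
  by (simp add: L2_sphere_norm_def power_mult_distrib real_sqrt_mult)

lemma L2_sphere_norm_power2: "(L2_sphere_norm f)\<^sup>2 = (\<integral>x. (f x)\<^sup>2 \<partial>sphere_area)"
  by (simp add: L2_sphere_norm_def)

lemma L2_sphere_norm_cong_AE:
  assumes "f \<in> borel_measurable sphere_area" "g \<in> borel_measurable sphere_area"
    and "AE x in sphere_area. f x = g x"
  shows "L2_sphere_norm f = L2_sphere_norm g"
  unfolding L2_sphere_norm_def using assms
  by (intro arg_cong[of _ _ sqrt] integral_cong_AE) auto

lemma L2_sphere_Cauchy_Schwarz:
  assumes "f \<in> L2_sphere" "g \<in> L2_sphere"
  shows "(\<integral>x. f x * g x \<partial>sphere_area) \<le> L2_sphere_norm f * L2_sphere_norm g"
proof -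
  define A B C where "A = (\<integral>x. (f x)\<^sup>2 \<partial>sphere_area)" and "B = (\<integral>x. f x * g x \<partial>sphere_area)"
    and "C = (\<integral>x. (g x)\<^sup>2 \<partial>sphere_area)"
  have i: "integrable sphere_area (\<lambda>x. (f x)\<^sup>2)" "integrable sphere_area (\<lambda>x. (g x)\<^sup>2)"
    using assms by (auto simp: L2_sphere_def)
  note j = L2_sphere_mult_integrable[OF assms]
  have q: "0 \<le> A - 2 * r * B + r\<^sup>2 * C" for r
  proof -
    have "0 \<le> (\<integral>x. (f x - r * g x)\<^sup>2 \<partial>sphere_area)" by simp
    also have "\<dots> = (\<integral>x. (f x)\<^sup>2 - 2 * r * (f x * g x) + r\<^sup>2 * (g x)\<^sup>2 \<partial>sphere_area)"
      by (intro Bochner_Integration.integral_cong) (auto simp: power2_eq_square algebra_simps)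
    also have "\<dots> = A - 2 * r * B + r\<^sup>2 * C"
      using i j by (simp add: A_def B_def C_def)
    finally show ?thesis .
  qed
  have nn: "A \<ge> 0" "C \<ge> 0" by (auto simp: A_def C_def)
  have "B\<^sup>2 \<le> A * C"
  proof (cases "C = 0")
    case True
    have "B = 0"
    proof (rule ccontr)
      assume "B \<noteq> 0"
      \<comment> \<open>For C = 0 the quadratic is affine in r; this r gives it the value
        -1.\<close>
      then show False using q[of "(A + 1) / (2 * B)"] True by simp
    qed
    then show ?thesis using True by simp
  next
    case False
    then show ?thesis using q[of "B / C"] nn
      by (simp add: field_simps power2_eq_square split: if_splits)
  qed
  then have "B \<le> sqrt (A * C)" by (rule real_le_rsqrt)
  then show ?thesis by (simp add: A_def B_def C_def L2_sphere_norm_def real_sqrt_mult)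
qed

lemma L2_sphere_norm_triangle:
  assumes "f \<in> L2_sphere" "g \<in> L2_sphere"
  shows "L2_sphere_norm (\<lambda>x. f x + g x) \<le> L2_sphere_norm f + L2_sphere_norm g"
proof (rule power2_le_imp_le)
  have i: "integrable sphere_area (\<lambda>x. (f x)\<^sup>2)" "integrable sphere_area (\<lambda>x. (g x)\<^sup>2)"
    using assms by (auto simp: L2_sphere_def)
  have "(L2_sphere_norm (\<lambda>x. f x + g x))\<^sup>2
      = (\<integral>x. (f x)\<^sup>2 + (g x)\<^sup>2 + 2 * (f x * g x) \<partial>sphere_area)"
    unfolding L2_sphere_norm_power2
    by (intro Bochner_Integration.integral_cong) (auto simp: power2_eq_square algebra_simps)
  also have "\<dots> = (L2_sphere_norm f)\<^sup>2 + (L2_sphere_norm g)\<^sup>2 + 2 * (\<integral>x. f x * g x \<partial>sphere_area)"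
    using i L2_sphere_mult_integrable[OF assms] by (simp add: L2_sphere_norm_power2)
  also have "\<dots> \<le> (L2_sphere_norm f + L2_sphere_norm g)\<^sup>2"
    using L2_sphere_Cauchy_Schwarz[OF assms] by (simp add: power2_sum)
  finally show "(L2_sphere_norm (\<lambda>x. f x + g x))\<^sup>2 \<le> (L2_sphere_norm f + L2_sphere_norm g)\<^sup>2" .
qed simp

lemma L2_sphere_norm_diff_le:
  assumes "f \<in> L2_sphere" "g \<in> L2_sphere"
  shows "\<bar>L2_sphere_norm f - L2_sphere_norm g\<bar> \<le> L2_sphere_norm (\<lambda>x. f x - g x)"
proof -
  have d: "(\<lambda>x. f x - g x) \<in> L2_sphere" by (rule L2_sphere_diff[OF assms])
  have "L2_sphere_norm f \<le> L2_sphere_norm (\<lambda>x. f x - g x) + L2_sphere_norm g"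
    using L2_sphere_norm_triangle[OF d assms(2)] by simp
  moreover have "L2_sphere_norm g \<le> L2_sphere_norm f + L2_sphere_norm (\<lambda>x. f x - g x)"
    using L2_sphere_norm_triangle[OF assms(1) L2_sphere_scale[OF d, of "-1"]]
      L2_sphere_norm_scale[of "-1" "\<lambda>x. f x - g x"] by simp
  ultimately show ?thesis by linarith
qed

text \<open>Growth is controlled through an upper right Dini derivative because \<open>N\<close>
  will be a norm and need not be differentiable. The last time in [0, b] at which \<open>N\<close>
  lies on or below the line of slope \<epsilon> would have to be before \<open>b\<close>, yet the
  local bound carries the inequality a little further.\<close>

lemma nonpos_of_right_derivative_nonpos:
  fixes N :: "real \<Rightarrow> real"
  assumes cont: "continuous_on {0..} N" and N0: "N 0 = 0" and b: "0 \<le> b"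
    and der: "\<And>t \<epsilon>. 0 \<le> t \<Longrightarrow> 0 < \<epsilon> \<Longrightarrow> eventually (\<lambda>h. N (t + h) - N t \<le> \<epsilon> * h) (at_right 0)"
  shows "N b \<le> 0"
proof (rule ccontr)
  assume "\<not> N b \<le> 0"
  \<comment> \<open>Small enough for the line of slope \<epsilon> to pass below \<open>N b\<close>
    at \<open>b\<close>; the shifted denominator covers b = 0.\<close>
  define \<epsilon> where "\<epsilon> = N b / (b + 1) / 2"
  have e: "0 < \<epsilon>" "\<epsilon> * b < N b"
  proof -
    show "0 < \<epsilon>" using \<open>\<not> N b \<le> 0\<close> b by (simp add: \<epsilon>_def)
    have "N b * b < N b * (2 * (b + 1))"
      using \<open>\<not> N b \<le> 0\<close> b by (intro mult_strict_left_mono) auto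
    then show "\<epsilon> * b < N b" using b by (simp add: \<epsilon>_def field_simps)
  qed
  define A where "A = {t \<in> {0..b}. N t - \<epsilon> * t \<le> 0}"
  have cl: "closed A" unfolding A_def
    by (intro continuous_closed_preimage_constant continuous_on_closed_Collect_le continuous_intros
        continuous_on_subset[OF cont]) auto
  have A0: "0 \<in> A" using N0 b by (simp add: A_def)
  have bd: "bdd_above A" by (auto simp: A_def)
  define \<tau> where "\<tau> = Sup A"
  have tA: "\<tau> \<in> A" unfolding \<tau>_def using closed_contains_Sup[OF _ bd cl] A0 by auto
  then have t: "0 \<le> \<tau>" "\<tau> \<le> b" "N \<tau> \<le> \<epsilon> * \<tau>" by (auto simp: A_def)
  have "\<tau> \<noteq> b" using t(3) e(2) by auto
  then have tb: "\<tau> < b" using t by simp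
  have "eventually (\<lambda>h. h < b - \<tau>) (at_right 0)"
    using tb by (intro eventually_at_right_less order_tendstoD(2)[OF tendsto_ident_at]) simp_all
  moreover have "eventually (\<lambda>h::real. 0 < h) (at_right 0)" by (rule eventually_at_right_less)
  ultimately have "eventually (\<lambda>h. N (\<tau> + h) - N \<tau> \<le> \<epsilon> * h \<and> h < b - \<tau> \<and> 0 < h) (at_right 0)"
    using der[OF t(1) e(1)] by eventually_elim auto
  then obtain h where h: "N (\<tau> + h) - N \<tau> \<le> \<epsilon> * h" "h < b - \<tau>" "0 < h"
    using eventually_happens'[OF trivial_limit_at_right_real] by blast
  then have "\<tau> + h \<in> A" using t by (auto simp: A_def algebra_simps)
  then have "\<tau> + h \<le> \<tau>" unfolding \<tau>_def by (rule cSup_upper[OF _ bd])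
  then show False using h by simp
qed

section \<open>Eigenfunctions under the heat semigroup\<close>

text \<open>The generator is known on \<open>f\<close> only at time 0. There S h f = exp (- l h) f +
  r with norm of r of order o(h); the semigroup law and the boundedness of \<open>S s\<close> carry
  this to every s, so exp (l s) S s f has increments o(h) and its distance to \<open>f\<close>
  cannot leave 0.\<close>

lemma heat_semigroup_eigenfunction:
  assumes S: "heat_semigroup S" and f: "f \<in> L2_sphere" "f \<in> C2_sphere"
    and ev: "AE x in sphere_area. laplace_beltrami f x = - l * f x"
    and lb: "laplace_beltrami f \<in> L2_sphere" and t: "0 \<le> t"
  shows "AE x in sphere_area. S t f x = exp (- l * t) * f x"
proof -
  have C0: "C0_semigroup_L2 S"
    and gen: "((\<lambda>h. L2_sphere_norm (\<lambda>x. (S h f x - f x) / h - laplace_beltrami f x)) \<longlongrightarrow> 0) (at_right 0)"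
    using S f by (auto simp: heat_semigroup_def)
  have bdd: "bounded_operator_L2 (S s)" if "s \<ge> 0" for s using C0 that by (auto simp: C0_semigroup_L2_def)
  have SL: "S s g \<in> L2_sphere" if "s \<ge> 0" "g \<in> L2_sphere" for s g
    using bdd[OF that(1)] that(2) by (auto simp: bounded_operator_L2_def)
  have Sf: "S s f \<in> L2_sphere" if "s \<ge> 0" for s using SL that f by auto
  have meas: "g \<in> borel_measurable sphere_area" if "g \<in> L2_sphere" for g using that by (simp add: L2_sphere_def)
  define u where "u s = (\<lambda>x. exp (l * s) * S s f x)" for s
  have uL: "u s \<in> L2_sphere" if "s \<ge> 0" for s unfolding u_def by (intro L2_sphere_scale Sf that)
  define N where "N s = L2_sphere_norm (\<lambda>x. u s x - f x)" for s
  have wL: "(\<lambda>x. u s x - f x) \<in> L2_sphere" if "s \<ge> 0" for s by (intro L2_sphere_diff uL that f)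
  have Ndiff: "\<bar>N s - N r\<bar> \<le> L2_sphere_norm (\<lambda>x. u s x - u r x)" if "s \<ge> 0" "r \<ge> 0" for s r
    unfolding N_def using L2_sphere_norm_diff_le[OF wL[OF that(1)] wL[OF that(2)]] by simp
  have "continuous_on {0..} N"
    unfolding continuous_on_def
  proof
    fix r :: real assume r: "r \<in> {0..}"
    then have r0: "0 \<le> r" by simp
    have sc: "((\<lambda>s. L2_sphere_norm (\<lambda>x. S s f x - S r f x)) \<longlongrightarrow> 0) (at r within {0..})"
      using C0 f r0 by (auto simp: C0_semigroup_L2_def)
    have b: "\<bar>N s - N r\<bar> \<le> exp (l * s) * L2_sphere_norm (\<lambda>x. S s f x - S r f x)
        + \<bar>exp (l * s) - exp (l * r)\<bar> * L2_sphere_norm (S r f)" if s: "s \<ge> 0" for s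
    proof -
      have "L2_sphere_norm (\<lambda>x. u s x - u r x)
          = L2_sphere_norm (\<lambda>x. exp (l * s) * (S s f x - S r f x) + (exp (l * s) - exp (l * r)) * S r f x)"
        by (simp add: u_def algebra_simps)
      also have "\<dots> \<le> L2_sphere_norm (\<lambda>x. exp (l * s) * (S s f x - S r f x))
          + L2_sphere_norm (\<lambda>x. (exp (l * s) - exp (l * r)) * S r f x)"
        by (intro L2_sphere_norm_triangle L2_sphere_scale L2_sphere_diff Sf s r0)
      finally show ?thesis using Ndiff[OF s r0] by (simp add: L2_sphere_norm_scale)
    qed
    have "((\<lambda>s. exp (l * s) * L2_sphere_norm (\<lambda>x. S s f x - S r f x)
        + \<bar>exp (l * s) - exp (l * r)\<bar> * L2_sphere_norm (S r f))
        \<longlongrightarrow> exp (l * r) * 0 + \<bar>exp (l * r) - exp (l * r)\<bar> * L2_sphere_norm (S r f)) (at r within {0..})"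
      by (intro tendsto_intros sc)
    then have "((\<lambda>s. exp (l * s) * L2_sphere_norm (\<lambda>x. S s f x - S r f x)
        + \<bar>exp (l * s) - exp (l * r)\<bar> * L2_sphere_norm (S r f)) \<longlongrightarrow> 0) (at r within {0..})"
      by simp
    moreover have "\<forall>\<^sub>F s in at r within {0..}. norm (N s - N r) \<le> exp (l * s) * L2_sphere_norm (\<lambda>x. S s f x - S r f x)
        + \<bar>exp (l * s) - exp (l * r)\<bar> * L2_sphere_norm (S r f)"
      using b by (auto simp: eventually_at_filter intro!: always_eventually)
    ultimately have "((\<lambda>s. N s - N r) \<longlongrightarrow> 0) (at r within {0..})"
      by (rule Lim_null_comparison[rotated])
    then show "(N \<longlongrightarrow> N r) (at r within {0..})" by (simp add: LIM_zero_iff)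
  qed
  moreover have "N 0 = 0"
  proof -
    have "AE x in sphere_area. S 0 f x = f x" using C0 f by (auto simp: C0_semigroup_L2_def)
    then have "N 0 = L2_sphere_norm (\<lambda>x. 0)"
      unfolding N_def using meas[OF wL[of 0]] by (intro L2_sphere_norm_cong_AE) (auto simp: u_def)
    then show ?thesis by (simp add: L2_sphere_norm_def)
  qed
  moreover have "eventually (\<lambda>h. N (s + h) - N s \<le> \<epsilon> * h) (at_right 0)"
    if s: "0 \<le> s" and e: "0 < \<epsilon>" for s \<epsilon>
  proof -
    from bdd[OF s] obtain C' where C': "\<forall>g\<in>L2_sphere. L2_sphere_norm (S s g) \<le> C' * L2_sphere_norm g"
      unfolding bounded_operator_L2_def by blast
    \<comment> \<open>The constant in \<open>bounded_operator_L2\<close> carries no sign, hence the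
      maximum with 0.\<close>
    then have C: "L2_sphere_norm (S s g) \<le> max C' 0 * L2_sphere_norm g" if "g \<in> L2_sphere" for g
      using that by (intro order_trans[OF _ mult_right_mono[of C' "max C' 0"]]) auto
    define C where "C = max C' 0"
    have C0': "0 \<le> C" by (simp add: C_def)
    note C = C[folded C_def]
    \<comment> \<open>The relative error of S h f against exp (- l h) f. It tends to 0: the first
      summand by the generator property, the second by the derivative of the exponential at
      0.\<close>
    define d where "d h = L2_sphere_norm (\<lambda>x. (S h f x - f x) / h - laplace_beltrami f x)
        + \<bar>(exp (- l * h) - 1) / h + l\<bar> * L2_sphere_norm f" for h
    have dl: "L2_sphere_norm (\<lambda>x. S h f x - exp (- l * h) * f x) \<le> h * d h" if h: "h > 0" for h
    proof -
      have "L2_sphere_norm (\<lambda>x. S h f x - exp (- l * h) * f x)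
        = L2_sphere_norm (\<lambda>x. h * (((S h f x - f x) / h - laplace_beltrami f x)
            + - ((exp (- l * h) - 1) / h + l) * f x))"
      proof (rule L2_sphere_norm_cong_AE)
        show "AE x in sphere_area. S h f x - exp (- l * h) * f x
          = h * (((S h f x - f x) / h - laplace_beltrami f x)
            + - ((exp (- l * h) - 1) / h + l) * f x)"
          using ev by eventually_elim (use h in \<open>simp add: field_simps\<close>)
      qed (use meas[OF Sf[of h]] meas[OF f(1)] meas[OF lb] h in \<open>auto intro!: borel_measurable_add borel_measurable_diff borel_measurable_times borel_measurable_divide borel_measurable_const\<close>)
      also have "\<dots> = h * L2_sphere_norm (\<lambda>x. ((S h f x - f x) / h - laplace_beltrami f x)
            + - ((exp (- l * h) - 1) / h + l) * f x)"
        using h by (subst L2_sphere_norm_scale) simp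
      also have "\<dots> \<le> h * (L2_sphere_norm (\<lambda>x. (S h f x - f x) / h - laplace_beltrami f x)
            + L2_sphere_norm (\<lambda>x. - ((exp (- l * h) - 1) / h + l) * f x))"
      proof (intro mult_left_mono L2_sphere_norm_triangle L2_sphere_scale f L2_sphere_diff lb)
        show "(\<lambda>x. (S h f x - f x) / h) \<in> L2_sphere"
          using L2_sphere_scale[OF L2_sphere_diff[OF Sf f(1)], of h "1 / h"] h by simp
      qed (use h in auto)
      also have "\<dots> = h * d h" 
        using L2_sphere_norm_scale[of "- ((exp (- l * h) - 1) / h + l)" f]
        unfolding d_def by (simp only: abs_minus_cancel)
      finally show ?thesis .
    qed
    have inc: "N (s + h) - N s \<le> exp (l * (s + h)) * (C * (h * d h))" if h: "h > 0" for h
    proof -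
      define r where "r = (\<lambda>x. S h f x - exp (- l * h) * f x)"
      have rL: "r \<in> L2_sphere" unfolding r_def
        by (intro L2_sphere_diff L2_sphere_scale Sf f) (use h in auto)
      have "AE x in sphere_area. S (s + h) f x = S s (S h f) x"
        using C0 s h f by (auto simp: C0_semigroup_L2_def)
      moreover have "S h f = (\<lambda>y. r y + exp (- l * h) * f y)" by (simp add: r_def)
      ultimately have "AE x in sphere_area. S (s + h) f x = S s (\<lambda>y. r y + exp (- l * h) * f y) x"
        by metis
      moreover have "AE x in sphere_area. S s (\<lambda>y. r y + exp (- l * h) * f y) x = S s r x + S s (\<lambda>y. exp (- l * h) * f y) x"
        using bdd[OF s] rL L2_sphere_scale[OF f(1)] by (auto simp: bounded_operator_L2_def)
      moreover have "AE x in sphere_area. S s (\<lambda>y. exp (- l * h) * f y) x = exp (- l * h) * S s f x"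
        using bdd[OF s] f(1) by (auto simp: bounded_operator_L2_def)
      ultimately have "AE x in sphere_area. u (s + h) x - u s x = exp (l * (s + h)) * S s r x"
        by eventually_elim (simp add: u_def ring_distribs exp_add exp_minus)
      then have "L2_sphere_norm (\<lambda>x. u (s + h) x - u s x) = L2_sphere_norm (\<lambda>x. exp (l * (s + h)) * S s r x)"
        using s h by (intro L2_sphere_norm_cong_AE meas L2_sphere_diff uL L2_sphere_scale SL rL) auto
      also have "\<dots> = exp (l * (s + h)) * L2_sphere_norm (S s r)" by (simp add: L2_sphere_norm_scale)
      also have "\<dots> \<le> exp (l * (s + h)) * (C * (h * d h))"
        using C[OF rL] mult_left_mono[OF dl[OF h] C0'] unfolding r_def
        by (intro mult_left_mono) auto
      finally show ?thesis using Ndiff[of "s + h" s] s h by simp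
    qed
    have "((\<lambda>h. (exp (- l * h) - 1) / h) \<longlongrightarrow> - l) (at_right 0)"
    proof -
      have "((\<lambda>h. exp (- l * h)) has_real_derivative - l) (at 0)"
        by (auto intro!: derivative_eq_intros)
      then show ?thesis
        by (auto simp: has_field_derivative_iff intro: tendsto_within_subset)
    qed
    then have "((\<lambda>h. exp (l * (s + h)) * (C * d h)) \<longlongrightarrow> exp (l * (s + 0)) * (C * (0 + \<bar>- l + l\<bar> * L2_sphere_norm f))) (at_right 0)"
      unfolding d_def by (intro tendsto_intros gen)
    then have "((\<lambda>h. exp (l * (s + h)) * (C * d h)) \<longlongrightarrow> 0) (at_right 0)" by simp
    then have "eventually (\<lambda>h. exp (l * (s + h)) * (C * d h) < \<epsilon>) (at_right 0)"
      using e by (rule order_tendstoD(2))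
    moreover have "eventually (\<lambda>h::real. 0 < h) (at_right 0)" by (rule eventually_at_right_less)
    ultimately show ?thesis
    proof eventually_elim
      case (elim h)
      have "N (s + h) - N s \<le> exp (l * (s + h)) * (C * (h * d h))"
        by (rule inc[OF elim(2)])
      also have "\<dots> = (exp (l * (s + h)) * (C * d h)) * h" by simp
      also have "\<dots> \<le> \<epsilon> * h" using elim by (intro mult_right_mono) auto
      finally show ?case .
    qed
  qed
  ultimately have "N t \<le> 0" using t by (intro nonpos_of_right_derivative_nonpos[of N])
  then have "N t = 0" unfolding N_def using L2_sphere_norm_nonneg by (smt (verit))
  then have "(\<integral>x. (u t x - f x)\<^sup>2 \<partial>sphere_area) = 0"
    by (simp add: N_def L2_sphere_norm_def)
  then have "AE x in sphere_area. (u t x - f x)\<^sup>2 = 0"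
    using wL[OF t] by (subst (asm) integral_nonneg_eq_0_iff_AE) (auto simp: L2_sphere_def)
  then show ?thesis
    by eventually_elim (simp add: u_def exp_minus field_simps)
qed

section \<open>Zonal functions and Legendre polynomials\<close>

definition zonal :: "real poly \<Rightarrow> real^3 \<Rightarrow> real" where
  "zonal q x = poly q ((1 - x $ 3) / 2)"

text \<open>The extension of the coordinate y that is constant along rays. Its directional
  derivatives are kept in closed form for arbitrary directions, so that they serve both as the
  witnesses for \<open>C2_on\<close> and as the summands of the Laplacian.\<close>

definition zonal_height :: "real^3 \<Rightarrow> real" where
  "zonal_height x = (1 - x $ 3 / norm x) / 2"

definition zonal_height' :: "real^3 \<Rightarrow> real^3 \<Rightarrow> real" where
  "zonal_height' v x = - (v $ 3 / norm x - x $ 3 * (x \<bullet> v) / norm x ^ 3) / 2"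

definition zonal_height'' :: "real^3 \<Rightarrow> real^3 \<Rightarrow> real^3 \<Rightarrow> real" where
  "zonal_height'' v w x = - (3 * x $ 3 * (x \<bullet> v) * (x \<bullet> w) / norm x ^ 5
     - v $ 3 * (x \<bullet> w) / norm x ^ 3 - w $ 3 * (x \<bullet> v) / norm x ^ 3 - x $ 3 * (v \<bullet> w) / norm x ^ 3) / 2"

lemma radial_ext_zonal: "radial_ext (zonal q) x = poly q (zonal_height x)"
  by (simp add: radial_ext_def zonal_def zonal_height_def inverse_eq_divide)

lemma DERIV_norm_line:
  fixes x v :: "real^3"
  assumes "x \<noteq> 0"
  shows "((\<lambda>s. norm (x + s *\<^sub>R v)) has_real_derivative (x \<bullet> v) / norm x) (at 0)"
proof -
  have p: "0 < x \<bullet> x" using assms by simp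
  have "((\<lambda>s. sqrt (x \<bullet> x + 2 * s * (x \<bullet> v) + s\<^sup>2 * (v \<bullet> v))) has_real_derivative (x \<bullet> v) / norm x) (at 0)"
    using p inner_ge_zero[of x]
    by (auto intro!: derivative_eq_intros simp: norm_eq_sqrt_inner field_simps simp del: inner_ge_zero)
  moreover have "(\<lambda>s. norm (x + s *\<^sub>R v)) = (\<lambda>s. sqrt (x \<bullet> x + 2 * s * (x \<bullet> v) + s\<^sup>2 * (v \<bullet> v)))"
    by (auto simp: norm_eq_sqrt_inner inner_add inner_commute power2_eq_square algebra_simps)
  ultimately show ?thesis by simp
qed

lemma DERIV_zonal_height:
  assumes "x \<noteq> 0"
  shows "((\<lambda>s. zonal_height (x + s *\<^sub>R v)) has_real_derivative zonal_height' v x) (at 0)"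
  unfolding zonal_height_def zonal_height'_def using assms
  by (auto intro!: derivative_eq_intros DERIV_norm_line simp: field_simps power3_eq_cube)

lemma DERIV_zonal_height':
  assumes "x \<noteq> 0"
  shows "((\<lambda>s. zonal_height' v (x + s *\<^sub>R w)) has_real_derivative zonal_height'' v w x) (at 0)"
  unfolding zonal_height'_def zonal_height''_def inner_add_left inner_scaleR_left using assms
  by (auto intro!: derivative_eq_intros DERIV_norm_line
      simp: field_simps power3_eq_cube power_numeral_reduce inner_commute[of w v])

lemma DERIV_zonal:
  assumes "x \<noteq> 0"
  shows "((\<lambda>s. radial_ext (zonal q) (x + s *\<^sub>R v)) has_real_derivative
    poly (pderiv q) (zonal_height x) * zonal_height' v x) (at 0)"
  unfolding radial_ext_zonal
  by (rule DERIV_chain2[where f = "poly q", OF _ DERIV_zonal_height[OF assms], THEN DERIV_cong]) (auto intro: poly_DERIV)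

lemma DERIV_zonal2:
  assumes "x \<noteq> 0"
  shows "((\<lambda>s. poly (pderiv q) (zonal_height (x + s *\<^sub>R w)) * zonal_height' v (x + s *\<^sub>R w)) has_real_derivative
    poly (pderiv (pderiv q)) (zonal_height x) * zonal_height' w x * zonal_height' v x
     + poly (pderiv q) (zonal_height x) * zonal_height'' v w x) (at 0)"
proof -
  have "((\<lambda>s. poly (pderiv q) (zonal_height (x + s *\<^sub>R w))) has_real_derivative
    poly (pderiv (pderiv q)) (zonal_height x) * zonal_height' w x) (at 0)"
    by (rule DERIV_chain2[where f = "poly (pderiv q)", OF _ DERIV_zonal_height[OF assms], THEN DERIV_cong]) (auto intro: poly_DERIV)
  from DERIV_mult[OF this DERIV_zonal_height'[OF assms]] show ?thesis
    by (rule DERIV_cong) simp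
qed

lemma zonal_C2_sphere: "zonal q \<in> C2_sphere"
  unfolding C2_sphere_def C2_on_def mem_Collect_eq
proof (intro exI ballI conjI)
  fix i j :: "real^3"
  show "((\<lambda>s. radial_ext (zonal q) (x + s *\<^sub>R i)) has_real_derivative
    (\<lambda>v x. poly (pderiv q) (zonal_height x) * zonal_height' v x) i x) (at 0)" if "x \<in> - {0}" for x
    using DERIV_zonal that by auto
  show "((\<lambda>s. (\<lambda>v x. poly (pderiv q) (zonal_height x) * zonal_height' v x) i (x + s *\<^sub>R j)) has_real_derivative
    (\<lambda>v w x. poly (pderiv (pderiv q)) (zonal_height x) * zonal_height' w x * zonal_height' v x
     + poly (pderiv q) (zonal_height x) * zonal_height'' v w x) i j x) (at 0)" if "x \<in> - {0}" for x
    using DERIV_zonal2 that by auto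
  have c: "continuous_on (- {0::real^3}) zonal_height" "continuous_on (- {0}) (zonal_height' v)"
    "continuous_on (- {0}) (zonal_height'' v w)" for v w
    unfolding zonal_height_def zonal_height'_def zonal_height''_def
    by (auto intro!: continuous_intros)
  show "continuous_on (- {0}) ((\<lambda>v x. poly (pderiv q) (zonal_height x) * zonal_height' v x) i)"
    by (intro continuous_intros c)
  show "continuous_on (- {0}) ((\<lambda>v w x. poly (pderiv (pderiv q)) (zonal_height x) * zonal_height' w x * zonal_height' v x
     + poly (pderiv q) (zonal_height x) * zonal_height'' v w x) i j)"
    by (intro continuous_intros c)
qed

text \<open>Chain rule: the Laplacian of q(h) is q'' times the squared gradient of h plus q' times
  the Laplacian of h. For h = \<open>zonal_height\<close> on the unit sphere these two quantities
  are y (1 - y) and 1 - 2 y.\<close>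

lemma laplace_beltrami_zonal:
  assumes "x \<in> S2" and "y = (1 - x $ 3) / 2"
  shows "laplace_beltrami (zonal q) x
    = y * (1 - y) * poly (pderiv (pderiv q)) y + (1 - 2 * y) * poly (pderiv q) y"
proof -
  have x: "norm x = 1" "x \<noteq> 0" using assms by auto
  have h: "zonal_height x = y" by (simp add: zonal_height_def x assms)
  have d2: "(deriv ^^ 2) (\<lambda>s. radial_ext (zonal q) (x + s *\<^sub>R v)) 0
    = poly (pderiv (pderiv q)) y * (zonal_height' v x)\<^sup>2 + poly (pderiv q) y * zonal_height'' v v x" for v
  proof -
    define r where "r = (\<lambda>s. poly (pderiv q) (zonal_height (x + s *\<^sub>R v)) * zonal_height' v (x + s *\<^sub>R v))"
    have "deriv (\<lambda>s. radial_ext (zonal q) (x + s *\<^sub>R v)) s = r s" if "x + s *\<^sub>R v \<noteq> 0" for s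
    proof -
      have "((\<lambda>u. radial_ext (zonal q) (x + (s + u) *\<^sub>R v)) has_real_derivative r s) (at 0)"
        using DERIV_zonal[OF that, of q v] by (simp add: r_def scaleR_add_left add.assoc)
      then have "((\<lambda>u. radial_ext (zonal q) (x + u *\<^sub>R v)) has_real_derivative r s) (at (0 + s))"
        by (subst DERIV_shift) (simp add: add.commute)
      then show ?thesis by (simp add: DERIV_imp_deriv)
    qed
    \<comment> \<open>An iterated \<open>deriv\<close> at 0 needs the first derivative on a whole
      neighbourhood of 0, where the line must avoid the origin.\<close>
    moreover have "eventually (\<lambda>s. x + s *\<^sub>R v \<noteq> 0) (nhds 0)"
    proof -
      have "((\<lambda>s. x + s *\<^sub>R v) \<longlongrightarrow> x + 0 *\<^sub>R v) (nhds 0)"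
        by (intro tendsto_intros filterlim_ident)
      then show ?thesis using x(2) by (intro tendsto_imp_eventually_ne) auto
    qed
    ultimately have "eventually (\<lambda>s. deriv (\<lambda>s. radial_ext (zonal q) (x + s *\<^sub>R v)) s = r s) (nhds 0)"
      by (auto elim: eventually_mono)
    then have "deriv (deriv (\<lambda>s. radial_ext (zonal q) (x + s *\<^sub>R v))) 0 = deriv r 0"
      by (rule deriv_cong_ev) simp
    also have "\<dots> = poly (pderiv (pderiv q)) y * (zonal_height' v x)\<^sup>2 + poly (pderiv q) y * zonal_height'' v v x"
      using DERIV_imp_deriv[OF DERIV_zonal2[OF x(2), of q v v]] by (simp add: r_def h power2_eq_square)
    finally show ?thesis by (simp add: numeral_2_eq_2)
  qed
  \<comment> \<open>The sums over \<open>Basis\<close> that follow are Parseval's identity for the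
    pairs formed from x and the third axis, together with the dimension 3.\<close>
  have e3: "v $ 3 = v \<bullet> axis 3 1" for v :: "real^3" by (simp add: inner_axis)
  have s1: "(\<Sum>v\<in>(Basis :: (real^3) set). (v $ 3)\<^sup>2) = 1"
    using euclidean_inner[of "axis 3 (1::real) :: real^3" "axis 3 1"]
    by (simp add: inner_axis_axis power2_eq_square inner_commute e3)
  have s2: "(\<Sum>v\<in>Basis. (x \<bullet> v)\<^sup>2) = 1"
    using euclidean_inner[of x x] x(1) by (simp add: power2_eq_square dot_square_norm)
  have s3: "(\<Sum>v\<in>Basis. (v $ 3) * (x \<bullet> v)) = x $ 3"
    using euclidean_inner[of "axis 3 (1::real) :: real^3" x]
    by (simp add: inner_commute e3)
  have s4: "(\<Sum>v\<in>(Basis :: (real^3) set). v \<bullet> v) = 3"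
    by (simp add: inner_Basis)
  have "(\<Sum>v\<in>Basis. (zonal_height' v x)\<^sup>2)
      = (\<Sum>v\<in>Basis. (v $ 3)\<^sup>2 / 4 - x $ 3 / 2 * (v $ 3 * (x \<bullet> v)) + (x $ 3)\<^sup>2 / 4 * (x \<bullet> v)\<^sup>2)"
    by (intro sum.cong) (auto simp: zonal_height'_def x power2_eq_square field_simps)
  also have "\<dots> = 1 / 4 - x $ 3 / 2 * (x $ 3) + (x $ 3)\<^sup>2 / 4"
    by (simp add: sum.distrib sum_subtractf s1 s2 s3 flip: sum_distrib_left sum_divide_distrib)
  also have "\<dots> = y * (1 - y)" by (simp add: assms(2) power2_eq_square field_simps)
  finally have A: "(\<Sum>v\<in>Basis. (zonal_height' v x)\<^sup>2) = y * (1 - y)" .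
  have "(\<Sum>v\<in>Basis. zonal_height'' v v x)
      = (\<Sum>v\<in>Basis. - 3 * (x $ 3) / 2 * (x \<bullet> v)\<^sup>2 + v $ 3 * (x \<bullet> v) + x $ 3 / 2 * (v \<bullet> v))"
    by (intro sum.cong) (auto simp: zonal_height''_def x power2_eq_square field_simps)
  also have "\<dots> = - 3 * (x $ 3) / 2 * 1 + x $ 3 + x $ 3 / 2 * 3"
    by (simp only: sum.distrib s2 s3 s4 flip: sum_distrib_left)
  also have "\<dots> = 1 - 2 * y" by (simp add: assms(2) field_simps)
  finally have B: "(\<Sum>v\<in>Basis. zonal_height'' v v x) = 1 - 2 * y" .
  have "laplace_beltrami (zonal q) x
    = poly (pderiv (pderiv q)) y * (\<Sum>v\<in>Basis. (zonal_height' v x)\<^sup>2)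
      + poly (pderiv q) y * (\<Sum>v\<in>Basis. zonal_height'' v v x)"
    unfolding laplace_beltrami_def laplacian_def d2 by (simp add: sum.distrib sum_distrib_left)
  then show ?thesis unfolding A B by simp
qed

text \<open>The coefficients of the hypergeometric series 2F1(-n, n + 1; 1; y). The numerator k (k +
  1) - n (n + 1) = (k - n) (k + n + 1) vanishes at k = n and ends the series there.\<close>

fun legendre_coeff :: "nat \<Rightarrow> nat \<Rightarrow> real" where
  "legendre_coeff n 0 = 1"
| "legendre_coeff n (Suc k) = legendre_coeff n k * (real k * (real k + 1) - real n * (real n + 1)) / (real k + 1)\<^sup>2"

text \<open>In terms of the classical polynomials, \<open>legendre n\<close> at \<open>y\<close> is \<open>P\<^sub>n (1 - 2 y)\<close>.\<close>

definition legendre :: "nat \<Rightarrow> real poly" where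
  "legendre n = (\<Sum>k\<le>n. monom (legendre_coeff n k) k)"

lemma coeff_legendre: "coeff (legendre n) k = legendre_coeff n k"
proof -
  have z: "legendre_coeff n (Suc n + j) = 0" for j by (induction j) auto
  have "legendre_coeff n k = 0" if "\<not> k \<le> n"
    using z[of "k - Suc n"] that by simp
  then show ?thesis by (auto simp: legendre_def coeff_sum)
qed

lemma legendre_coeff_nonzero: "k \<le> n \<Longrightarrow> legendre_coeff n k \<noteq> 0"
proof (induction k)
  case (Suc k)
  have "real k * (real k + 1) < real n * (real n + 1)"
    using Suc.prems by (intro mult_strict_mono) auto
  then show ?case using Suc by auto
qed simp

lemma poly_legendre_0: "poly (legendre n) 0 = 1"
  by (simp add: poly_0_coeff_0 coeff_legendre)

text \<open>On coefficients the equation is exactly the recursion of \<open>legendre_coeff\<close>,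
  so that zonal Legendre polynomials are eigenfunctions of the Laplacian. The orders 0 and 1 are
  split off because multiplication by y and y^2 shifts the index.\<close>

lemma legendre_ODE:
  "y * (1 - y) * poly (pderiv (pderiv (legendre n))) y + (1 - 2 * y) * poly (pderiv (legendre n)) y
    = - (real n * (real n + 1)) * poly (legendre n) y"
proof -
  define P where "P = legendre n"
  have "[:0, 1:] * pderiv (pderiv P) - [:0, 0, 1:] * pderiv (pderiv P) + pderiv P - [:0, 2:] * pderiv P
    = smult (- (real n * (real n + 1))) P"
  proof (rule poly_eqI)
    fix k
    show "coeff ([:0, 1:] * pderiv (pderiv P) - [:0, 0, 1:] * pderiv (pderiv P) + pderiv P - [:0, 2:] * pderiv P) k
      = coeff (smult (- (real n * (real n + 1))) P) k"
    proof (cases k)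
      case 0
      then show ?thesis by (simp add: coeff_pderiv P_def coeff_legendre)
    next
      case (Suc j)
      show ?thesis
      proof (cases j)
        case 0
        then show ?thesis using Suc by (simp add: coeff_pderiv P_def coeff_legendre field_simps)
      next
        case (Suc i)
        have s: "legendre_coeff n (Suc k) * (real k + 1)\<^sup>2 = legendre_coeff n k * (real k * (real k + 1) - real n * (real n + 1))"
          by simp
        then have "coeff P (Suc k) * (real k + 1)\<^sup>2 = coeff P k * (real k * (real k + 1) - real n * (real n + 1))"
          by (simp only: P_def coeff_legendre)
        then show ?thesis using Suc \<open>k = Suc j\<close>
          by (simp add: coeff_pderiv coeff_pCons algebra_simps power2_eq_square)
      qed
    qed
  qed
  then have "poly ([:0, 1:] * pderiv (pderiv P) - [:0, 0, 1:] * pderiv (pderiv P) + pderiv P - [:0, 2:] * pderiv P) y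
    = poly (smult (- (real n * (real n + 1))) P) y" by simp
  then show ?thesis by (simp add: P_def algebra_simps)
qed

text \<open>The passage from monomials to Legendre polynomials is triangular with nonzero diagonal,
  so each monomial is recovered from its Legendre polynomial and lower monomials. Linear statements
  about polynomials can then be tested on \<open>legendre n\<close> alone.\<close>

lemma poly_legendre_induct:
  assumes add: "\<And>p q. P p \<Longrightarrow> P q \<Longrightarrow> P (p + q)" and scale: "\<And>c p. P p \<Longrightarrow> P (smult c p)"
    and leg: "\<And>n. P (legendre n)"
  shows "P p"
proof -
  have P0: "P 0" using scale[OF leg, of 0 0] by simp
  have sm: "P (sum f S)" if "finite S" "\<And>k. k \<in> S \<Longrightarrow> P (f k)" for f :: "nat \<Rightarrow> real poly" and S
    using that by (induction S rule: finite_induct) (auto simp: add P0)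
  have mono: "P (monom 1 n)" for n
  proof (induction n rule: less_induct)
    case (less n)
    have c: "legendre_coeff n n \<noteq> 0" by (simp add: legendre_coeff_nonzero)
    have "legendre n = (\<Sum>k<n. smult (legendre_coeff n k) (monom 1 k)) + smult (legendre_coeff n n) (monom 1 n)"
      by (simp add: legendre_def smult_monom flip: lessThan_Suc_atMost)
    then have "smult (1 / legendre_coeff n n) (legendre n + smult (- 1) (\<Sum>k<n. smult (legendre_coeff n k) (monom 1 k))) = monom 1 n"
      using c by simp
    moreover have "P (smult (1 / legendre_coeff n n) (legendre n + smult (- 1) (\<Sum>k<n. smult (legendre_coeff n k) (monom 1 k))))"
      by (intro scale add leg sm) (auto intro: scale less)
    ultimately show ?case by simp
  qed
  have "P (\<Sum>k\<le>degree p. smult (coeff p k) (monom 1 k))"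
    by (intro sm scale mono) auto
  then show ?thesis by (simp add: smult_monom poly_as_sum_of_monoms)
qed

text \<open>\<open>abel_coeff k\<close> is the value of
  \<open>\<integral> 2 y\<^sup>k / sqrt (2 (a - y)) dy\<close> over \<open>[0, a]\<close>, divided by the power \<open>k + 1/2\<close> of \<open>a\<close>.\<close>

fun abel_coeff :: "nat \<Rightarrow> real" where
  "abel_coeff 0 = 2 * sqrt 2"
| "abel_coeff (Suc k) = abel_coeff k * (real k + 1) / (real k + 3 / 2)"

text \<open>The left side is what the Abel transform makes of \<open>legendre n\<close> at s = 2 u.
  As a polynomial in sin u it satisfies w'' = - m^2 w with m = 2 n + 1, by the combined recursions
  of the two coefficient families; the initial values at 0 then identify it.\<close>

lemma sin_multiple_expansion:
  "(\<Sum>k\<le>n. legendre_coeff n k * abel_coeff k * sin u ^ (2 * k + 1))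
    = 2 * sqrt 2 / (2 * real n + 1) * sin ((2 * real n + 1) * u)"
proof -
  define c where "c k = legendre_coeff n k * abel_coeff k" for k
  define w :: "real \<Rightarrow> real" where "w u = (\<Sum>k\<le>n. c k * sin u ^ (2 * k + 1))" for u
  define w1 :: "real \<Rightarrow> real" where "w1 u = (\<Sum>k\<le>n. c k * ((2 * real k + 1) * sin u ^ (2 * k) * cos u))" for u
  define m where "m = 2 * real n + 1"
  \<comment> \<open>The denominators k + 1 and k + 3/2 left by the two recursions are the halves of
    the factors produced by differentiating sin u ^ (2 k + 3) twice.\<close>
  have rec: "c (Suc k) * ((2 * real k + 3) * (2 * real k + 2)) = c k * ((2 * real k + 1)\<^sup>2 - m\<^sup>2)" for k
  proof -
    define p r X where "p = real k + 1" and "r = real k + 3 / 2" and "X = real k * (real k + 1) - real n * (real n + 1)"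
    have pr: "p \<noteq> 0" "r \<noteq> 0" by (auto simp: p_def r_def)
    have "c (Suc k) * ((2 * r) * (2 * p)) = c k * (4 * X)"
      unfolding c_def legendre_coeff.simps abel_coeff.simps
      unfolding X_def[symmetric] r_def[symmetric] unfolding p_def[symmetric]
      using pr by (simp add: power2_eq_square)
    moreover have "4 * X = (2 * real k + 1)\<^sup>2 - m\<^sup>2"
      by (simp add: X_def m_def power2_eq_square algebra_simps)
    moreover have "2 * r = 2 * real k + 3" "2 * p = 2 * real k + 2" by (simp_all add: p_def r_def)
    ultimately show ?thesis by simp
  qed
  have cz: "c (Suc n) = 0" by (simp add: c_def)
  have dw: "(w has_real_derivative w1 u) (at u)" for u
    unfolding w_def w1_def
  proof (intro DERIV_sum DERIV_cmult)
    fix k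
    show "((\<lambda>u. sin u ^ (2 * k + 1)) has_real_derivative (2 * real k + 1) * sin u ^ (2 * k) * cos u) (at u)"
      using DERIV_fun_pow[OF DERIV_sin, of "2 * k + 1" u] by (simp add: add.commute)
  qed
  have dw1: "(w1 has_real_derivative - m\<^sup>2 * w u) (at u)" for u
  proof -
    have "(w1 has_real_derivative (\<Sum>k\<le>n. c k * ((2 * real k + 1) * (2 * real k) * sin u ^ (2 * k - 1) * (cos u)\<^sup>2
        - (2 * real k + 1) * sin u ^ (2 * k + 1)))) (at u)"
      unfolding w1_def
    proof (intro DERIV_sum DERIV_cmult)
      fix k
      have "((\<lambda>u. sin u ^ (2 * k)) has_real_derivative real (2 * k) * sin u ^ (2 * k - 1) * cos u) (at u)"
        using DERIV_fun_pow[OF DERIV_sin, of "2 * k" u] by simp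
      from DERIV_cmult[OF DERIV_mult[OF this DERIV_cos], of "2 * real k + 1"]
      show "((\<lambda>u. (2 * real k + 1) * sin u ^ (2 * k) * cos u) has_real_derivative
        (2 * real k + 1) * (2 * real k) * sin u ^ (2 * k - 1) * (cos u)\<^sup>2
        - (2 * real k + 1) * sin u ^ (2 * k + 1)) (at u)"
        by (simp add: power2_eq_square algebra_simps)
    qed
    also have "(\<Sum>k\<le>n. c k * ((2 * real k + 1) * (2 * real k) * sin u ^ (2 * k - 1) * (cos u)\<^sup>2
        - (2 * real k + 1) * sin u ^ (2 * k + 1)))
      = (\<Sum>k\<le>n. c k * ((2 * real k + 1) * (2 * real k)) * sin u ^ (2 * k - 1)
          - c k * (2 * real k + 1)\<^sup>2 * sin u ^ (2 * k + 1))"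
    proof (intro sum.cong refl)
      fix k
      show "c k * ((2 * real k + 1) * (2 * real k) * sin u ^ (2 * k - 1) * (cos u)\<^sup>2
        - (2 * real k + 1) * sin u ^ (2 * k + 1)) = c k * ((2 * real k + 1) * (2 * real k)) * sin u ^ (2 * k - 1)
          - c k * (2 * real k + 1)\<^sup>2 * sin u ^ (2 * k + 1)"
      proof (cases k)
        case (Suc j)
        define P Q where "P = sin u ^ (2 * k - 1)" and "Q = sin u ^ (2 * k + 1)"
        have "Q = P * (sin u)\<^sup>2" using Suc by (simp add: P_def Q_def flip: power_add)
        then have PQ: "P * (cos u)\<^sup>2 = P - Q" by (simp add: cos_squared_eq algebra_simps)
        have "c k * ((2 * real k + 1) * (2 * real k) * P * (cos u)\<^sup>2 - (2 * real k + 1) * Q)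
          = c k * ((2 * real k + 1) * (2 * real k) * (P * (cos u)\<^sup>2) - (2 * real k + 1) * Q)"
          by (simp only: mult.assoc)
        also have "\<dots> = c k * ((2 * real k + 1) * (2 * real k)) * P - c k * (2 * real k + 1)\<^sup>2 * Q"
          unfolding PQ by (simp add: power2_eq_square algebra_simps)
        finally show ?thesis unfolding P_def Q_def .
      qed simp
    qed
    also have "\<dots> = (\<Sum>k\<le>n. c k * ((2 * real k + 1) * (2 * real k)) * sin u ^ (2 * k - 1))
        - (\<Sum>k\<le>n. c k * (2 * real k + 1)\<^sup>2 * sin u ^ (2 * k + 1))" by (rule sum_subtractf)
    \<comment> \<open>Adding the vanishing term of index n + 1 makes room for an index shift; the
      term of index 0 is killed by its factor 2 k, whatever the truncated exponent is.\<close>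
    also have "(\<Sum>k\<le>n. c k * ((2 * real k + 1) * (2 * real k)) * sin u ^ (2 * k - 1))
       = (\<Sum>k\<le>Suc n. c k * ((2 * real k + 1) * (2 * real k)) * sin u ^ (2 * k - 1))"
      by (simp add: cz)
    also have "\<dots> = (\<Sum>k\<le>n. c (Suc k) * ((2 * real k + 3) * (2 * real k + 2)) * sin u ^ (2 * k + 1))"
      by (subst sum.atMost_Suc_shift) (simp add: algebra_simps)
    also have "\<dots> - (\<Sum>k\<le>n. c k * (2 * real k + 1)\<^sup>2 * sin u ^ (2 * k + 1)) = - m\<^sup>2 * w u"
      unfolding rec w_def by (simp add: sum_distrib_left algebra_simps flip: sum_subtractf)
    finally show ?thesis .
  qed
  have m: "m > 0" by (simp add: m_def)
  \<comment> \<open>Uniqueness by energy: \<open>e\<close> solves the oscillator equation with zero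
    initial data, and e'^2 + m^2 e^2 is conserved.\<close>
  define e where "e u = w u - 2 * sqrt 2 / m * sin (m * u)" for u
  define e1 where "e1 u = w1 u - 2 * sqrt 2 * cos (m * u)" for u
  have de: "(e has_real_derivative e1 u) (at u)" "(e1 has_real_derivative - m\<^sup>2 * e u) (at u)" for u
    unfolding e_def e1_def using m
    by (auto intro!: derivative_eq_intros dw dw1 simp: field_simps power2_eq_square)
  have "((\<lambda>u. (e1 u)\<^sup>2 + m\<^sup>2 * (e u)\<^sup>2) has_real_derivative 0) (at u)" for u
    by (auto intro!: derivative_eq_intros de simp: algebra_simps)
  then have "(e1 u)\<^sup>2 + m\<^sup>2 * (e u)\<^sup>2 = (e1 0)\<^sup>2 + m\<^sup>2 * (e 0)\<^sup>2"
    by (intro DERIV_isconst_all) auto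
  moreover have "e 0 = 0" by (simp add: e_def w_def)
  moreover have "e1 0 = 0"
  proof -
    have "w1 0 = (\<Sum>k\<le>n. if k = 0 then 2 * sqrt 2 else 0)"
      unfolding w1_def by (intro sum.cong) (auto simp: c_def power_0_left)
    then show ?thesis by (simp add: e1_def)
  qed
  ultimately have "(e1 u)\<^sup>2 + m\<^sup>2 * (e u)\<^sup>2 = 0" by simp
  then have "m\<^sup>2 * (e u)\<^sup>2 \<le> 0" using zero_le_power2[of "e1 u"] by linarith
  then have "e u = 0" using m by (simp add: mult_le_0_iff)
  then show ?thesis by (simp add: e_def w_def c_def m_def)
qed

section \<open>Legendre moments of the heat kernel\<close>

lemma space_sphere_area [simp]: "space sphere_area = S2"
  and sets_sphere_area [simp, measurable_cong]: "sets sphere_area = sets (restrict_space borel S2)"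
  by (simp_all add: sphere_area_def space_restrict_space)

lemma sphere_density_measurable:
  "(\<lambda>z. indicator ({0..pi} \<times> {0..2*pi}) z * sin (fst z) :: real) \<in> borel_measurable borel"
proof -
  have "{0..pi} \<times> {0..2*pi} \<in> sets (borel :: (real \<times> real) measure)"
    by (intro borel_closed closed_Times) auto
  then show ?thesis by (intro borel_measurable_times borel_measurable_indicator) (auto intro!: borel_measurable_continuous_onI continuous_intros)
qed

lemma sphere_density_nonneg: "0 \<le> indicator ({0..pi} \<times> {0..2*pi}) z * sin (fst z)"
  by (auto simp: indicator_def sin_ge_zero split: prod.splits)

lemma integral_sphere_area:
  assumes "f \<in> borel_measurable (restrict_space borel S2)"
  shows "(\<integral>x. f x \<partial>sphere_area)
    = (\<integral>z. indicator ({0..pi} \<times> {0..2*pi}) z * sin (fst z) * f (sphere_param z) \<partial>lborel)"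
proof -
  have m: "(\<lambda>z. f (sphere_param z)) \<in> borel_measurable borel"
    using measurable_compose[OF measurable_sphere_param assms] by simp
  have "(\<integral>x. f x \<partial>sphere_area) = (\<integral>z. f (sphere_param z) \<partial>density lborel
              (\<lambda>z. ennreal (indicator ({0..pi} \<times> {0..2*pi}) z * sin (fst z))))"
    unfolding sphere_area_def by (rule integral_distr) (use measurable_sphere_param assms in auto)
  also have "\<dots> = (\<integral>z. (indicator ({0..pi} \<times> {0..2*pi}) z * sin (fst z)) *\<^sub>R f (sphere_param z) \<partial>lborel)"
  proof (rule integral_density)
    show "AE z in lborel. 0 \<le> indicator ({0..pi} \<times> {0..2*pi}) z * sin (fst z)"
      by (intro AE_I2 sphere_density_nonneg)
  qed (simp_all add: m sphere_density_measurable)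
  finally show ?thesis by simp
qed

lemma finite_measure_sphere_area: "finite_measure sphere_area"
proof
  define b where "b = ({0..pi} \<times> {0..2*pi} :: (real \<times> real) set)"
  have bm: "b \<in> sets borel" unfolding b_def by (intro borel_closed closed_Times) auto
  have "emeasure sphere_area (space sphere_area) = emeasure (density lborel
              (\<lambda>z. ennreal (indicator b z * sin (fst z)))) UNIV"
    unfolding sphere_area_def b_def
  proof (subst emeasure_distr)
    have sp: "space (restrict_space borel S2) = S2" by (simp add: space_restrict_space)
    show "space (distr (density lborel (\<lambda>z. ennreal (indicator ({0..pi} \<times> {0..2*pi}) z * sin (fst z))))
           (restrict_space borel S2) sphere_param) \<in> sets (restrict_space borel S2)"
      using sets.top[of "restrict_space borel S2"] by simp
  qed (use measurable_sphere_param sphere_param_in_S2 in \<open>auto simp: space_restrict_space intro!: arg_cong2[where f = emeasure]\<close>)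
  also have "\<dots> = (\<integral>\<^sup>+z. ennreal (indicator b z * sin (fst z)) \<partial>lborel)"
    using sphere_density_measurable unfolding b_def by (subst emeasure_density) auto
  also have "\<dots> \<le> (\<integral>\<^sup>+z. indicator b z \<partial>lborel)"
    by (intro nn_integral_mono) (auto simp: indicator_def intro: ennreal_leI[of _ 1, simplified])
  also have "\<dots> = emeasure lborel b" using bm by simp
  also have "\<dots> < \<infinity>"
  proof (rule emeasure_bounded_finite)
    show "bounded b" unfolding b_def by (intro bounded_Times) auto
  qed
  finally show "emeasure sphere_area (space sphere_area) \<noteq> \<infinity>" by auto
qed

lemma continuous_on_S2_measurable:
  "continuous_on S2 f \<Longrightarrow> f \<in> borel_measurable (restrict_space borel S2)"
  by (rule borel_measurable_continuous_on_restrict)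

lemma continuous_on_S2_L2:
  assumes "continuous_on S2 f" shows "f \<in> L2_sphere"
proof -
  interpret finite_measure sphere_area by (rule finite_measure_sphere_area)
  have m: "f \<in> borel_measurable sphere_area"
    using continuous_on_S2_measurable[OF assms] by (simp cong: measurable_cong_sets)
  have "bounded (f ` S2)" using assms by (intro compact_imp_bounded compact_continuous_image) auto
  then obtain B where B: "\<forall>x\<in>S2. \<bar>f x\<bar> \<le> B" unfolding bounded_iff by auto
  have "integrable sphere_area (\<lambda>x. (f x)\<^sup>2)"
  proof (rule integrable_const_bound)
    show "AE x in sphere_area. norm ((f x)\<^sup>2) \<le> B\<^sup>2"
    proof (rule AE_I2)
      fix x assume "x \<in> space sphere_area"
      then have "\<bar>f x\<bar> \<le> B" using B by simp
      then show "norm ((f x)\<^sup>2) \<le> B\<^sup>2" using power_mono[of "\<bar>f x\<bar>" B 2] by simp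
    qed
  qed (use m in auto)
  then show ?thesis using m by (simp add: L2_sphere_def)
qed

lemma sphere_area_integral_zonal:
  assumes f: "continuous_on S2 f" and F: "continuous_on {0..pi} F"
    and eq: "\<And>\<theta> \<psi>. \<theta> \<in> {0..pi} \<Longrightarrow> f (sphere_param (\<theta>, \<psi>)) = F \<theta>"
  shows "(\<integral>x. f x \<partial>sphere_area) = 2 * pi * integral {0..pi} (\<lambda>\<theta>. F \<theta> * sin \<theta>)"
proof -
  define u where "u \<theta> = indicator {0..pi} \<theta> * (F \<theta> * sin \<theta>)" for \<theta>
  define v :: "real \<Rightarrow> real" where "v = indicator {0..2 * pi}"
  have c: "continuous_on {0..pi} (\<lambda>\<theta>. F \<theta> * sin \<theta>)" by (intro continuous_intros F)
  have iu: "integrable lborel u" "integral\<^sup>L lborel u = integral {0..pi} (\<lambda>\<theta>. F \<theta> * sin \<theta>)"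
    using borel_integrable_atLeastAtMost'[OF c] set_borel_integral_eq_integral(2)[OF borel_integrable_atLeastAtMost'[OF c]]
    by (simp_all add: set_integrable_def set_lebesgue_integral_def u_def[abs_def])
  have iv: "integrable lborel v" "integral\<^sup>L lborel v = 2 * pi"
    by (simp_all add: v_def)
  have [measurable]: "u \<in> borel_measurable borel" "v \<in> borel_measurable borel" using iu iv by auto
  have iuv: "integrable (lborel \<Otimes>\<^sub>M lborel) (\<lambda>(x, y). u x * v y)"
  proof (rule lborel_pair.Fubini_integrable)
    show "integrable lborel (\<lambda>x. LINT y|lborel. norm (case (x, y) of (x, y) \<Rightarrow> u x * v y))"
      using iu by (simp add: abs_mult)
  qed (use iu iv in \<open>auto simp: case_prod_beta\<close>)
  have "(\<integral>x. f x \<partial>sphere_area) = (\<integral>z. (case z of (x, y) \<Rightarrow> u x * v y) \<partial>lborel)"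
    unfolding integral_sphere_area[OF continuous_on_S2_measurable[OF f]]
  proof (rule Bochner_Integration.integral_cong)
    fix z :: "real \<times> real"
    obtain a b where z: "z = (a, b)" by (cases z)
    show "indicator ({0..pi} \<times> {0..2*pi}) z * sin (fst z) * f (sphere_param z) = (case z of (x, y) \<Rightarrow> u x * v y)"
      using eq[of a b] by (cases "a \<in> {0..pi}") (auto simp: z u_def v_def indicator_def)
  qed simp
  also have "\<dots> = (\<integral>x. (\<integral>y. u x * v y \<partial>lborel) \<partial>lborel)"
    unfolding lborel_prod[symmetric] using lborel_pair.integral_fst'[OF iuv] by simp
  also have "\<dots> = 2 * pi * integral {0..pi} (\<lambda>\<theta>. F \<theta> * sin \<theta>)"
    using iu iv by simp
  finally show ?thesis .
qed

lemma inner_north_pole: "sphere_param (0, 0) \<bullet> sphere_param (\<theta>, \<psi>) = cos \<theta>"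
  and sphere_param_nth_3: "sphere_param (\<theta>, \<psi>) $ 3 = cos \<theta>"
  by (simp_all add: sphere_param_def inner_vec_def sum_3)

text \<open>The pole itself is a null set, so an almost everywhere identity says nothing there. It
  does hold at points arbitrarily close to the pole, which is enough for identities between
  continuous functions.\<close>

lemma AE_sphere_area_tendsto_north_pole:
  assumes "AE x in sphere_area. P x"
  shows "\<exists>X. (\<forall>n. X n \<in> S2 \<and> P (X n)) \<and> X \<longlonglongrightarrow> sphere_param (0, 0)"
proof -
  define \<mu> where "\<mu> = density lborel (\<lambda>z. ennreal (indicator ({0..pi} \<times> {0..2*pi}) z * sin (fst z)))"
  have "sphere_param \<in> measurable \<mu> (restrict_space borel S2)"
    by (subst measurable_cong_sets[of \<mu> borel, OF _ refl]) (auto simp: \<mu>_def measurable_sphere_param)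
  then have "AE z in \<mu>. P (sphere_param z)"
    using assms[unfolded sphere_area_def, folded \<mu>_def] by (rule AE_distrD)
  then have ae: "AE z in lborel. 0 < indicator ({0..pi} \<times> {0..2*pi}) z * sin (fst z) \<longrightarrow> P (sphere_param z)"
    unfolding \<mu>_def using sphere_density_measurable by (subst (asm) AE_density) auto
  have "\<exists>z. fst z \<in> {0<..<1 / real (Suc n)} \<and> snd z \<in> {0<..<1 / real (Suc n)} \<and> P (sphere_param z)" for n
  proof (rule ccontr)
    assume neg: "\<not> ?thesis"
    \<comment> \<open>On this open square the density sin \<theta> is strictly positive; if the
      property failed throughout, a nonempty open set would be negligible.\<close>
    define U where "U = {0<..<1 / real (Suc n)} \<times> {0<..<1 / real (Suc n)}"
    have U: "open U" "U \<noteq> {}" by (auto simp: U_def intro: open_Times)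
    have "1 / real (Suc n) \<le> 1" by simp
    then have one: "x < pi" "x \<le> 2 * pi" if "x < 1 / real (Suc n)" for x using that pi_gt3 by linarith+
    have "AE z in lborel. z \<notin> U"
      using ae
    proof eventually_elim
      case (elim z)
      show ?case
      proof
        assume "z \<in> U"
        then have "0 < sin (fst z)" "z \<in> {0..pi} \<times> {0..2*pi}" "\<not> P (sphere_param z)"
          using neg one by (auto simp: U_def intro!: sin_gt_zero less_imp_le)
        then show False using elim by simp
      qed
    qed
    then have "U \<in> null_sets lborel" using U(1) by (subst (asm) AE_iff_null_sets[symmetric]) auto
    then have "negligible U" by (simp add: negligible_iff_null_sets null_sets_completionI)
    then show False using open_not_negligible[OF U] by simp
  qed
  then obtain z where z: "\<And>n. fst (z n) \<in> {0<..<1 / real (Suc n)} \<and> snd (z n) \<in> {0<..<1 / real (Suc n)} \<and> P (sphere_param (z n))"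
    by metis
  have lim: "(\<lambda>n. 1 / real (Suc n)) \<longlonglongrightarrow> 0" using LIMSEQ_inverse_real_of_nat by (simp add: inverse_eq_divide)
  have "(\<lambda>n. fst (z n)) \<longlonglongrightarrow> 0" "(\<lambda>n. snd (z n)) \<longlonglongrightarrow> 0"
    using z by (auto intro!: tendsto_sandwich[OF _ _ tendsto_const lim] always_eventually less_imp_le)
  then have "(\<lambda>n. (fst (z n), snd (z n))) \<longlonglongrightarrow> (0, 0)" by (rule tendsto_Pair)
  then have "z \<longlonglongrightarrow> (0, 0)" by simp
  then have "(\<lambda>n. sphere_param (z n)) \<longlonglongrightarrow> sphere_param (0, 0)"
    by (rule continuous_on_tendsto_compose[OF continuous_on_sphere_param[of UNIV]]) auto
  then show ?thesis using z sphere_param_in_S2 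
    by (intro exI[of _ "\<lambda>n. sphere_param (z n)"]) auto
qed

lemma kernel_integral_tendsto:
  assumes p: "continuous_on (S2 \<times> S2) (\<lambda>(\<xi>, \<eta>). p \<xi> \<eta> :: real)" and f: "continuous_on S2 f"
    and X: "\<And>n. X n \<in> S2" "X \<longlonglongrightarrow> x" "x \<in> S2"
  shows "(\<lambda>n. \<integral>\<eta>. p (X n) \<eta> * f \<eta> \<partial>sphere_area) \<longlonglongrightarrow> (\<integral>\<eta>. p x \<eta> * f \<eta> \<partial>sphere_area)"
proof -
  interpret finite_measure sphere_area by (rule finite_measure_sphere_area)
  have c: "continuous_on (S2 \<times> S2) (\<lambda>z. p (fst z) (snd z) * f (snd z))"
    using p by (intro continuous_intros continuous_on_compose2[OF f]) (auto simp: case_prod_beta)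
  have "bounded ((\<lambda>z. p (fst z) (snd z) * f (snd z)) ` (S2 \<times> S2))"
    by (intro compact_imp_bounded compact_continuous_image c compact_Times) auto
  then obtain B where B: "\<forall>\<xi>\<in>S2. \<forall>\<eta>\<in>S2. \<bar>p \<xi> \<eta> * f \<eta>\<bar> \<le> B"
    unfolding bounded_iff by (auto simp del: mem_sphere)
  have cs: "continuous_on S2 (\<lambda>\<eta>. p \<xi> \<eta> * f \<eta>)" if "\<xi> \<in> S2" for \<xi>
  proof -
    have "continuous_on S2 (\<lambda>\<eta>. (\<xi>, \<eta>))"
      by (intro continuous_on_Pair continuous_on_const continuous_on_id)
    moreover have "(\<lambda>\<eta>. (\<xi>, \<eta>)) ` S2 \<subseteq> S2 \<times> S2" using that by auto
    ultimately show ?thesis using continuous_on_compose2[OF c] by fastforce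
  qed
  have m: "(\<lambda>\<eta>. p \<xi> \<eta> * f \<eta>) \<in> borel_measurable sphere_area" if "\<xi> \<in> S2" for \<xi>
    using continuous_on_S2_measurable[OF cs[OF that]] by (simp cong: measurable_cong_sets)
  show ?thesis
  proof (rule integral_dominated_convergence[where w = "\<lambda>_. B"])
    show "AE \<eta> in sphere_area. (\<lambda>n. p (X n) \<eta> * f \<eta>) \<longlonglongrightarrow> p x \<eta> * f \<eta>"
    proof (rule AE_I2)
      fix \<eta> assume "\<eta> \<in> space sphere_area"
      then have e: "\<eta> \<in> S2" by simp
      have "(\<lambda>n. (X n, \<eta>)) \<longlonglongrightarrow> (x, \<eta>)" by (intro tendsto_intros X)
      from continuous_on_tendsto_compose[OF c this] e X
      show "(\<lambda>n. p (X n) \<eta> * f \<eta>) \<longlonglongrightarrow> p x \<eta> * f \<eta>" by auto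
    qed
    show "AE \<eta> in sphere_area. norm (p (X n) \<eta> * f \<eta>) \<le> B" for n
      using B X(1)[of n] by (intro AE_I2) auto
  qed (use m X in auto)
qed

lemma zonal_continuous: "continuous_on A (zonal q)"
  unfolding zonal_def[abs_def] by (intro continuous_intros) auto

text \<open>Along a meridian from the north pole the geodesic distance is the polar angle itself, so
  \<open>K t\<close> is a restriction of the continuous kernel.\<close>

lemma heat_kernel_profile_continuous:
  assumes "heat_kernel_profile K" "t > 0"
  shows "continuous_on {0..pi} (K t)"
proof -
  obtain p where p: "heat_kernel p" and pK: "\<forall>t>0. \<forall>\<xi>\<in>S2. \<forall>\<eta>\<in>S2. p t \<xi> \<eta> = K t (arccos (\<xi> \<bullet> \<eta>))"
    using assms by (auto simp: heat_kernel_profile_def)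
  have c: "continuous_on (S2 \<times> S2) (\<lambda>(\<xi>, \<eta>). p t \<xi> \<eta>)" using p assms by (auto simp: heat_kernel_def)
  have "continuous_on {0..pi} (\<lambda>\<phi>. (sphere_param (0, 0), sphere_param (\<phi>, 0)))"
    by (intro continuous_intros continuous_on_compose2[OF continuous_on_sphere_param[of UNIV]]) auto
  moreover have "(\<lambda>\<phi>. (sphere_param (0, 0), sphere_param (\<phi>, 0))) ` {0..pi} \<subseteq> S2 \<times> S2"
    using sphere_param_in_S2 by auto
  ultimately have "continuous_on {0..pi} (\<lambda>\<phi>. p t (sphere_param (0, 0)) (sphere_param (\<phi>, 0)))"
    using continuous_on_compose2[OF c] by fastforce
  moreover have "p t (sphere_param (0, 0)) (sphere_param (\<phi>, 0)) = K t \<phi>" if "\<phi> \<in> {0..pi}" for \<phi>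
  proof -
    have "sphere_param (0, 0) \<bullet> sphere_param (\<phi>, 0) = cos \<phi>"
      by (rule inner_north_pole)
    moreover have "p t (sphere_param (0, 0)) (sphere_param (\<phi>, 0)) = K t (arccos (sphere_param (0, 0) \<bullet> sphere_param (\<phi>, 0)))"
      using pK assms(2) sphere_param_in_S2 by blast
    ultimately show ?thesis using that by (simp add: arccos_cos)
  qed
  ultimately show ?thesis by (rule continuous_on_eq)
qed

lemma heat_kernel_profile_legendre_moment:
  assumes "heat_kernel_profile K" "t > 0"
  shows "2 * pi * integral {0..pi} (\<lambda>\<phi>. K t \<phi> * poly (legendre n) ((1 - cos \<phi>) / 2) * sin \<phi>)
    = exp (- (real n * (real n + 1)) * t)"
proof -
  define q where "q = legendre n"
  obtain p where p: "heat_kernel p" and pK: "\<forall>t>0. \<forall>\<xi>\<in>S2. \<forall>\<eta>\<in>S2. p t \<xi> \<eta> = K t (arccos (\<xi> \<bullet> \<eta>))"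
    using assms by (auto simp: heat_kernel_profile_def)
  have c: "continuous_on (S2 \<times> S2) (\<lambda>(\<xi>, \<eta>). p t \<xi> \<eta>)" using p assms by (auto simp: heat_kernel_def)
  obtain S where S: "heat_semigroup S"
    and ker: "\<And>f. f \<in> L2_sphere \<Longrightarrow> AE \<xi> in sphere_area. S t f \<xi> = (\<integral>\<eta>. p t \<xi> \<eta> * f \<eta> \<partial>sphere_area)"
    using p assms by (auto simp: heat_kernel_def)
  have fL: "zonal q \<in> L2_sphere" by (intro continuous_on_S2_L2 zonal_continuous)
  have LB: "laplace_beltrami (zonal q) x = - (real n * (real n + 1)) * zonal q x" if "x \<in> S2" for x
    unfolding laplace_beltrami_zonal[OF that refl] unfolding q_def legendre_ODE by (simp add: zonal_def)
  have "continuous_on S2 (laplace_beltrami (zonal q))"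
    by (rule continuous_on_eq[OF continuous_on_mult_left[OF zonal_continuous[of S2 q], of "- (real n * (real n + 1))"]])
       (rule LB[symmetric])
  then have lb: "laplace_beltrami (zonal q) \<in> L2_sphere" by (rule continuous_on_S2_L2)
  have "AE x in sphere_area. S t (zonal q) x = exp (- (real n * (real n + 1)) * t) * zonal q x"
  proof (rule heat_semigroup_eigenfunction[OF S fL zonal_C2_sphere _ lb])
    show "AE x in sphere_area. laplace_beltrami (zonal q) x = - (real n * (real n + 1)) * zonal q x"
      using LB by (intro AE_I2) simp
  qed (use assms(2) in simp)
  with ker[OF fL] have "AE x in sphere_area. (\<integral>\<eta>. p t x \<eta> * zonal q \<eta> \<partial>sphere_area)
      = exp (- (real n * (real n + 1)) * t) * zonal q x"
    by eventually_elim simp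
  \<comment> \<open>The eigenvalue relation holds almost everywhere; both of its sides depend
    continuously on the point, which carries it to the pole, where the zonal function equals
    1.\<close>
  from AE_sphere_area_tendsto_north_pole[OF this] obtain X where X: "\<And>n. X n \<in> S2" "X \<longlonglongrightarrow> sphere_param (0, 0)"
    and eq: "\<And>m. (\<integral>\<eta>. p t (X m) \<eta> * zonal q \<eta> \<partial>sphere_area)
      = exp (- (real n * (real n + 1)) * t) * zonal q (X m)"
    by auto
  have e3: "sphere_param (0, 0) \<in> S2" by (rule sphere_param_in_S2)
  have "(\<lambda>m. zonal q (X m)) \<longlonglongrightarrow> zonal q (sphere_param (0, 0))"
    by (rule continuous_on_tendsto_compose[OF zonal_continuous[of UNIV q] X(2)]) auto
  then have "(\<lambda>m. exp (- (real n * (real n + 1)) * t) * zonal q (X m)) \<longlonglongrightarrow> exp (- (real n * (real n + 1)) * t) * zonal q (sphere_param (0, 0))"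
    by (intro tendsto_intros)
  moreover have "zonal q (sphere_param (0, 0)) = 1" by (simp add: zonal_def q_def poly_legendre_0 sphere_param_nth_3)
  ultimately have "(\<lambda>m. exp (- (real n * (real n + 1)) * t) * zonal q (X m)) \<longlonglongrightarrow> exp (- (real n * (real n + 1)) * t)"
    by simp
  then have I: "(\<integral>\<eta>. p t (sphere_param (0, 0)) \<eta> * zonal q \<eta> \<partial>sphere_area) = exp (- (real n * (real n + 1)) * t)"
    using kernel_integral_tendsto[where p = "p t", OF c zonal_continuous[of S2 q] X e3]
    unfolding eq by (intro LIMSEQ_unique)
  have "(\<integral>\<eta>. p t (sphere_param (0, 0)) \<eta> * zonal q \<eta> \<partial>sphere_area)
    = 2 * pi * integral {0..pi} (\<lambda>\<phi>. (K t \<phi> * poly q ((1 - cos \<phi>) / 2)) * sin \<phi>)"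
  proof (rule sphere_area_integral_zonal)
    show "continuous_on S2 (\<lambda>\<eta>. p t (sphere_param (0, 0)) \<eta> * zonal q \<eta>)"
    proof (intro continuous_on_mult zonal_continuous)
      have "continuous_on S2 (\<lambda>\<eta>. (sphere_param (0, 0), \<eta>))"
        by (intro continuous_on_Pair continuous_on_const continuous_on_id)
      moreover have "(\<lambda>\<eta>. (sphere_param (0, 0), \<eta>)) ` S2 \<subseteq> S2 \<times> S2" using e3 by auto
      ultimately show "continuous_on S2 (p t (sphere_param (0, 0)))"
        using continuous_on_compose2[OF c] by fastforce
    qed
    show "continuous_on {0..pi} (\<lambda>\<phi>. K t \<phi> * poly q ((1 - cos \<phi>) / 2))"
      by (intro continuous_intros heat_kernel_profile_continuous assms) auto
    fix \<theta> \<psi> :: real assume th: "\<theta> \<in> {0..pi}"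
    have i: "sphere_param (0, 0) \<bullet> sphere_param (\<theta>, \<psi>) = cos \<theta>" "sphere_param (\<theta>, \<psi>) $ 3 = cos \<theta>"
      by (rule inner_north_pole, rule sphere_param_nth_3)
    moreover have "p t (sphere_param (0, 0)) (sphere_param (\<theta>, \<psi>))
        = K t (arccos (sphere_param (0, 0) \<bullet> sphere_param (\<theta>, \<psi>)))"
      using pK assms(2) sphere_param_in_S2 by blast
    ultimately have "p t (sphere_param (0, 0)) (sphere_param (\<theta>, \<psi>)) = K t \<theta>"
      using th by (simp add: arccos_cos)
    then show "p t (sphere_param (0, 0)) (sphere_param (\<theta>, \<psi>)) * zonal q (sphere_param (\<theta>, \<psi>)) = K t \<theta> * poly q ((1 - cos \<theta>) / 2)"
      using i(2) by (simp add: zonal_def)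
  qed
  with I show ?thesis by (simp add: q_def)
qed

section \<open>The Abel transform\<close>

text \<open>For k = 0 the function -2 sqrt (cos \<phi> - cos s) is an antiderivative. The step
  differentiates y^(k+1) sqrt (cos \<phi> - cos s), which vanishes at both ends, and so links two
  consecutive exponents. The singularity at \<phi> = s is harmless because these antiderivatives are
  continuous there.\<close>

lemma abel_power_has_integral:
  assumes s: "0 \<le> s" "s \<le> pi"
  shows "((\<lambda>\<phi>. ((1 - cos \<phi>) / 2) ^ k * (sin \<phi> / sqrt (cos \<phi> - cos s))) has_integral
    abel_coeff k * sin (s / 2) ^ (2 * k + 1)) {0..s}"
proof (induction k)
  case 0
  have cs: "cos s < cos x" if "0 < x" "x < s" for x using that s by (intro cos_monotone_0_pi) auto
  have "((\<lambda>\<phi>. sin \<phi> / sqrt (cos \<phi> - cos s)) has_integral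
    (- 2 * sqrt (cos s - cos s)) - (- 2 * sqrt (cos 0 - cos s))) {0..s}"
  proof (rule fundamental_theorem_of_calculus_interior)
    fix x assume "x \<in> {0<..<s}"
    then have "cos s < cos x" using cs by simp
    then show "((\<lambda>\<phi>. - 2 * sqrt (cos \<phi> - cos s)) has_vector_derivative sin x / sqrt (cos x - cos s)) (at x)"
      by (auto intro!: derivative_eq_intros simp: divide_simps simp flip: has_real_derivative_iff_has_vector_derivative)
  qed (use s in \<open>auto intro!: continuous_intros\<close>)
  moreover have "sqrt (1 - cos s) = sqrt 2 * sin (s / 2)"
  proof -
    have "1 - cos s = 2 * (sin (s / 2))\<^sup>2" using cos_double_sin[of "s / 2"] by simp
    moreover have "0 \<le> sin (s / 2)" using s by (intro sin_ge_zero) auto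
    ultimately show ?thesis by (simp add: real_sqrt_mult)
  qed
  ultimately show ?case by (simp add: mult.assoc)
next
  case (Suc k)
  define y where "y \<phi> = (1 - cos \<phi>) / 2" for \<phi> :: real
  define F where "F \<phi> = y \<phi> ^ Suc k * sqrt (cos \<phi> - cos s)" for \<phi>
  define f where "f k \<phi> = y \<phi> ^ k * (sin \<phi> / sqrt (cos \<phi> - cos s))" for k \<phi>
  define a where "a = sin (s / 2) ^ 2"
  have a: "cos s = 1 - 2 * a" using cos_double_sin[of "s / 2"] by (simp add: a_def)
  have cs: "cos s < cos x" if "0 < x" "x < s" for x using that s by (intro cos_monotone_0_pi) auto
  have "((\<lambda>\<phi>. (real k + 1) * a * f k \<phi> - (real k + 3 / 2) * f (Suc k) \<phi>) has_integral F s - F 0) {0..s}"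
  proof (rule fundamental_theorem_of_calculus_interior)
    show "continuous_on {0..s} F" unfolding F_def y_def by (intro continuous_intros)  auto
    fix x assume x: "x \<in> {0<..<s}"
    define r where "r = sqrt (cos x - cos s)"
    have r: "r > 0" "r\<^sup>2 = 2 * (a - y x)" using cs[of x] x by (auto simp: r_def y_def a field_simps)
    have dy: "(y has_real_derivative sin x / 2) (at x)"
      unfolding y_def by (auto intro!: derivative_eq_intros)
    have dr: "((\<lambda>x. sqrt (cos x - cos s)) has_real_derivative - sin x / (2 * r)) (at x)"
      using cs[of x] x unfolding r_def by (auto intro!: derivative_eq_intros simp: field_simps)
    have "(F has_real_derivative (real k + 1) * y x ^ k * (sin x / 2) * r + (- sin x / (2 * r)) * y x ^ Suc k) (at x)"
      unfolding F_def using DERIV_mult[OF DERIV_power[OF dy, of "Suc k"] dr]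
      by (simp add: r_def algebra_simps add_divide_distrib)
    moreover have "(real k + 1) * y x ^ k * (sin x / 2) * r + (- sin x / (2 * r)) * y x ^ Suc k
      = (real k + 1) * a * f k x - (real k + 3 / 2) * f (Suc k) x"
    proof -
      \<comment> \<open>The product term is given the same denominator r as the other one, so that
        both become integrands of the family \<open>f\<close>.\<close>
      have "r = 2 * (a - y x) / r" using r by (simp add: field_simps power2_eq_square)
      then have "(real k + 1) * y x ^ k * (sin x / 2) * r = (real k + 1) * y x ^ k * (sin x / 2) * (2 * (a - y x) / r)"
        by (rule arg_cong[where f = "\<lambda>r. (real k + 1) * y x ^ k * (sin x / 2) * r"])
      also have "\<dots> + (- sin x / (2 * r)) * y x ^ Suc k
        = (real k + 1) * a * (y x ^ k * (sin x / r)) - (real k + 3 / 2) * (y x ^ Suc k * (sin x / r))"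
        using r(1) by (simp add: field_simps)
      finally show ?thesis unfolding f_def r_def[symmetric] by simp
    qed
    ultimately show "(F has_vector_derivative (real k + 1) * a * f k x - (real k + 3 / 2) * f (Suc k) x) (at x)"
      by (simp flip: has_real_derivative_iff_has_vector_derivative)
  qed (use s in auto)
  then have A: "((\<lambda>\<phi>. (real k + 1) * a * f k \<phi> - (real k + 3 / 2) * f (Suc k) \<phi>) has_integral 0) {0..s}"
    by (simp add: F_def y_def)
  have B: "((\<lambda>\<phi>. (real k + 1) * a * f k \<phi>) has_integral (real k + 1) * a * (abel_coeff k * sin (s / 2) ^ (2 * k + 1))) {0..s}"
    using has_integral_mult_right[OF Suc.IH, of "(real k + 1) * a"] by (simp add: f_def y_def)
  have "((\<lambda>\<phi>. f (Suc k) \<phi>) has_integral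
      1 / (real k + 3 / 2) * ((real k + 1) * a * (abel_coeff k * sin (s / 2) ^ (2 * k + 1)))) {0..s}"
    using has_integral_mult_right[OF has_integral_diff[OF B A], of "1 / (real k + 3 / 2)"]
    by simp
  also have "1 / (real k + 3 / 2) * ((real k + 1) * a * (abel_coeff k * sin (s / 2) ^ (2 * k + 1)))
    = abel_coeff (Suc k) * sin (s / 2) ^ (2 * Suc k + 1)"
    by (simp add: a_def power2_eq_square)
  finally show ?case by (simp add: f_def y_def)
qed

text \<open>The Abel transform, given by its closed form instead of the singular integral:
  continuity in s is then immediate and the integral is a lemma.\<close>

definition abel :: "real poly \<Rightarrow> real \<Rightarrow> real" where
  "abel q s = (\<Sum>k\<le>degree q. coeff q k * (abel_coeff k * sin (s / 2) ^ (2 * k + 1)))"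

lemma continuous_on_abel: "continuous_on A (abel q)"
  unfolding abel_def by (intro continuous_intros) auto

lemma abel_has_integral:
  assumes "0 \<le> s" "s \<le> pi"
  shows "((\<lambda>\<phi>. poly q ((1 - cos \<phi>) / 2) * (sin \<phi> / sqrt (cos \<phi> - cos s))) has_integral abel q s) {0..s}"
proof -
  have "((\<lambda>\<phi>. \<Sum>k\<le>degree q. coeff q k * (((1 - cos \<phi>) / 2) ^ k * (sin \<phi> / sqrt (cos \<phi> - cos s)))) has_integral abel q s) {0..s}"
    unfolding abel_def by (intro has_integral_sum has_integral_mult_right abel_power_has_integral assms) auto
  then show ?thesis by (simp only: poly_altdef sum_distrib_right mult.assoc)
qed

text \<open>The degree of a sum can drop, so the defining sums have different ranges; uniqueness of
  the integral avoids matching them.\<close>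

lemma abel_add:
  assumes "0 \<le> s" "s \<le> pi" shows "abel (p + q) s = abel p s + abel q s"
  using has_integral_add[OF abel_has_integral[OF assms, of p] abel_has_integral[OF assms, of q]]
    abel_has_integral[OF assms, of "p + q"]
  by (intro has_integral_unique) (simp_all only: poly_add distrib_right)

lemma abel_smult:
  assumes "0 \<le> s" "s \<le> pi" shows "abel (smult c p) s = c * abel p s"
  using has_integral_mult_right[OF abel_has_integral[OF assms, of p], of c]
    abel_has_integral[OF assms, of "smult c p"]
  by (intro has_integral_unique) (simp_all only: poly_smult mult.assoc)

lemma abel_nonneg:
  assumes "0 \<le> s" "s \<le> pi" and "\<And>y. y \<in> {0..1} \<Longrightarrow> 0 \<le> poly q y"
  shows "0 \<le> abel q s"
proof (rule has_integral_nonneg[OF abel_has_integral[OF assms(1,2)]])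
  fix \<phi> assume \<phi>: "\<phi> \<in> {0..s}"
  then have "cos s \<le> cos \<phi>" "0 \<le> sin \<phi>" using assms by (auto intro!: cos_monotone_0_pi_le sin_ge_zero)
  moreover have "(1 - cos \<phi>) / 2 \<in> {0..1}" using cos_ge_minus_one[of \<phi>] cos_le_one[of \<phi>] by auto
  ultimately show "0 \<le> poly q ((1 - cos \<phi>) / 2) * (sin \<phi> / sqrt (cos \<phi> - cos s))"
    using assms(3) by (intro mult_nonneg_nonneg divide_nonneg_nonneg) auto
qed

lemma abel_legendre:
  assumes "0 \<le> s" "s \<le> pi"
  shows "abel (legendre n) s = 2 * sqrt 2 / (2 * real n + 1) * sin ((2 * real n + 1) * (s / 2))"
proof -
  have d: "degree (legendre n) = n"
  proof (rule antisym)
    show "degree (legendre n) \<le> n"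
      unfolding legendre_def by (intro degree_sum_le) (auto intro: order_trans[OF degree_monom_le])
    show "n \<le> degree (legendre n)"
      using legendre_coeff_nonzero[of n n] by (intro le_degree) (simp add: coeff_legendre)
  qed
  show ?thesis unfolding sin_multiple_expansion[symmetric] abel_def d
    by (simp add: coeff_legendre mult.assoc)
qed

section \<open>Sine moments of image sums and sine sums\<close>

text \<open>The real part of the characteristic function of the standard normal distribution,
  rescaled by 1 / sqrt (2 t) and halved by evenness. The limit of integrals over [0, R] is the form
  in which the unfolded image sums appear.\<close>

lemma gaussian_cos_integral_tendsto:
  fixes t \<beta> :: real
  assumes t: "t > 0"
  shows "((\<lambda>R. integral {0..R} (\<lambda>x. exp (- x\<^sup>2 / (4 * t)) * cos (\<beta> * x))) \<longlongrightarrow> sqrt (pi * t) * exp (- \<beta>\<^sup>2 * t)) at_top"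
proof -
  define E where "E x = exp (- x\<^sup>2 / (4 * t)) * cos (\<beta> * x)" for x
  define a where "a = \<beta> * sqrt (2 * t)"
  define f where "f x = std_normal_density x * cos (a * x)" for x
  have [measurable]: "E \<in> borel_measurable borel" "f \<in> borel_measurable borel"
    unfolding E_def[abs_def] f_def[abs_def] by measurable
  interpret rd: real_distribution std_normal_distribution by (rule real_dist_normal_dist)
  have fi: "integrable lborel f"
  proof (rule Bochner_Integration.integrable_bound)
    show "integrable lborel std_normal_density" using integrable_std_normal_moment[of 0] by simp
    show "AE x in lborel. norm (f x) \<le> norm (std_normal_density x)"
      by (intro AE_I2) (auto simp: f_def abs_mult mult_left_le)
  qed measurable
  have "complex_of_real (exp (- a\<^sup>2 / 2)) = (CLINT x|std_normal_distribution. iexp (a * x))"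
    using char_std_normal_distribution by (simp add: char_def fun_eq_iff)
  then have "exp (- a\<^sup>2 / 2) = Re (CLINT x|std_normal_distribution. iexp (a * x))"
    by (metis Re_complex_of_real)
  also have "\<dots> = (LINT x|std_normal_distribution. Re (iexp (a * x)))"
    by (rule integral_Re[symmetric]) (rule rd.integrable_iexp, auto)
  also have "\<dots> = (LINT x|std_normal_distribution. cos (a * x))"
    by (simp add: Re_exp)
  also have "\<dots> = (LINT x|lborel. std_normal_density x *\<^sub>R cos (a * x))"
    by (intro integral_density) auto
  finally have If: "integral\<^sup>L lborel f = exp (- a\<^sup>2 / 2)" by (simp add: f_def[abs_def])
  define c where "c = 1 / sqrt (2 * t)"
  have c: "c > 0" "c\<^sup>2 = 1 / (2 * t)" "a * c = \<beta>" using t by (auto simp: c_def a_def power_divide)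
  have fE: "f (0 + c * x) = 1 / sqrt (2 * pi) * E x" for x
  proof -
    have "cos (a * (c * x)) = cos (\<beta> * x)" by (metis c(3) mult.assoc)
    moreover have "(c * x)\<^sup>2 / 2 = x\<^sup>2 / (4 * t)" by (simp add: power_mult_distrib c(2))
    ultimately show ?thesis by (simp add: f_def std_normal_density_def E_def)
  qed
  have "integral\<^sup>L lborel f = \<bar>c\<bar> *\<^sub>R (\<integral>x. f (0 + c * x) \<partial>lborel)"
    using c by (intro lborel_integral_real_affine) auto
  then have "exp (- a\<^sup>2 / 2) = c * (1 / sqrt (2 * pi) * integral\<^sup>L lborel E)"
    unfolding If fE using c by simp
  moreover have "a\<^sup>2 / 2 = \<beta>\<^sup>2 * t" using t by (simp add: a_def power_mult_distrib)
  ultimately have "exp (- \<beta>\<^sup>2 * t) = c * (1 / sqrt (2 * pi) * integral\<^sup>L lborel E)" by simp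
  then have "integral\<^sup>L lborel E = sqrt (2 * t) * sqrt (2 * pi) * exp (- \<beta>\<^sup>2 * t)"
    using t by (simp add: c_def field_simps)
  also have "sqrt (2 * t) * sqrt (2 * pi) = 2 * sqrt (pi * t)"
    by (simp add: real_sqrt_mult)
  finally have IE: "integral\<^sup>L lborel E = 2 * (sqrt (pi * t) * exp (- \<beta>\<^sup>2 * t))" by simp
  have Ei: "integrable lborel E"
  proof -
    have "integrable lborel (\<lambda>x. f (0 + c * x))"
      using lborel_integrable_real_affine[OF fi, of c 0] c by simp
    then have "integrable lborel (\<lambda>x. 1 / sqrt (2 * pi) * E x)" unfolding fE .
    then have "integrable lborel (\<lambda>x. sqrt (2 * pi) * (1 / sqrt (2 * pi) * E x))"
      by (rule integrable_mult_right)
    then show ?thesis by simp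
  qed
  define H where "H x = indicator {0..} x *\<^sub>R E x" for x :: real
  have Hi: "integrable lborel H" unfolding H_def using Ei by (intro integrable_mult_indicator) auto
  have "has_bochner_integral lborel E (2 *\<^sub>R integral\<^sup>L lborel H)"
    using Hi unfolding H_def
    by (intro has_bochner_integral_even_function) (auto simp: E_def has_bochner_integral_iff)
  then have IH: "integral\<^sup>L lborel H = sqrt (pi * t) * exp (- \<beta>\<^sup>2 * t)"
    using IE by (auto dest: has_bochner_integral_integral_eq)
  have "((\<lambda>R. \<integral>x. indicator {..R} x *\<^sub>R H x \<partial>lborel) \<longlongrightarrow> integral\<^sup>L lborel H) at_top"
    using Hi by (intro tendsto_integral_at_top) auto
  moreover have "(\<integral>x. indicator {..R} x *\<^sub>R H x \<partial>lborel) = integral {0..R} E" for R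
  proof -
    have "continuous_on {0..R} E" unfolding E_def by (intro continuous_intros) (use t in auto)
    from set_borel_integral_eq_integral(2)[OF borel_integrable_atLeastAtMost'[OF this]]
    moreover have "indicator {..R} x *\<^sub>R H x = indicator {0..R} x *\<^sub>R E x" for x
      by (auto simp: H_def indicator_def)
    ultimately show ?thesis by (simp add: set_lebesgue_integral_def)
  qed
  ultimately show ?thesis by (simp add: IH E_def[abs_def])
qed

text \<open>This is -2 t times the x-derivative of exp (-x^2 / (4 t)), the unnormalised heat kernel
  of the line; it is odd in x.\<close>

definition gauss_g :: "real \<Rightarrow> real \<Rightarrow> real" where
  "gauss_g t x = x * exp (- x\<^sup>2 / (4 * t))"

text \<open>Integration by parts reduces the sine moment to the cosine moment of the plain Gaussian;
  the boundary term \<open>F R\<close> dies out.\<close>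

lemma gauss_sin_integral_tendsto:
  assumes t: "t > 0"
  shows "((\<lambda>R. integral {0..R} (\<lambda>x. gauss_g t x * sin (\<beta> * x))) \<longlongrightarrow> 2 * t * \<beta> * sqrt (pi * t) * exp (- \<beta>\<^sup>2 * t)) at_top"
proof -
  define E where "E x = exp (- x\<^sup>2 / (4 * t)) * cos (\<beta> * x)" for x
  define F where "F x = - 2 * t * exp (- x\<^sup>2 / (4 * t)) * sin (\<beta> * x)" for x
  have eq: "integral {0..R} (\<lambda>x. gauss_g t x * sin (\<beta> * x)) = F R + 2 * t * \<beta> * integral {0..R} E" if R: "R \<ge> 0" for R
  proof (rule integral_unique)
    have "((\<lambda>x. gauss_g t x * sin (\<beta> * x) - 2 * t * \<beta> * E x) has_integral F R - F 0) {0..R}"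
      using R t by (intro fundamental_theorem_of_calculus)
        (auto simp: F_def E_def gauss_g_def field_simps power2_eq_square simp flip: has_real_derivative_iff_has_vector_derivative intro!: derivative_eq_intros)
    moreover have "((\<lambda>x. 2 * t * \<beta> * E x) has_integral 2 * t * \<beta> * integral {0..R} E) {0..R}"
      by (intro has_integral_mult_right integrable_integral integrable_continuous_interval)
         (use t in \<open>auto simp: E_def intro!: continuous_intros\<close>)
    ultimately have "((\<lambda>x. (gauss_g t x * sin (\<beta> * x) - 2 * t * \<beta> * E x) + 2 * t * \<beta> * E x) has_integral (F R - F 0) + 2 * t * \<beta> * integral {0..R} E) {0..R}"
      by (rule has_integral_add)
    then show "((\<lambda>x. gauss_g t x * sin (\<beta> * x)) has_integral F R + 2 * t * \<beta> * integral {0..R} E) {0..R}"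
      by (simp add: F_def)
  qed
  have ev: "eventually (\<lambda>R. F R + 2 * t * \<beta> * integral {0..R} E = integral {0..R} (\<lambda>x. gauss_g t x * sin (\<beta> * x))) at_top"
    using eventually_ge_at_top[of 0] by eventually_elim (simp add: eq)
  have "((\<lambda>R. exp (- R\<^sup>2 / (4 * t))) \<longlongrightarrow> 0) at_top"
    using t by real_asymp
  then have "((\<lambda>R. - 2 * t * exp (- R\<^sup>2 / (4 * t))) \<longlongrightarrow> - 2 * t * 0) at_top" by (intro tendsto_intros)
  then have g0: "((\<lambda>R. - 2 * t * exp (- R\<^sup>2 / (4 * t))) \<longlongrightarrow> 0) at_top" by simp
  have "(F \<longlongrightarrow> 0) at_top"
  proof (rule Lim_null_comparison[OF _ tendsto_norm_zero[OF g0]])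
    show "\<forall>\<^sub>F R in at_top. norm (F R) \<le> norm (- 2 * t * exp (- R\<^sup>2 / (4 * t)))"
      by (intro always_eventually allI) (auto simp: F_def abs_mult mult_left_le)
  qed
  moreover have "((\<lambda>R. integral {0..R} E) \<longlongrightarrow> sqrt (pi * t) * exp (- \<beta>\<^sup>2 * t)) at_top"
    unfolding E_def using gaussian_cos_integral_tendsto[OF t, of \<beta>] .
  ultimately have "((\<lambda>R. F R + 2 * t * \<beta> * integral {0..R} E) \<longlongrightarrow> 0 + 2 * t * \<beta> * (sqrt (pi * t) * exp (- \<beta>\<^sup>2 * t))) at_top"
    by (intro tendsto_intros)
  from Lim_transform_eventually[OF this ev] show ?thesis by (simp add: mult.assoc)
qed

text \<open>Since \<open>gauss_g t\<close> is odd, this collects the images of index j and -j, so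
  that \<open>image_sum t N s\<close> is the sum of (-1)^j gauss_g t (s + 2 \<pi> j) over
  \<bar>j\<bar> \<le> N. Arranged like this, the pairs can be nonnegative and decreasing in
  j.\<close>

definition image_pair :: "real \<Rightarrow> nat \<Rightarrow> real \<Rightarrow> real" where
  "image_pair t j s = gauss_g t (2 * pi * real j - s) - gauss_g t (2 * pi * real j + s)"

definition image_sum :: "real \<Rightarrow> nat \<Rightarrow> real \<Rightarrow> real" where
  "image_sum t N s = gauss_g t s + (\<Sum>j=1..N. (- 1) ^ (j + 1) * image_pair t j s)"

lemma continuous_on_gauss_g: "continuous_on A (gauss_g t)"
  unfolding gauss_g_def divide_inverse by (intro continuous_intros)

lemma continuous_on_image_sum: "continuous_on A (image_sum t N)"
  unfolding image_sum_def image_pair_def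
  by (intro continuous_intros continuous_on_compose2[OF continuous_on_gauss_g[of UNIV]]) auto

text \<open>Unfolding: against \<open>sin ((n + 1/2) s)\<close>, which changes sign under \<open>s \<mapsto> s + 2\<pi>\<close>, the images
  of \<open>[0, \<pi>]\<close> fit together to an interval.\<close>

lemma image_sum_sin_integral:
  fixes n :: nat
  defines "\<beta> \<equiv> (2 * real n + 1) / 2"
  shows "((\<lambda>s. image_sum t N s * sin (\<beta> * s)) has_integral
    integral {0..(2 * real N + 1) * pi} (\<lambda>x. gauss_g t x * sin (\<beta> * x))) {0..pi}"
proof -
  define F where "F x = gauss_g t x * sin (\<beta> * x)" for x
  define \<Phi> where "\<Phi> x = integral {0..x} F" for x
  have cF: "continuous_on A F" for A
    unfolding F_def by (intro continuous_intros continuous_on_gauss_g)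
  have d\<Phi>: "(\<Phi> has_real_derivative F x) (at x)" if "x > 0" for x
  proof -
    have "(\<Phi> has_real_derivative F x) (at x within {0..x + 1})"
      unfolding \<Phi>_def has_real_derivative_iff_has_vector_derivative
      using that by (intro integral_has_vector_derivative cF) auto
    moreover have "at x within {0..x + 1} = at x"
      using that by (intro at_within_interior) auto
    ultimately show ?thesis by simp
  qed
  have c\<Phi>: "continuous_on {0..R} \<Phi>" for R
    unfolding \<Phi>_def by (intro indefinite_integral_continuous_1 integrable_continuous_interval cF)
  have c\<Phi>': "continuous_on {0..} \<Phi>"
    unfolding continuous_on_eq_continuous_within
  proof
    fix x :: real assume x: "x \<in> {0..}"
    have "continuous (at x within {0..x + 1}) \<Phi>" using c\<Phi>[of "x + 1"] x by (auto simp: continuous_on_eq_continuous_within)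
    moreover have "at x within {0..x + 1} = at x within {0..}"
      using x by (intro at_within_nhd[of x "{..<x + 1}"]) auto
    ultimately show "continuous (at x within {0..}) \<Phi>" by simp
  qed
  have step: "((\<lambda>s. (- 1) ^ (j + 1) * image_pair t j s * sin (\<beta> * s)) has_integral
      \<Phi> ((2 * real j + 1) * pi) - \<Phi> ((2 * real j - 1) * pi)) {0..pi}" if j: "j \<ge> 1" for j
  proof -
    have jpi: "2 * pi * real j \<ge> 2 * pi" using j by simp
    \<comment> \<open>As s runs through [0, \<pi>], the two arguments sweep the interval of radius
      \<pi> about 2 \<pi> j from its midpoint outwards.\<close>
    have "((\<lambda>s. F (2 * pi * real j + s) + F (2 * pi * real j - s)) has_integral
      (\<Phi> (2 * pi * real j + pi) - \<Phi> (2 * pi * real j - pi)) - (\<Phi> (2 * pi * real j + 0) - \<Phi> (2 * pi * real j - 0))) {0..pi}"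
    proof (rule fundamental_theorem_of_calculus_interior)
      show "continuous_on {0..pi} (\<lambda>s. \<Phi> (2 * pi * real j + s) - \<Phi> (2 * pi * real j - s))"
        using jpi by (intro continuous_intros continuous_on_compose2[OF c\<Phi>']) (auto intro: order_trans)
      fix s assume "s \<in> {0<..<pi}"
      then have "0 < s" "s < pi" by auto
      then have "2 * pi * real j + s > 0" "2 * pi * real j - s > 0" using jpi pi_gt_zero by linarith+
      then have "((\<lambda>s. \<Phi> (2 * pi * real j + s)) has_real_derivative F (2 * pi * real j + s) * 1) (at s)"
        "((\<lambda>s. \<Phi> (2 * pi * real j - s)) has_real_derivative F (2 * pi * real j - s) * (-1)) (at s)"
        by (intro DERIV_chain2[where f = \<Phi> and g = "\<lambda>s. 2 * pi * real j + s"]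
              DERIV_chain2[where f = \<Phi> and g = "\<lambda>s. 2 * pi * real j - s"] d\<Phi>;
            auto intro!: derivative_eq_intros)+
      from DERIV_diff[OF this]
      show "((\<lambda>s. \<Phi> (2 * pi * real j + s) - \<Phi> (2 * pi * real j - s)) has_vector_derivative
        F (2 * pi * real j + s) + F (2 * pi * real j - s)) (at s)"
        by (simp flip: has_real_derivative_iff_has_vector_derivative)
    qed simp
    moreover have "F (2 * pi * real j + s) + F (2 * pi * real j - s) = (- 1) ^ (j + 1) * image_pair t j s * sin (\<beta> * s)" for s
    proof -
      \<comment> \<open>The shift by 2 \<pi> j moves the phase by m \<pi>; m has the parity of j,
        and this matches the alternating sign of the images.\<close>
      define m where "m = (2 * n + 1) * j"
      have b: "\<beta> * (2 * pi * real j) = real m * pi" by (simp add: \<beta>_def m_def field_simps)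
      have sm: "(- 1) ^ m = ((- 1) ^ j :: real)" unfolding m_def power_mult by simp
      have "sin (\<beta> * (2 * pi * real j + s)) = (- 1) ^ j * sin (\<beta> * s)"
        unfolding distrib_left b by (simp add: sin_add sin_npi cos_npi sm)
      moreover have "sin (\<beta> * (2 * pi * real j - s)) = - ((- 1) ^ j * sin (\<beta> * s))"
        unfolding right_diff_distrib b by (simp add: sin_diff sin_npi cos_npi sm)
      ultimately show ?thesis by (simp add: F_def image_pair_def algebra_simps)
    qed
    ultimately show ?thesis by (simp add: algebra_simps)
  qed
  show ?thesis unfolding F_def[symmetric] \<Phi>_def[symmetric]
  proof (induction N)
    case 0
    have "(F has_integral \<Phi> pi) {0..pi}"
      unfolding \<Phi>_def by (intro integrable_integral integrable_continuous_interval cF)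
    then show ?case by (simp add: image_sum_def F_def[abs_def])
  next
    case (Suc N)
    have "((\<lambda>s. image_sum t N s * sin (\<beta> * s) + (- 1) ^ (Suc N + 1) * image_pair t (Suc N) s * sin (\<beta> * s)) has_integral
      \<Phi> ((2 * real N + 1) * pi) + (\<Phi> ((2 * real (Suc N) + 1) * pi) - \<Phi> ((2 * real (Suc N) - 1) * pi))) {0..pi}"
      by (intro has_integral_add Suc step) simp
    moreover have "2 * real (Suc N) - 1 = 2 * real N + 1" by simp
    moreover have "image_sum t (Suc N) s * sin (\<beta> * s)
        = image_sum t N s * sin (\<beta> * s) + (- 1) ^ (Suc N + 1) * image_pair t (Suc N) s * sin (\<beta> * s)" for s
      by (simp add: image_sum_def distrib_right add.assoc)
    ultimately show ?case by (simp add: add.commute)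
  qed
qed

lemma image_sum_sin_tendsto:
  fixes n :: nat
  assumes t: "t > 0"
  defines "\<beta> \<equiv> (2 * real n + 1) / 2"
  shows "(\<lambda>N. integral {0..pi} (\<lambda>s. image_sum t N s * sin (\<beta> * s))) \<longlonglongrightarrow> 2 * t * \<beta> * sqrt (pi * t) * exp (- \<beta>\<^sup>2 * t)"
proof -
  have "filterlim (\<lambda>N. (2 * real N + 1) * pi) at_top sequentially"
    by real_asymp
  from filterlim_compose[OF gauss_sin_integral_tendsto[OF t, of \<beta>] this]
  show ?thesis unfolding \<beta>_def integral_unique[OF image_sum_sin_integral] .
qed

text \<open>Each coefficient is the required sine moment divided by \<pi>/2, the squared norm of sin
  ((n + 1/2) s) on [0, \<pi>]; half of the factor 2 n + 1 is the frequency in that moment.\<close>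

definition sine_sum :: "real \<Rightarrow> nat \<Rightarrow> real \<Rightarrow> real" where
  "sine_sum t N s = 2 * t * sqrt (pi * t) / pi *
    (\<Sum>n\<le>N. (2 * real n + 1) * exp (- ((2 * real n + 1) / 2)\<^sup>2 * t) * sin ((2 * real n + 1) / 2 * s))"

lemma continuous_on_sine_sum: "continuous_on A (sine_sum t N)"
  unfolding sine_sum_def by (intro continuous_intros)

lemma sin_half_integer_orthogonal:
  fixes n m :: nat
  shows "((\<lambda>s. sin ((2 * real n + 1) / 2 * s) * sin ((2 * real m + 1) / 2 * s)) has_integral
    (if n = m then pi / 2 else 0)) {0..pi}"
proof -
  define k where "k = real n + real m + 1"
  define d where "d = real n - real m"
  have prod: "sin ((2 * real n + 1) / 2 * s) * sin ((2 * real m + 1) / 2 * s) = cos (d * s) / 2 - cos (k * s) / 2" for s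
  proof -
    have "sin ((2 * real n + 1) / 2 * s) * sin ((2 * real m + 1) / 2 * s)
      = (cos ((2 * real n + 1) / 2 * s - (2 * real m + 1) / 2 * s) - cos ((2 * real n + 1) / 2 * s + (2 * real m + 1) / 2 * s)) / 2"
      by (rule sin_times_sin)
    also have "(2 * real n + 1) / 2 * s - (2 * real m + 1) / 2 * s = d * s" by (simp add: d_def field_simps)
    also have "(2 * real n + 1) / 2 * s + (2 * real m + 1) / 2 * s = k * s" by (simp add: k_def field_simps)
    finally show ?thesis by (simp add: diff_divide_distrib)
  qed
  have C: "((\<lambda>s. cos (c * s)) has_integral sin (c * pi) / c) {0..pi}" if "c \<noteq> 0" for c :: real
  proof -
    have "((\<lambda>s. cos (c * s)) has_integral sin (c * pi) / c - sin (c * 0) / c) {0..pi}"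
      using that by (intro fundamental_theorem_of_calculus)
        (auto intro!: derivative_eq_intros simp flip: has_real_derivative_iff_has_vector_derivative)
    then show ?thesis by simp
  qed
  have sk: "sin (k * pi) = 0" using sin_npi[of "n + m + 1"] by (simp add: k_def algebra_simps)
  have k: "((\<lambda>s. cos (k * s) / 2) has_integral 0) {0..pi}"
    using has_integral_divide[OF C[of k], of 2] sk by (simp add: k_def)
  have "((\<lambda>s. cos (d * s) / 2) has_integral (if n = m then pi / 2 else 0)) {0..pi}"
  proof (cases "n = m")
    case True
    then show ?thesis using has_integral_const_real[of "1 / 2 :: real" 0 pi] by (simp add: d_def)
  next
    case False
    have "sin (d * pi) = 0" unfolding d_def left_diff_distrib sin_diff by (simp add: sin_npi)
    then show ?thesis using has_integral_divide[OF C[of d], of 2] False by (simp add: d_def)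
  qed
  from has_integral_diff[OF this k] show ?thesis unfolding prod by simp
qed

lemma sine_sum_sin_tendsto:
  fixes m :: nat
  defines "\<beta> \<equiv> (2 * real m + 1) / 2"
  shows "(\<lambda>N. integral {0..pi} (\<lambda>s. sine_sum t N s * sin (\<beta> * s))) \<longlonglongrightarrow> 2 * t * \<beta> * sqrt (pi * t) * exp (- \<beta>\<^sup>2 * t)"
proof -
  define c where "c n = 2 * t * sqrt (pi * t) / pi * ((2 * real n + 1) * exp (- ((2 * real n + 1) / 2)\<^sup>2 * t))" for n :: nat
  \<comment> \<open>By orthogonality the sequence of moments is constant as soon as its own
    frequency is included.\<close>
  have "integral {0..pi} (\<lambda>s. sine_sum t N s * sin (\<beta> * s)) = 2 * t * \<beta> * sqrt (pi * t) * exp (- \<beta>\<^sup>2 * t)" if N: "m \<le> N" for N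
  proof -
    have "((\<lambda>s. \<Sum>n\<le>N. c n * (sin ((2 * real n + 1) / 2 * s) * sin (\<beta> * s))) has_integral
      (\<Sum>n\<le>N. c n * (if n = m then pi / 2 else 0))) {0..pi}"
      unfolding \<beta>_def by (intro has_integral_sum has_integral_mult_right sin_half_integer_orthogonal) auto
    also have "(\<Sum>n\<le>N. c n * (if n = m then pi / 2 else 0)) = c m * (pi / 2)"
      using N by (simp add: if_distrib cong: if_cong)
    also have "\<dots> = 2 * t * \<beta> * sqrt (pi * t) * exp (- \<beta>\<^sup>2 * t)" by (simp add: c_def \<beta>_def)
    finally show ?thesis
      by (intro integral_unique) (simp add: sine_sum_def c_def sum_distrib_left sum_distrib_right mult.assoc)
  qed
  then have "eventually (\<lambda>N. integral {0..pi} (\<lambda>s. sine_sum t N s * sin (\<beta> * s)) = 2 * t * \<beta> * sqrt (pi * t) * exp (- \<beta>\<^sup>2 * t)) sequentially"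
    by (auto simp: eventually_sequentially)
  then show ?thesis by (rule tendsto_eventually)
qed

section \<open>Comparison with a single Gaussian\<close>

lemma mult_cosh_le: "0 \<le> z \<Longrightarrow> z * cosh z \<le> (1 + z) * sinh (z::real)"
proof -
  assume z: "0 \<le> z"
  have "2 * z \<le> exp (2 * z) - 1" using exp_ge_add_one_self[of "2 * z"] by linarith
  then have "2 * z * exp (- z) \<le> (exp (2 * z) - 1) * exp (- z)" by (rule mult_right_mono) simp
  also have "\<dots> = 2 * sinh z" by (simp add: sinh_field_def algebra_simps flip: exp_add)
  finally have "z * exp (- z) \<le> sinh z" by simp
  then show ?thesis by (simp add: sinh_field_def cosh_field_def field_simps)
qed

lemma sinh_le_mult_exp: "sinh z \<le> z * exp (z::real)"
proof -
  have "1 - exp (- 2 * z) \<le> 2 * z" using exp_ge_add_one_self[of "- 2 * z"] by linarith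
  then have "(1 - exp (- 2 * z)) * exp z \<le> 2 * z * exp z" by (rule mult_right_mono) simp
  moreover have "(1 - exp (- 2 * z)) * exp z = 2 * sinh z"
    by (simp add: sinh_field_def algebra_simps flip: exp_add)
  ultimately show ?thesis by linarith
qed

lemma sinh_le_mult_cosh:
  assumes "0 \<le> (z::real)" shows "sinh z \<le> z * cosh z"
proof -
  have "(\<lambda>z. z * cosh z - sinh z) 0 \<le> (\<lambda>z. z * cosh z - sinh z) z"
    by (rule DERIV_nonneg_imp_nondecreasing[OF assms])
       (auto intro!: exI derivative_eq_intros simp: sinh_real_nonneg_iff)
  then show ?thesis by simp
qed

lemma le_sinh:
  assumes "0 \<le> (z::real)" shows "z \<le> sinh z"
proof -
  have "(\<lambda>z. sinh z - z) 0 \<le> (\<lambda>z. sinh z - z) z"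
    by (rule DERIV_nonneg_imp_nondecreasing[OF assms])
       (auto intro!: exI derivative_eq_intros simp: cosh_real_ge_1)
  then show ?thesis by simp
qed

text \<open>The hyperbolic Cusa-Huygens inequality. Two differentiations reduce it to
  \<open>sinh_le_mult_cosh\<close>.\<close>

lemma three_sinh_le:
  assumes "0 \<le> (z::real)" shows "3 * sinh z \<le> z * cosh z + 2 * z"
proof -
  have d: "0 \<le> x * sinh x - 2 * cosh x + 2" if "0 \<le> x" for x :: real
  proof -
    have "(\<lambda>z. z * sinh z - 2 * cosh z + 2) 0 \<le> (\<lambda>z. z * sinh z - 2 * cosh z + 2) x"
    proof (rule DERIV_nonneg_imp_nondecreasing[OF that])
      fix y :: real assume "0 \<le> y"
      then show "\<exists>d. ((\<lambda>z. z * sinh z - 2 * cosh z + 2) has_real_derivative d) (at y) \<and> 0 \<le> d"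
        using sinh_le_mult_cosh[of y] by (intro exI[of _ "y * cosh y - sinh y"]) (auto intro!: derivative_eq_intros)
    qed
    then show ?thesis by simp
  qed
  have "(\<lambda>z. z * cosh z + 2 * z - 3 * sinh z) 0 \<le> (\<lambda>z. z * cosh z + 2 * z - 3 * sinh z) z"
  proof (rule DERIV_nonneg_imp_nondecreasing[OF assms])
    fix y :: real assume "0 \<le> y"
    then show "\<exists>d. ((\<lambda>z. z * cosh z + 2 * z - 3 * sinh z) has_real_derivative d) (at y) \<and> 0 \<le> d"
      using d[of y] by (intro exI[of _ "y * sinh y - 2 * cosh y + 2"]) (auto intro!: derivative_eq_intros)
  qed
  then show ?thesis by simp
qed

lemma exp_17_10_le: "exp (17 / 10 :: real) \<le> 56 / 10"
proof (rule power_le_imp_le_base)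
  have "exp (17 / 10 :: real) ^ Suc 9 = exp 1 ^ 17" by (simp flip: exp_of_nat_mult)
  also have "\<dots> \<le> (272 / 100) ^ 17" using e_less_272 by (intro power_mono) auto
  also have "\<dots> \<le> (56 / 10) ^ Suc 9" by (simp add: power_divide)
  finally show "exp (17 / 10 :: real) ^ Suc 9 \<le> (56 / 10) ^ Suc 9" .
qed simp

text \<open>By convexity sinh lies below its chord over [0, 1.7], whose slope is at most 2.72 / 1.7
  = 1.6.\<close>

lemma sinh_le_16_10:
  assumes "0 \<le> z" "z \<le> 17 / 10" shows "sinh z \<le> 16 / 10 * (z::real)"
proof -
  have "convex_on {0..} (sinh :: real \<Rightarrow> real)"
    by (rule f''_ge0_imp_convex[where f' = cosh and f'' = sinh]) (auto intro!: derivative_eq_intros)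
  from convex_onD[OF this, of "z / (17 / 10)" 0 "17 / 10"] assms
  have "sinh z \<le> z / (17 / 10) * sinh (17 / 10)" by simp
  moreover have "exp (- (17 / 10)) \<ge> 1 / (56 / 10 :: real)"
    using exp_17_10_le unfolding exp_minus by (simp add: field_simps)
  then have "sinh (17 / 10) \<le> (272 / 100 :: real)" using exp_17_10_le by (simp add: sinh_field_def)
  then have "z / (17 / 10) * sinh (17 / 10) \<le> z / (17 / 10) * (272 / 100)"
    using assms by (intro mult_left_mono) auto
  ultimately show ?thesis by simp
qed

text \<open>The tangent to exp at m with the slope exp m lowered to a convenient c. Where the
  bracket is negative the left side is below 0 anyway, so lowering the slope does no harm.\<close>

lemma exp_ge_tangent:
  assumes "c \<le> exp (m::real)" "0 < c" shows "c * (1 + b - m) \<le> exp b"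
proof (cases "1 + b - m \<ge> 0")
  case True
  have "1 + b - m \<le> exp (b - m)" using exp_ge_add_one_self[of "b - m"] by linarith
  then have "c * (1 + b - m) \<le> exp m * exp (b - m)"
    using True assms by (intro mult_mono) auto
  then show ?thesis by (simp flip: exp_add)
next
  case False
  then have "c * (1 + b - m) \<le> 0" using assms by (intro mult_nonneg_nonpos) auto
  then show ?thesis using exp_gt_zero[of b] by linarith
qed

lemma exp_3_2_ge: "4 \<le> exp (3 / 2 :: real)"
proof -
  have "(2 :: real)\<^sup>2 \<le> exp (3 / 4) ^ 2"
    using exp_lower_Taylor_quadratic[of "3 / 4"] by (intro power_mono) (auto simp: power2_eq_square)
  then show ?thesis by (simp flip: exp_of_nat_mult)
qed

text \<open>An eighth root brings the argument down to 15/64, where the quadratic Taylor bound is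
  sharp enough.\<close>

lemma exp_15_8_ge: "64 / 10 \<le> exp (15 / 8 :: real)"
proof -
  have "(64 / 10 :: real) \<le> (12618 / 10000) ^ 8" by (simp add: power_divide)
  also have "\<dots> \<le> exp (15 / 64) ^ 8"
    using exp_lower_Taylor_quadratic[of "15 / 64"] by (intro power_mono) (auto simp: power2_eq_square)
  finally show ?thesis by (simp flip: exp_of_nat_mult)
qed

text \<open>The product (1 + u + u^2/2) (1 - u + u^2/2) = 1 + u^4/4 is at least 1, and the first
  factor is at most exp u.\<close>

lemma exp_minus_le_quadratic:
  assumes "0 \<le> (u::real)" shows "exp (- u) \<le> 1 - u + u\<^sup>2 / 2"
proof -
  have q: "0 < 1 - u + u\<^sup>2 / 2"
    using zero_le_power2[of "u - 1"] by (simp add: power2_eq_square algebra_simps)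
  have "1 \<le> 1 + u ^ 4 / 4" by simp
  also have "\<dots> = (1 + u + u\<^sup>2 / 2) * (1 - u + u\<^sup>2 / 2)"
    by (simp add: field_simps power2_eq_square power4_eq_xxxx)
  also have "\<dots> \<le> exp u * (1 - u + u\<^sup>2 / 2)"
    using exp_lower_Taylor_quadratic[OF assms] q by (intro mult_right_mono) auto
  finally show ?thesis by (simp add: exp_minus field_simps)
qed

text \<open>The difference of the two sides vanishes to leading order along \<open>z = b\<close> as \<open>b\<close> grows, so the
  exponential is replaced by a tangent line whose point of contact depends on the range of \<open>z\<close>.\<close>

lemma four_sinh_le:
  assumes z: "0 \<le> z" "z \<le> (b::real)"
  shows "4 * b * sinh z \<le> z * (exp b + 2 * cosh z)"
proof -
  define w where "w = b - z"
  have w: "0 \<le> w" "b = z + w" using z by (auto simp: w_def)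
  define p r where "p = exp z" and "r = exp (- z)"
  have pr: "0 < p" "0 < r" "sinh z = (p - r) / 2" "cosh z = (p + r) / 2"
    by (auto simp: p_def r_def sinh_field_def cosh_field_def)
  consider "2 \<le> z" | "17 / 10 \<le> z" "z \<le> 2" | "z \<le> 17 / 10" by linarith
  then show ?thesis
  proof cases
    case 1
    \<comment> \<open>Tangent at z itself: the remainder has the factor z - 2, which is nonnegative
      in this range.\<close>
    have "p * (1 + w) \<le> exp b"
      using exp_ge_tangent[of p z b] pr by (simp add: p_def w_def algebra_simps)
    then have "z * (p * (1 + w) + 2 * cosh z) \<le> z * (exp b + 2 * cosh z)"
      using z by (intro mult_left_mono) auto
    moreover have "0 \<le> w * p * (z - 2) + 3 * z * r + 2 * w * r" using w pr 1 by auto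
    moreover have "z * (p * (1 + w) + 2 * cosh z) - 4 * b * sinh z = w * p * (z - 2) + 3 * z * r + 2 * w * r"
      unfolding pr w(2) by (simp add: field_simps)
    ultimately show ?thesis by linarith
  next
    case 2
    \<comment> \<open>Tangent at the fixed point 2, since z - 2 has changed sign. The difference of
      the two sides is then linear in w = b - z; its two coefficients are estimated through p = q
      exp (-u).\<close>
    define q u where "q = exp (2::real)" and "u = 2 - z"
    have u: "0 \<le> u" "u \<le> 3 / 10" "z = 2 - u" using 2 by (auto simp: u_def)
    have q: "0 < q" by (simp add: q_def)
    have "q * (b - 1) \<le> exp b"
      using exp_ge_tangent[of q 2 b] q by (simp add: q_def algebra_simps)
    then have "z * (q * (b - 1) + 2 * cosh z) \<le> z * (exp b + 2 * cosh z)"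
      using z by (intro mult_left_mono) auto
    have pq: "p \<le> q * (1 - u + u\<^sup>2 / 2)"
    proof -
      have "p = q * exp (- u)" by (simp add: p_def q_def u_def flip: exp_add)
      then show ?thesis using exp_minus_le_quadratic[OF u(1)] q by simp
    qed
    have "0 \<le> z * q - 2 * p + 2 * r"
    proof -
      have "0 \<le> q * (u * (1 - u))" using q u by simp
      then show ?thesis using pq pr(2) unfolding u(3) by (simp add: algebra_simps power2_eq_square)
    qed
    moreover have "0 \<le> q * (z - 1) - p + 3 * r"
    proof -
      have "q\<^sup>2 = exp 1 ^ 4" by (simp add: q_def flip: exp_of_nat_mult)
      also have "\<dots> \<le> (272 / 100) ^ 4" using e_less_272 by (intro power_mono) auto
      finally have q2: "q\<^sup>2 \<le> 55" by (simp add: power_divide)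
      have "u\<^sup>2 \<le> (3 / 10)\<^sup>2" using u by (intro power_mono) auto
      then have "q\<^sup>2 * u\<^sup>2 \<le> 55 * (3 / 10)\<^sup>2" using q2 by (intro mult_mono) auto
      then have "q\<^sup>2 * u\<^sup>2 \<le> 6" by (simp add: power2_eq_square)
      then have "q * u\<^sup>2 / 2 \<le> 3 * (1 / q)" using q by (simp add: field_simps power2_eq_square)
      also have "1 / q \<le> r" using 2 by (simp add: q_def r_def exp_minus field_simps)
      finally have "q * u\<^sup>2 / 2 \<le> 3 * r" by simp
      then show ?thesis using pq unfolding u(3) by (simp add: algebra_simps)
    qed
    ultimately have "0 \<le> w * (z * q - 2 * p + 2 * r) + z * (q * (z - 1) - p + 3 * r)"
      using w z by simp
    also have "\<dots> = z * (q * (b - 1) + 2 * cosh z) - 4 * b * sinh z"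
      unfolding pr w(2) by (simp add: field_simps)
    finally show ?thesis using \<open>z * (q * (b - 1) + 2 * cosh z) \<le> _\<close> by linarith
  next
    case 3
    define S where "S = sinh z"
    have S: "z \<le> S" "S \<le> 16 / 10 * z" using sinh_le_16_10[OF z(1) 3] le_sinh[OF z(1)] by (auto simp: S_def)
    have C: "6 * S - 4 * z \<le> 2 * (z * cosh z)" using three_sinh_le[OF z(1)] by (simp add: S_def)
    \<comment> \<open>With S = sinh z the claim is linear in S with coefficient 6 - 4 b. The two
      lines, tangents at 3/2 and 15/8 with slightly lowered slopes, meet at b = 3/2, where this
      coefficient changes sign; they give exactly 0 for S = z and S = 1.6 z respectively, the
      extreme values allowed for S.\<close>
    have e1: "4 * b - 2 \<le> exp b" using exp_ge_tangent[OF exp_3_2_ge, of b] by (simp add: algebra_simps)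
    have e2: "64 / 10 * b - 56 / 10 \<le> exp b" using exp_ge_tangent[OF exp_15_8_ge, of b] by (simp add: algebra_simps)
    have "0 \<le> z * exp b - 4 * z + S * (6 - 4 * b)"
    proof (cases "6 - 4 * b \<ge> 0")
      case True
      have "0 \<le> z * (exp b - (4 * b - 2))" using e1 z by simp
      also have "\<dots> = z * exp b - 4 * z + z * (6 - 4 * b)" by (simp add: algebra_simps)
      also have "\<dots> \<le> z * exp b - 4 * z + S * (6 - 4 * b)" using True S by (simp add: mult_right_mono)
      finally show ?thesis .
    next
      case False
      have "0 \<le> z * (exp b - (64 / 10 * b - 56 / 10))" using e2 z by simp
      also have "\<dots> = z * exp b - 4 * z + (16 / 10 * z) * (6 - 4 * b)" by (simp add: field_simps)
      also have "\<dots> \<le> z * exp b - 4 * z + S * (6 - 4 * b)"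
        using False S by (intro add_left_mono mult_right_mono_neg) auto
      finally show ?thesis .
    qed
    then show ?thesis using C by (simp add: S_def algebra_simps)
  qed
qed

text \<open>An image pair divided by 2 \<pi> exp (-s^2 / (4 t)), in the dimensionless variables b =
  \<pi>^2 / t and x = s / \<pi>.\<close>

definition image_factor :: "real \<Rightarrow> real \<Rightarrow> nat \<Rightarrow> real" where
  "image_factor b x j = exp (- b * (real j)\<^sup>2) * (2 * real j * sinh (real j * (b * x)) - x * cosh (real j * (b * x)))"

lemma image_pair_eq:
  assumes "t > 0"
  shows "image_pair t j s = 2 * pi * exp (- s\<^sup>2 / (4 * t)) * image_factor (pi\<^sup>2 / t) (s / pi) j"
proof -
  define z where "z = real j * (pi\<^sup>2 / t * (s / pi))"
  have "- (2 * pi * real j - s)\<^sup>2 / (4 * t) = - s\<^sup>2 / (4 * t) + (- (pi\<^sup>2 / t) * (real j)\<^sup>2 + z)"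
    "- (2 * pi * real j + s)\<^sup>2 / (4 * t) = - s\<^sup>2 / (4 * t) + (- (pi\<^sup>2 / t) * (real j)\<^sup>2 + - z)"
    using assms by (simp_all add: z_def field_simps power2_eq_square)
  then have e: "exp (- (2 * pi * real j - s)\<^sup>2 / (4 * t)) = exp (- s\<^sup>2 / (4 * t)) * (exp (- (pi\<^sup>2 / t) * (real j)\<^sup>2) * exp z)"
    "exp (- (2 * pi * real j + s)\<^sup>2 / (4 * t)) = exp (- s\<^sup>2 / (4 * t)) * (exp (- (pi\<^sup>2 / t) * (real j)\<^sup>2) * exp (- z))"
    by (simp_all only: exp_add)
  have "image_pair t j s = exp (- s\<^sup>2 / (4 * t)) * (exp (- (pi\<^sup>2 / t) * (real j)\<^sup>2) *
    ((2 * pi * real j - s) * exp z - (2 * pi * real j + s) * exp (- z)))"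
    unfolding image_pair_def gauss_g_def e by (simp add: algebra_simps)
  also have "(2 * pi * real j - s) * exp z - (2 * pi * real j + s) * exp (- z)
    = 2 * pi * (2 * real j * sinh z - s / pi * cosh z)"
    by (simp add: sinh_field_def cosh_field_def field_simps)
  finally show ?thesis by (simp add: image_factor_def z_def)
qed

text \<open>Both terms are measured by S = sinh (j b x). Apart from the Gaussian factors and after
  multiplication by j, the present term is at least (2 j^2 - j - 1/b) S and the next one at most 2
  (j + 1)^2 exp b S. The quotient exp (-(2 j + 1) b) of the Gaussian factors absorbs exp b and
  leaves the exponential in the hypothesis.\<close>

lemma image_factor_decreasing:
  assumes b: "b > 0" and x: "0 \<le> x" "x \<le> 1" and j: "j \<ge> 1"
    and c: "2 * (real j + 1)\<^sup>2 * exp (- 2 * real j * b) \<le> 2 * (real j)\<^sup>2 - real j - 1 / b"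
  shows "image_factor b x (Suc j) \<le> image_factor b x j" "0 \<le> image_factor b x j"
proof -
  define z where "z = b * x"
  define J where "J = real j"
  have J: "J \<ge> 1" using j by (simp add: J_def)
  have z: "0 \<le> z" "z \<le> b" using b x by (auto simp: z_def mult_left_le)
  define S where "S = sinh (J * z)"
  have S: "0 \<le> S" using J z by (simp add: S_def)
  define A where "A = 2 * J * S - x * cosh (J * z)"
  have lower: "(2 * J\<^sup>2 - J - 1 / b) * S \<le> J * A"
  proof -
    have "(J * b * x) * cosh (J * z) \<le> (1 + J * b * x) * S"
      using mult_cosh_le[of "J * z"] J z by (simp add: S_def z_def mult.assoc)
    then have "J * x * cosh (J * z) \<le> (1 / b + J * x) * S" using b by (simp add: field_simps)
    also have "\<dots> \<le> (1 / b + J) * S" using x J S by (intro mult_right_mono add_left_mono) (auto simp: mult_left_le)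
    finally show ?thesis by (simp add: A_def power2_eq_square algebra_simps)
  qed
  have c0: "0 \<le> 2 * J\<^sup>2 - J - 1 / b"
    unfolding J_def by (rule order_trans[OF _ c]) simp
  have "0 \<le> J * A" using order_trans[OF mult_nonneg_nonneg[OF c0 S] lower] .
  then have A: "0 \<le> A" using J by (simp add: zero_le_mult_iff)
  then show "0 \<le> image_factor b x j"
    by (simp add: image_factor_def A_def S_def J_def z_def)
  define B where "B = 2 * (J + 1) * sinh ((J + 1) * z) - x * cosh ((J + 1) * z)"
  have Jz: "J * z * cosh (J * z) \<le> (1 + J * z) * S" using mult_cosh_le[of "J * z"] J z by (simp add: S_def)
  \<comment> \<open>Addition theorem; the mixed term J cosh (J z) sinh z is estimated after
    multiplication by z, which is why z = 0 is separate.\<close>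
  have sh: "J * sinh ((J + 1) * z) \<le> (J + 1) * exp z * S"
  proof -
    have "J * (cosh (J * z) * sinh z) \<le> J * S * sinh z + S * exp z"
    proof (cases "z = 0")
      case False
      then have zp: "z > 0" using z by simp
      have "J * z * cosh (J * z) * sinh z \<le> (1 + J * z) * S * sinh z"
        using Jz zp by (intro mult_right_mono) auto
      also have "\<dots> = J * z * S * sinh z + S * sinh z" by (simp add: algebra_simps)
      also have "\<dots> \<le> J * z * S * sinh z + S * (z * exp z)"
        using sinh_le_mult_exp[of z] S by (intro add_left_mono mult_left_mono) auto
      finally have "z * (J * (cosh (J * z) * sinh z)) \<le> z * (J * S * sinh z + S * exp z)"
        by (simp add: algebra_simps)
      then show ?thesis using zp by simp
    qed (use S in simp)
    moreover have "sinh ((J + 1) * z) = S * cosh z + cosh (J * z) * sinh z"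
      by (simp add: S_def distrib_right sinh_add)
    moreover have "exp z = cosh z + sinh z" by (simp add: cosh_plus_sinh)
    ultimately show ?thesis by (simp add: algebra_simps)
  qed
  have "J * B \<le> J * (2 * (J + 1) * sinh ((J + 1) * z))"
    using J x cosh_real_nonneg[of "(J + 1) * z"] by (intro mult_left_mono) (auto simp: B_def)
  also have "\<dots> = 2 * (J + 1) * (J * sinh ((J + 1) * z))" by simp
  also have "\<dots> \<le> 2 * (J + 1) * ((J + 1) * exp z * S)" using sh J by (intro mult_left_mono) auto
  also have "\<dots> = 2 * (J + 1)\<^sup>2 * S * exp z" by (simp add: power2_eq_square)
  also have "\<dots> \<le> 2 * (J + 1)\<^sup>2 * S * exp b" using z S by (intro mult_left_mono) auto
  finally have JB: "J * B \<le> 2 * (J + 1)\<^sup>2 * S * exp b" .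
  have "J * (exp (- b * (J + 1)\<^sup>2) * B) = exp (- b * (J + 1)\<^sup>2) * (J * B)" by simp
  also have "\<dots> \<le> exp (- b * (J + 1)\<^sup>2) * (2 * (J + 1)\<^sup>2 * S * exp b)"
    using JB by (intro mult_left_mono) auto
  also have "\<dots> = exp (- b * J\<^sup>2) * ((2 * (J + 1)\<^sup>2 * exp (- 2 * J * b)) * S)"
  proof -
    have "exp (- b * (J + 1)\<^sup>2) * exp b = exp (- b * J\<^sup>2) * exp (- 2 * J * b)"
      by (simp add: power2_eq_square algebra_simps flip: exp_add)
    then show ?thesis by (simp add: mult_ac)
  qed
  also have "\<dots> \<le> exp (- b * J\<^sup>2) * ((2 * J\<^sup>2 - J - 1 / b) * S)"
    using c S by (intro mult_left_mono mult_right_mono) (auto simp: J_def)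
  also have "\<dots> \<le> exp (- b * J\<^sup>2) * (J * A)" using lower by (intro mult_left_mono) auto
  finally have "J * (exp (- b * (J + 1)\<^sup>2) * B) \<le> J * (exp (- b * J\<^sup>2) * A)" by (simp add: mult_ac)
  then have "exp (- b * (J + 1)\<^sup>2) * B \<le> exp (- b * J\<^sup>2) * A" using J by simp
  then show "image_factor b x (Suc j) \<le> image_factor b x j"
    by (simp add: image_factor_def A_def B_def S_def J_def z_def add.commute)
qed

text \<open>The threshold b \<ge> 1/2 corresponds to t \<le> 2 \<pi>^2 and yields monotonicity only
  from the second pair on. For j = 1 the inequality reads 8 exp (-2 b) \<le> 1 - 1/b and fails for b
  \<le> 1, hence the stronger requirement b \<ge> 2.\<close>

lemma image_factor_condition:
  assumes "b \<ge> 1 / 2" "j \<ge> 2 \<or> b \<ge> 2 \<and> j = 1"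
  shows "2 * (real j + 1)\<^sup>2 * exp (- 2 * real j * b) \<le> 2 * (real j)\<^sup>2 - real j - 1 / b"
proof (cases "j \<ge> 2")
  case True
  define J where "J = real j"
  have J: "J \<ge> 2" using True by (simp add: J_def)
  have "(J + 1)\<^sup>2 \<le> 2 * exp J" using exp_lower_Taylor_quadratic[of J] J by (simp add: power2_eq_square algebra_simps)
  then have "(J + 1)\<^sup>2 * exp (- J) \<le> 2 * exp J * exp (- J)" by (intro mult_right_mono) auto
  then have e: "(J + 1)\<^sup>2 * exp (- J) \<le> 2" by (simp add: exp_minus field_simps)
  have "J * 1 \<le> J * (2 * b)" using assms(1) J by (intro mult_left_mono) auto
  then have "2 * (J + 1)\<^sup>2 * exp (- 2 * J * b) \<le> 2 * (J + 1)\<^sup>2 * exp (- J)"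
    by (intro mult_left_mono) auto
  also have "\<dots> \<le> 4" using e by (simp add: mult.commute)
  also have "4 \<le> J * (2 * J - 1) - 2"
    using mult_mono[of 2 J 3 "2 * J - 1"] J by simp
  also have "J * (2 * J - 1) - 2 \<le> 2 * J\<^sup>2 - J - 1 / b"
    using assms(1) by (simp add: power2_eq_square algebra_simps divide_le_eq)
  finally show ?thesis by (simp add: J_def)
next
  case False
  then have j: "j = 1" "b \<ge> 2" using assms by auto
  have "(16::real) \<le> exp 1 ^ 4" using power_mono[of 2 "exp 1 :: real" 4] exp_ge_add_one_self[of 1] by simp
  also have "\<dots> \<le> exp (2 * b)" using j by (simp flip: exp_of_nat_mult)
  finally have "8 * exp (- 2 * b) \<le> 1 / 2" by (simp add: exp_minus field_simps)
  moreover have "1 / b \<le> 1 / 2" using j by (simp add: field_simps)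
  ultimately have "8 * exp (- 2 * b) \<le> 1 - 1 / b" by linarith
  then show ?thesis using j by (simp add: mult_ac)
qed

section \<open>Two-sided comparison of the image sums with the Gaussian\<close>

lemma alternating_sum_bounds:
  fixes a :: "nat \<Rightarrow> real"
  assumes "\<And>i. 0 \<le> a i" "\<And>i. a (Suc i) \<le> a i"
  shows "0 \<le> (\<Sum>i<n. (- 1) ^ i * a i) \<and> (\<Sum>i<n. (- 1) ^ i * a i) \<le> a 0"
  using assms
proof (induction n arbitrary: a)
  case (Suc n)
  have "(\<Sum>i<Suc n. (- 1) ^ i * a i) = a 0 - (\<Sum>i<n. (- 1) ^ i * a (Suc i))"
    by (subst sum.lessThan_Suc_shift) (simp add: sum_negf)
  moreover have "0 \<le> (\<Sum>i<n. (- 1) ^ i * a (Suc i)) \<and> (\<Sum>i<n. (- 1) ^ i * a (Suc i)) \<le> a (Suc 0)"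
    using Suc.prems by (intro Suc.IH) auto
  ultimately show ?case using Suc.prems(2)[of 0] by auto
qed simp

lemma image_sum_alt: "image_sum t N s = gauss_g t s + (\<Sum>i<N. (- 1) ^ i * image_pair t (Suc i) s)"
  unfolding image_sum_def by (simp add: sum.atLeast1_atMost_eq)

lemma image_sum_upper:
  assumes t: "0 < t" "t \<le> 2 * pi\<^sup>2" and s: "0 \<le> s" "s \<le> pi"
  shows "image_sum t N s \<le> 2 * gauss_g t s"
proof -
  define b x where "b = pi\<^sup>2 / t" and "x = s / pi"
  have b: "b \<ge> 1 / 2" using t by (simp add: b_def field_simps)
  have x: "0 \<le> x" "x \<le> 1" using s by (auto simp: x_def)
  have g: "0 \<le> gauss_g t s" using s by (simp add: gauss_g_def)
  have "(\<Sum>i<N. (- 1) ^ i * image_pair t (Suc i) s) \<le> gauss_g t s"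
  proof (cases N)
    case 0 then show ?thesis using g by simp
  next
    case (Suc n)
    have "0 \<le> (\<Sum>i<n. (- 1) ^ i * image_pair t (Suc (Suc i)) s)"
    proof (rule conjunct1[OF alternating_sum_bounds])
      fix i
      show "0 \<le> image_pair t (Suc (Suc i)) s" "image_pair t (Suc (Suc (Suc i))) s \<le> image_pair t (Suc (Suc i)) s"
        unfolding image_pair_eq[OF t(1)] b_def[symmetric] x_def[symmetric]
        using image_factor_decreasing[of b x "Suc (Suc i)"] image_factor_condition[of b "Suc (Suc i)"] b x
        by (auto intro!: mult_left_mono)
    qed
    then have "(\<Sum>i<Suc n. (- 1) ^ i * image_pair t (Suc i) s) \<le> image_pair t 1 s"
      by (subst sum.lessThan_Suc_shift) (simp add: sum_negf)
    also have "\<dots> \<le> gauss_g t s"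
    proof -
      have "4 * b * sinh (b * x) \<le> (b * x) * (exp b + 2 * cosh (b * x))"
        using b x by (intro four_sinh_le) (auto simp: mult_left_le)
      then have "b * (4 * sinh (b * x) - 2 * x * cosh (b * x)) \<le> b * (x * exp b)" by (simp add: algebra_simps)
      then have "4 * sinh (b * x) - 2 * x * cosh (b * x) \<le> x * exp b" using b by simp
      then have "exp (- b) * (4 * sinh (b * x) - 2 * x * cosh (b * x)) \<le> exp (- b) * (x * exp b)"
        by (intro mult_left_mono) auto
      also have "\<dots> = x" by (simp add: exp_minus)
      finally have "2 * image_factor b x 1 \<le> x" by (simp add: image_factor_def algebra_simps)
      then have "pi * exp (- s\<^sup>2 / (4 * t)) * (2 * image_factor b x 1) \<le> pi * exp (- s\<^sup>2 / (4 * t)) * x"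
        by (intro mult_left_mono) auto
      then show ?thesis
        unfolding image_pair_eq[OF t(1)] b_def[symmetric] x_def[symmetric] by (simp add: gauss_g_def x_def)
    qed
    finally show ?thesis using Suc by simp
  qed
  then show ?thesis unfolding image_sum_alt by simp
qed

text \<open>For t \<le> \<pi> one has b \<ge> \<pi> > 2, so the alternation is already decreasing
  from the first pair, which enters with a plus sign.\<close>

lemma image_sum_lower:
  assumes t: "0 < t" "t \<le> pi" and s: "0 \<le> s" "s \<le> pi"
  shows "gauss_g t s \<le> image_sum t N s"
proof -
  define b x where "b = pi\<^sup>2 / t" and "x = s / pi"
  have "pi * t \<le> pi * pi" using t by (intro mult_left_mono) auto
  then have "b \<ge> pi" using t by (simp add: b_def field_simps power2_eq_square)
  then have b: "b \<ge> 2" using pi_gt3 by linarith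
  have x: "0 \<le> x" "x \<le> 1" using s by (auto simp: x_def)
  have "0 \<le> (\<Sum>i<N. (- 1) ^ i * image_pair t (Suc i) s)"
  proof (rule conjunct1[OF alternating_sum_bounds])
    fix i
    have "Suc i \<ge> 2 \<or> b \<ge> 2 \<and> Suc i = 1" using b by auto
    then show "0 \<le> image_pair t (Suc i) s" "image_pair t (Suc (Suc i)) s \<le> image_pair t (Suc i) s"
      unfolding image_pair_eq[OF t(1)] b_def[symmetric] x_def[symmetric]
      using image_factor_decreasing[of b x "Suc i"] image_factor_condition[of b "Suc i"] b x
      by (auto intro!: mult_left_mono)
  qed
  then show ?thesis unfolding image_sum_alt by simp
qed

section \<open>The sine sums for long times\<close>

lemma jordan_sin_ge:
  assumes "0 \<le> u" "u \<le> pi / 2" shows "2 * u / pi \<le> sin u"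
proof -
  have "convex_on {0..pi / 2} (\<lambda>x. - sin x)"
    by (rule f''_ge0_imp_convex[where f' = "\<lambda>x. - cos x" and f'' = sin])
       (auto intro!: derivative_eq_intros sin_ge_zero)
  from convex_onD[OF this, of "u / (pi / 2)" 0 "pi / 2"] assms show ?thesis by (simp add: field_simps)
qed

lemma abs_sin_mult_le: "\<bar>sin (real m * u)\<bar> \<le> real m * \<bar>sin u\<bar>"
proof (induction m)
  case (Suc m)
  have "\<bar>sin (real (Suc m) * u)\<bar> \<le> \<bar>sin (real m * u)\<bar> * \<bar>cos u\<bar> + \<bar>cos (real m * u)\<bar> * \<bar>sin u\<bar>"
    by (simp add: distrib_right sin_add order_trans[OF abs_triangle_ineq] abs_mult add.commute[of 1])
  also have "\<dots> \<le> \<bar>sin (real m * u)\<bar> * 1 + 1 * \<bar>sin u\<bar>"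
    by (intro add_mono mult_left_mono mult_right_mono) auto
  finally show ?case using Suc by (simp add: distrib_right)
qed simp

text \<open>The term n = 0 carries the bound. With u = s/2, the others together cost at most half of
  it, by \<bar>sin ((2 n + 1) u)\<bar> \<le> (2 n + 1) sin u and a telescoping bound for the
  weights. For t \<ge> \<pi> half the prefactor is at least \<pi>, and Jordan's inequality gives s
  \<le> \<pi> sin u.\<close>

lemma sine_sum_lower:
  assumes t: "pi \<le> t" and s: "0 \<le> s" "s \<le> pi"
  shows "exp (- t / 4) * gauss_g t s \<le> sine_sum t N s"
proof -
  define u where "u = s / 2"
  have u: "0 \<le> u" "u \<le> pi / 2" using s by (auto simp: u_def)
  have su: "0 \<le> sin u" using u by (intro sin_ge_zero) auto
  define a where "a n = (2 * real n + 1) * exp (- ((2 * real n + 1) / 2)\<^sup>2 * t) * sin ((2 * real n + 1) / 2 * s)" for n :: nat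
  have t3: "3 \<le> t" "0 < t" using t pi_gt3 by auto
  have bnd: "- (exp (- t / 4) * sin u * (1 / 2 * (1 / real n - 1 / (real n + 1)))) \<le> a n" if n: "n \<ge> 1" for n
  proof -
    define m where "m = real n * (real n + 1)"
    have m: "2 \<le> m" using n mult_mono[of 1 "real n" 2 "real n + 1"] by (simp add: m_def)
    \<comment> \<open>The decay exp (-m t) is used only through t \<ge> 3. The aim is a bound of
      order 1/m, because 1/m = 1/n - 1/(n + 1) telescopes.\<close>
    have "2 * m * (4 * m + 1) \<le> (1 + 2 * m) ^ 3"
      using m by (simp add: power3_eq_cube algebra_simps)
    also have "(1 + 2 * m) ^ 3 \<le> exp m ^ 3"
    proof (rule power_mono)
      have "2 * m \<le> m * m" using m by (intro mult_right_mono) auto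
      then show "1 + 2 * m \<le> exp m"
        using exp_lower_Taylor_quadratic[of m] m unfolding power2_eq_square by linarith
    qed (use m in simp)
    also have "exp m ^ 3 \<le> exp (m * t)" using t3 m by (simp add: mult.commute flip: exp_of_nat_mult)
    finally have "(4 * m + 1) * exp (- (m * t)) \<le> 1 / (2 * m)" using m by (simp add: exp_minus field_simps)
    moreover have "4 * m + 1 = (2 * real n + 1)\<^sup>2" by (simp add: m_def power2_eq_square algebra_simps)
    moreover have "1 / (2 * m) = 1 / 2 * (1 / real n - 1 / (real n + 1))" using n by (simp add: m_def field_simps)
    ultimately have q: "(2 * real n + 1)\<^sup>2 * exp (- (m * t)) \<le> 1 / 2 * (1 / real n - 1 / (real n + 1))" by simp
    have ex: "exp (- ((2 * real n + 1) / 2)\<^sup>2 * t) = exp (- t / 4) * exp (- (m * t))"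
      by (simp add: m_def power2_eq_square field_simps flip: exp_add)
    have "(2 * real n + 1) / 2 * s = real (2 * n + 1) * u" by (simp add: u_def)
    moreover have "\<bar>sin (real (2 * n + 1) * u)\<bar> \<le> (2 * real n + 1) * sin u"
      using abs_sin_mult_le[of "2 * n + 1" u] su by (simp add: add.commute)
    ultimately have "\<bar>sin ((2 * real n + 1) / 2 * s)\<bar> \<le> (2 * real n + 1) * sin u" by simp
    then have "\<bar>a n\<bar> \<le> (2 * real n + 1) * exp (- ((2 * real n + 1) / 2)\<^sup>2 * t) * ((2 * real n + 1) * sin u)"
      unfolding a_def abs_mult by (intro mult_mono) auto
    also have "\<dots> = exp (- t / 4) * sin u * ((2 * real n + 1)\<^sup>2 * exp (- (m * t)))"
      unfolding ex by (simp add: power2_eq_square)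
    also have "\<dots> \<le> exp (- t / 4) * sin u * (1 / 2 * (1 / real n - 1 / (real n + 1)))"
      using q su by (intro mult_left_mono) auto
    finally show ?thesis by linarith
  qed
  \<comment> \<open>The telescoped remainder is kept in the claim to make the induction close; only
    the part 1/2 is used afterwards.\<close>
  have "exp (- t / 4) * sin u * (1 / 2 + 1 / 2 * (1 / (real N + 1))) \<le> (\<Sum>n\<le>N. a n)"
  proof (induction N)
    case 0
    then show ?case by (simp add: a_def u_def power2_eq_square)
  next
    case (Suc N)
    have "exp (- t / 4) * sin u * (1 / 2 + 1 / 2 * (1 / (real (Suc N) + 1)))
      = exp (- t / 4) * sin u * (1 / 2 + 1 / 2 * (1 / (real N + 1)))
        - exp (- t / 4) * sin u * (1 / 2 * (1 / real (Suc N) - 1 / (real (Suc N) + 1)))"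
      by (simp add: algebra_simps)
    then show ?case using Suc bnd[of "Suc N"] by simp
  qed
  moreover have "exp (- t / 4) * sin u * (1 / 2) \<le> exp (- t / 4) * sin u * (1 / 2 + 1 / 2 * (1 / (real N + 1)))"
    using su by (intro mult_left_mono) auto
  ultimately have A: "exp (- t / 4) * sin u / 2 \<le> (\<Sum>n\<le>N. a n)" by linarith
  define \<kappa> where "\<kappa> = 2 * t * sqrt (pi * t) / pi"
  have "sqrt (pi * pi) \<le> sqrt (pi * t)" using t by (intro real_sqrt_le_mono mult_left_mono) auto
  then have "pi * pi \<le> t * sqrt (pi * t)" using t t3 by (intro mult_mono) auto
  then have k: "2 * pi \<le> \<kappa>" by (simp add: \<kappa>_def field_simps)
  have "gauss_g t s \<le> s" using s t3 by (simp add: gauss_g_def mult_left_le)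
  also have "\<dots> \<le> pi * sin u" using jordan_sin_ge[OF u] by (simp add: u_def field_simps)
  also have "\<dots> \<le> \<kappa> / 2 * sin u" using k su by (intro mult_right_mono) auto
  finally have "exp (- t / 4) * gauss_g t s \<le> exp (- t / 4) * (\<kappa> / 2 * sin u)" by (intro mult_left_mono) auto
  also have "\<dots> = \<kappa> * (exp (- t / 4) * sin u / 2)" by simp
  also have "\<dots> \<le> \<kappa> * (\<Sum>n\<le>N. a n)" using A k pi_gt_zero by (intro mult_left_mono) linarith+
  finally show ?thesis by (simp add: sine_sum_def \<kappa>_def a_def)
qed

section \<open>The Abel integral of the Gaussian\<close>

text \<open>On [0, \<pi>/2] the difference vanishes at 0 and has derivative cos u - 1 + 2 u / \<pi>,
  nonnegative by concavity of cos; both sides are symmetric about \<pi>/2.\<close>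

lemma sin_ge_parabola:
  assumes u: "0 \<le> u" "u \<le> pi" shows "u * (pi - u) / pi \<le> sin u"
proof -
  have half: "u * (pi - u) / pi \<le> sin u" if u: "0 \<le> u" "u \<le> pi / 2" for u
  proof -
    have c: "1 - 2 * x / pi \<le> cos x" if "0 \<le> x" "x \<le> pi / 2" for x
    proof -
      have "convex_on {0..pi / 2} (\<lambda>x. - cos x)"
        by (rule f''_ge0_imp_convex[where f' = sin and f'' = cos])
           (auto intro!: derivative_eq_intros cos_ge_zero)
      from convex_onD[OF this, of "x / (pi / 2)" 0 "pi / 2"] that show ?thesis by (simp add: field_simps)
    qed
    have "(\<lambda>u. sin u - u + u\<^sup>2 / pi) 0 \<le> (\<lambda>u. sin u - u + u\<^sup>2 / pi) u"
    proof (rule DERIV_nonneg_imp_nondecreasing[OF u(1)])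
      fix y assume "0 \<le> y" "y \<le> u"
      then show "\<exists>d. ((\<lambda>u. sin u - u + u\<^sup>2 / pi) has_real_derivative d) (at y) \<and> 0 \<le> d"
        using c[of y] u by (intro exI[of _ "cos y - 1 + 2 * y / pi"]) (auto intro!: derivative_eq_intros)
    qed
    then show ?thesis by (simp add: field_simps power2_eq_square)
  qed
  show ?thesis
  proof (cases "u \<le> pi / 2")
    case False
    then have "(pi - u) * (pi - (pi - u)) / pi \<le> sin (pi - u)" using u by (intro half) auto
    then show ?thesis by (simp add: mult.commute)
  qed (use half u in auto)
qed

text \<open>Write cos \<phi> - cos s = 2 sin u sin v with u, v half the difference and half the sum,
  and apply the parabola bound to both sines. The factor \<pi>^2 - \<phi>^2 records the flattening
  near the antipode; it comes from 4 (\<pi> - u) (\<pi> - v) - (\<pi>^2 - \<phi>^2) = (\<pi> - s) (3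
  \<pi> - s) \<ge> 0.\<close>

lemma cos_diff_ge:
  assumes "0 \<le> \<phi>" "\<phi> \<le> s" "s \<le> pi"
  shows "(s\<^sup>2 - \<phi>\<^sup>2) * (pi\<^sup>2 - \<phi>\<^sup>2) / (8 * pi\<^sup>2) \<le> cos \<phi> - cos s"
proof -
  define u v where "u = (s - \<phi>) / 2" and "v = (s + \<phi>) / 2"
  have uv: "0 \<le> u" "u \<le> pi" "0 \<le> v" "v \<le> pi" using assms by (auto simp: u_def v_def)
  have e: "cos \<phi> - cos s = 2 * (sin u * sin v)"
    using sin_times_sin[of u v] by (simp add: u_def v_def field_simps) 
  have "(u * (pi - u) / pi) * (v * (pi - v) / pi) \<le> sin u * sin v"
    using uv by (intro mult_mono sin_ge_parabola) (auto intro: sin_ge_zero)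
  moreover have "(s\<^sup>2 - \<phi>\<^sup>2) * (pi\<^sup>2 - \<phi>\<^sup>2) / (8 * pi\<^sup>2) \<le> 2 * ((u * (pi - u) / pi) * (v * (pi - v) / pi))"
  proof -
    have "0 \<le> (pi - s) * (3 * pi - s)" using assms pi_gt_zero by (intro mult_nonneg_nonneg) linarith+
    moreover have "4 * ((pi - u) * (pi - v)) - (pi\<^sup>2 - \<phi>\<^sup>2) = (pi - s) * (3 * pi - s)"
      by (simp add: u_def v_def field_simps power2_eq_square)
    ultimately have "(pi\<^sup>2 - \<phi>\<^sup>2) \<le> 4 * ((pi - u) * (pi - v))" by linarith
    then have "(u * v) * (pi\<^sup>2 - \<phi>\<^sup>2) \<le> (u * v) * (4 * ((pi - u) * (pi - v)))"
      using uv by (intro mult_left_mono) auto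
    then have "(u * v) * (pi\<^sup>2 - \<phi>\<^sup>2) / (2 * pi\<^sup>2) \<le> (u * v) * (4 * ((pi - u) * (pi - v))) / (2 * pi\<^sup>2)"
      by (intro divide_right_mono) auto
    moreover have "s\<^sup>2 - \<phi>\<^sup>2 = 4 * (u * v)" by (simp add: u_def v_def field_simps power2_eq_square)
    moreover have "(u * v) * (4 * ((pi - u) * (pi - v))) / (2 * pi\<^sup>2) = 2 * ((u * (pi - u) / pi) * (v * (pi - v) / pi))"
      by (simp add: power2_eq_square)
    ultimately show ?thesis by simp
  qed
  ultimately show ?thesis unfolding e by linarith
qed

text \<open>The same product, with sin v \<le> v away from the antipode and sin v \<le> \<pi> - v
  \<le> \<pi> - \<phi> close to it.\<close>

lemma cos_diff_le:
  assumes "0 \<le> \<phi>" "\<phi> \<le> s" "s \<le> pi"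
  shows "cos \<phi> - cos s \<le> (s\<^sup>2 - \<phi>\<^sup>2) / 2" "cos \<phi> - cos s \<le> (s - \<phi>) * (pi - \<phi>)"
proof -
  define u v where "u = (s - \<phi>) / 2" and "v = (s + \<phi>) / 2"
  have uv: "0 \<le> u" "u \<le> pi" "0 \<le> v" "v \<le> pi" using assms by (auto simp: u_def v_def)
  have e: "cos \<phi> - cos s = 2 * (sin u * sin v)"
    using sin_times_sin[of u v] by (simp add: u_def v_def field_simps)
  have su: "sin u \<le> u" "0 \<le> sin u" "sin v \<le> v" "0 \<le> sin v"
    using uv by (auto intro: sin_x_le_x sin_ge_zero)
  have "sin v \<le> pi - v" using sin_x_le_x[of "pi - v"] uv by simp
  moreover have "\<phi> \<le> v" using assms by (simp add: v_def)
  ultimately have v2: "sin v \<le> pi - \<phi>" by linarith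
  have "sin u * sin v \<le> u * v" using su uv by (intro mult_mono) auto
  then show "cos \<phi> - cos s \<le> (s\<^sup>2 - \<phi>\<^sup>2) / 2"
    unfolding e by (simp add: u_def v_def field_simps power2_eq_square)
  have "sin u * sin v \<le> u * (pi - \<phi>)" using su v2 uv by (intro mult_mono) auto
  then show "cos \<phi> - cos s \<le> (s - \<phi>) * (pi - \<phi>)"
    unfolding e by (simp add: u_def)
qed

section \<open>Truncated Gaussian integrals and the bounds for \<open>abel_gauss\<close>\<close>

definition gauss_int :: "real \<Rightarrow> real \<Rightarrow> real" where
  "gauss_int t R = integral {0..R} (\<lambda>w. exp (- w\<^sup>2 / (4 * t)))"

lemma gauss_int_facts:
  assumes t: "t > 0" and R: "0 \<le> R"
  shows "gauss_int t R \<le> R" "gauss_int t R \<le> sqrt (pi * t)"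
    "0 \<le> r \<Longrightarrow> r \<le> R \<Longrightarrow> r * exp (- r\<^sup>2 / (4 * t)) \<le> gauss_int t R"
proof -
  have i: "(\<lambda>w. exp (- w\<^sup>2 / (4 * t))) integrable_on {0..x}" for x
    by (intro integrable_continuous_interval continuous_intros) (use t in auto)
  have "gauss_int t R \<le> integral {0..R} (\<lambda>w. 1)"
    unfolding gauss_int_def using t by (intro integral_le i) auto
  then show "gauss_int t R \<le> R" using R by simp
  have mono: "gauss_int t x \<le> gauss_int t y" if "0 \<le> x" "x \<le> y" for x y
    unfolding gauss_int_def using that by (intro integral_subset_le i) auto
  have "((\<lambda>R. gauss_int t R) \<longlongrightarrow> sqrt (pi * t)) at_top"
    using gaussian_cos_integral_tendsto[OF t, of 0] by (simp add: gauss_int_def)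
  moreover have "eventually (\<lambda>x. gauss_int t R \<le> gauss_int t x) at_top"
    using eventually_ge_at_top[of R] by eventually_elim (use mono R in auto)
  ultimately show "gauss_int t R \<le> sqrt (pi * t)" by (rule tendsto_lowerbound) simp
  assume r: "0 \<le> r" "r \<le> R"
  have "r * exp (- r\<^sup>2 / (4 * t)) = integral {0..r} (\<lambda>w. exp (- r\<^sup>2 / (4 * t)))" using r by simp
  also have "\<dots> \<le> gauss_int t r"
    unfolding gauss_int_def
  proof (intro integral_le i)
    fix w assume "w \<in> {0..r}"
    then have "w\<^sup>2 \<le> r\<^sup>2" by (intro power_mono) auto
    then show "exp (- r\<^sup>2 / (4 * t)) \<le> exp (- w\<^sup>2 / (4 * t))" using t by (simp add: divide_right_mono)
  qed auto
  also have "\<dots> \<le> gauss_int t R" using mono r by auto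
  finally show "r * exp (- r\<^sup>2 / (4 * t)) \<le> gauss_int t R" .
qed

text \<open>The substitution w = sqrt (s^2 - \<phi>^2) splits off exp (-\<phi>^2 / (4 t)) exactly.
  With s^2 - \<phi>^2 in place of cos \<phi> - cos s the Abel integral is therefore
  explicit.\<close>

lemma gauss_g_abel_has_integral:
  assumes t: "t > 0" and p: "0 \<le> \<phi>" "\<phi> \<le> pi"
  shows "((\<lambda>s. gauss_g t s / sqrt (s\<^sup>2 - \<phi>\<^sup>2)) has_integral
    exp (- \<phi>\<^sup>2 / (4 * t)) * gauss_int t (sqrt (pi\<^sup>2 - \<phi>\<^sup>2))) {\<phi>..pi}"
proof -
  define E where "E w = exp (- w\<^sup>2 / (4 * t))" for w
  have cE: "continuous_on A E" for A unfolding E_def by (intro continuous_intros) (use t in auto)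
  define F where "F s = exp (- \<phi>\<^sup>2 / (4 * t)) * gauss_int t (sqrt (s\<^sup>2 - \<phi>\<^sup>2))" for s
  have cont: "continuous_on {0..R} (gauss_int t)" for R
    unfolding gauss_int_def using cE unfolding E_def
    by (intro indefinite_integral_continuous_1 integrable_continuous_interval)
  have der: "(gauss_int t has_real_derivative E x) (at x)" if "x > 0" for x
  proof -
    have "(gauss_int t has_real_derivative E x) (at x within {0..x + 1})"
      unfolding gauss_int_def[abs_def] has_real_derivative_iff_has_vector_derivative E_def
      using that cE unfolding E_def by (intro integral_has_vector_derivative) auto
    moreover have "at x within {0..x + 1} = at x"
      using that by (intro at_within_interior) auto
    ultimately show ?thesis by simp
  qed
  have "((\<lambda>s. gauss_g t s / sqrt (s\<^sup>2 - \<phi>\<^sup>2)) has_integral F pi - F \<phi>) {\<phi>..pi}"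
  proof (rule fundamental_theorem_of_calculus_interior[OF p(2)])
    have sub: "(\<lambda>s. sqrt (s\<^sup>2 - \<phi>\<^sup>2)) ` {\<phi>..pi} \<subseteq> {0..sqrt (pi\<^sup>2 - \<phi>\<^sup>2)}"
      using p by (auto intro!: power_mono)
    show "continuous_on {\<phi>..pi} F"
      unfolding F_def by (intro continuous_intros continuous_on_compose2[OF cont _ sub])
    fix s assume s: "s \<in> {\<phi><..<pi}"
    then have "\<phi>\<^sup>2 < s\<^sup>2" using p by (intro power_strict_mono) auto
    then have q: "0 < sqrt (s\<^sup>2 - \<phi>\<^sup>2)" "0 < s\<^sup>2 - \<phi>\<^sup>2" by auto
    have "((\<lambda>s. sqrt (s\<^sup>2 - \<phi>\<^sup>2)) has_real_derivative s / sqrt (s\<^sup>2 - \<phi>\<^sup>2)) (at s)"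
      using q by (auto intro!: derivative_eq_intros simp: field_simps)
    from DERIV_chain2[where f = "gauss_int t" and g = "\<lambda>s. sqrt (s\<^sup>2 - \<phi>\<^sup>2)", OF der[OF q(1)] this]
    have D: "(F has_real_derivative exp (- \<phi>\<^sup>2 / (4 * t)) * (E (sqrt (s\<^sup>2 - \<phi>\<^sup>2)) * (s / sqrt (s\<^sup>2 - \<phi>\<^sup>2)))) (at s)"
      unfolding F_def by (rule DERIV_cmult)
    have "exp (- \<phi>\<^sup>2 / (4 * t)) * E (sqrt (s\<^sup>2 - \<phi>\<^sup>2)) = exp (- s\<^sup>2 / (4 * t))"
      using q(2) by (simp add: E_def diff_divide_distrib flip: exp_add)
    then have "exp (- \<phi>\<^sup>2 / (4 * t)) * (E (sqrt (s\<^sup>2 - \<phi>\<^sup>2)) * (s / sqrt (s\<^sup>2 - \<phi>\<^sup>2))) = gauss_g t s / sqrt (s\<^sup>2 - \<phi>\<^sup>2)"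
      by (simp only: mult.assoc[symmetric] gauss_g_def) simp
    from DERIV_cong[OF D this] show "(F has_vector_derivative gauss_g t s / sqrt (s\<^sup>2 - \<phi>\<^sup>2)) (at s)"
      unfolding has_real_derivative_iff_has_vector_derivative .
  qed
  then show ?thesis by (simp add: F_def gauss_int_def)
qed

text \<open>The inner integral after exchanging the order of integration, as a nonnegative Lebesgue
  integral so that no integrability has to be checked.\<close>

definition abel_gauss :: "real \<Rightarrow> real \<Rightarrow> ennreal" where
  "abel_gauss t \<phi> = (\<integral>\<^sup>+s. ennreal (indicator {\<phi><..pi} s * (gauss_g t s / sqrt (cos \<phi> - cos s))) \<partial>lborel)"

lemma gauss_g_measurable [measurable]: "gauss_g t \<in> borel_measurable borel"
  unfolding gauss_g_def[abs_def] by measurable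

lemma nn_integral_Ioc_eq:
  fixes f :: "real \<Rightarrow> real"
  assumes [measurable]: "f \<in> borel_measurable borel" and nn: "\<And>x. x \<in> {a<..b} \<Longrightarrow> 0 \<le> f x"
    and i: "(f has_integral I) {a..b}"
  shows "(\<integral>\<^sup>+x. ennreal (indicator {a<..b} x * f x) \<partial>lborel) = ennreal I"
proof (rule nn_integral_has_integral_lborel)
  have "((\<lambda>x. if x \<in> {a..b} then f x else 0) has_integral I) UNIV"
    using i by (simp only: has_integral_restrict_UNIV)
  then show "((\<lambda>x. indicator {a<..b} x * f x) has_integral I) UNIV"
    by (rule has_integral_spike[of "{a}", rotated 2]) (auto simp: indicator_def)
qed (use nn in \<open>auto simp: indicator_def\<close>)

lemma abel_gauss_upper:
  assumes t: "t > 0" and p: "0 \<le> \<phi>" "\<phi> < pi"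
  shows "abel_gauss t \<phi> \<le> ennreal (sqrt 8 * pi / sqrt (pi\<^sup>2 - \<phi>\<^sup>2) *
    (exp (- \<phi>\<^sup>2 / (4 * t)) * gauss_int t (sqrt (pi\<^sup>2 - \<phi>\<^sup>2))))"
proof -
  have pp: "\<phi>\<^sup>2 < pi\<^sup>2" using p by (intro power_strict_mono) auto
  define k where "k = sqrt 8 * pi / sqrt (pi\<^sup>2 - \<phi>\<^sup>2)"
  have k: "0 \<le> k" using pp by (simp add: k_def)
  have "abel_gauss t \<phi> \<le> (\<integral>\<^sup>+s. ennreal (indicator {\<phi><..pi} s * (k * (gauss_g t s / sqrt (s\<^sup>2 - \<phi>\<^sup>2)))) \<partial>lborel)"
    unfolding abel_gauss_def
  proof (intro nn_integral_mono ennreal_leI)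
    fix s
    show "indicator {\<phi><..pi} s * (gauss_g t s / sqrt (cos \<phi> - cos s))
      \<le> indicator {\<phi><..pi} s * (k * (gauss_g t s / sqrt (s\<^sup>2 - \<phi>\<^sup>2)))"
    proof (cases "s \<in> {\<phi><..pi}")
      case True
      then have s: "\<phi> < s" "s \<le> pi" by auto
      have "\<phi>\<^sup>2 < s\<^sup>2" using s p by (intro power_strict_mono) auto
      then have q: "0 < s\<^sup>2 - \<phi>\<^sup>2" "0 < pi\<^sup>2 - \<phi>\<^sup>2" using pp by auto
      have g: "0 \<le> gauss_g t s" using s p by (simp add: gauss_g_def)
      have "cos s < cos \<phi>" using s p by (intro cos_monotone_0_pi) auto
      then have c: "0 < sqrt (cos \<phi> - cos s)" by simp
      have "sqrt ((s\<^sup>2 - \<phi>\<^sup>2) * (pi\<^sup>2 - \<phi>\<^sup>2) / (8 * pi\<^sup>2)) \<le> sqrt (cos \<phi> - cos s)"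
        using cos_diff_ge[of \<phi> s] s p by (intro real_sqrt_le_mono) auto
      moreover have "sqrt ((s\<^sup>2 - \<phi>\<^sup>2) * (pi\<^sup>2 - \<phi>\<^sup>2) / (8 * pi\<^sup>2)) = sqrt (s\<^sup>2 - \<phi>\<^sup>2) / k"
        by (simp add: k_def real_sqrt_mult real_sqrt_divide)
      ultimately have "gauss_g t s / sqrt (cos \<phi> - cos s) \<le> gauss_g t s / (sqrt (s\<^sup>2 - \<phi>\<^sup>2) / k)"
        using g q c by (intro divide_left_mono mult_pos_pos) (auto simp: k_def)
      then show ?thesis using True by (simp add: mult.commute)
    qed simp
  qed
  also have "\<dots> = ennreal (k * (exp (- \<phi>\<^sup>2 / (4 * t)) * gauss_int t (sqrt (pi\<^sup>2 - \<phi>\<^sup>2))))"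
  proof (rule nn_integral_Ioc_eq)
    show "((\<lambda>s. k * (gauss_g t s / sqrt (s\<^sup>2 - \<phi>\<^sup>2))) has_integral
      k * (exp (- \<phi>\<^sup>2 / (4 * t)) * gauss_int t (sqrt (pi\<^sup>2 - \<phi>\<^sup>2)))) {\<phi>..pi}"
      using gauss_g_abel_has_integral[OF t p(1) less_imp_le[OF p(2)]] by (rule has_integral_mult_right)
    fix s assume "s \<in> {\<phi><..pi}"
    then have "0 \<le> gauss_g t s" "\<phi>\<^sup>2 \<le> s\<^sup>2" using p by (auto simp: gauss_g_def intro: power_mono)
    then show "0 \<le> k * (gauss_g t s / sqrt (s\<^sup>2 - \<phi>\<^sup>2))" using k by simp
  qed measurable
  finally show ?thesis by (simp add: k_def)
qed

lemma abel_gauss_lower_int: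
  assumes t: "t > 0" and p: "0 \<le> \<phi>" "\<phi> < pi"
  shows "ennreal (sqrt 2 * (exp (- \<phi>\<^sup>2 / (4 * t)) * gauss_int t (sqrt (pi\<^sup>2 - \<phi>\<^sup>2)))) \<le> abel_gauss t \<phi>"
proof -
  have "ennreal (sqrt 2 * (exp (- \<phi>\<^sup>2 / (4 * t)) * gauss_int t (sqrt (pi\<^sup>2 - \<phi>\<^sup>2))))
    = (\<integral>\<^sup>+s. ennreal (indicator {\<phi><..pi} s * (sqrt 2 * (gauss_g t s / sqrt (s\<^sup>2 - \<phi>\<^sup>2)))) \<partial>lborel)"
  proof (rule nn_integral_Ioc_eq[symmetric])
    show "((\<lambda>s. sqrt 2 * (gauss_g t s / sqrt (s\<^sup>2 - \<phi>\<^sup>2))) has_integral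
      sqrt 2 * (exp (- \<phi>\<^sup>2 / (4 * t)) * gauss_int t (sqrt (pi\<^sup>2 - \<phi>\<^sup>2)))) {\<phi>..pi}"
      using gauss_g_abel_has_integral[OF t p(1) less_imp_le[OF p(2)]] by (rule has_integral_mult_right)
    fix s assume "s \<in> {\<phi><..pi}"
    then have "0 \<le> gauss_g t s" "\<phi>\<^sup>2 \<le> s\<^sup>2" using p by (auto simp: gauss_g_def intro: power_mono)
    then show "0 \<le> sqrt 2 * (gauss_g t s / sqrt (s\<^sup>2 - \<phi>\<^sup>2))" by simp
  qed measurable
  also have "\<dots> \<le> abel_gauss t \<phi>"
    unfolding abel_gauss_def
  proof (intro nn_integral_mono ennreal_leI)
    fix s
    show "indicator {\<phi><..pi} s * (sqrt 2 * (gauss_g t s / sqrt (s\<^sup>2 - \<phi>\<^sup>2)))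
      \<le> indicator {\<phi><..pi} s * (gauss_g t s / sqrt (cos \<phi> - cos s))"
    proof (cases "s \<in> {\<phi><..pi}")
      case True
      then have s: "\<phi> < s" "s \<le> pi" by auto
      have g: "0 \<le> gauss_g t s" using s p by (simp add: gauss_g_def)
      have c: "cos s < cos \<phi>" using s p by (intro cos_monotone_0_pi) auto
      have "sqrt (cos \<phi> - cos s) \<le> sqrt ((s\<^sup>2 - \<phi>\<^sup>2) / 2)"
        using cos_diff_le(1)[of \<phi> s] s p by (intro real_sqrt_le_mono) auto
      then have "gauss_g t s / sqrt ((s\<^sup>2 - \<phi>\<^sup>2) / 2) \<le> gauss_g t s / sqrt (cos \<phi> - cos s)"
        using g c by (intro divide_left_mono mult_pos_pos) (auto intro: less_le_trans[of _ "sqrt (cos \<phi> - cos s)"])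
      then show ?thesis using True by (simp add: real_sqrt_divide mult.commute)
    qed simp
  qed
  finally show ?thesis .
qed

text \<open>Only s in (\<phi>, \<phi> + \<tau>] is kept. There s^2 - \<phi>^2 \<le> (t/2) (2 \<pi>),
  so the Gaussian loses at most the factor exp (-\<pi>/4), and the integral of 1 / sqrt (s - \<phi>)
  over this range is 2 sqrt \<tau>.\<close>

lemma abel_gauss_lower_near_antipode:
  assumes t: "t > 0" and p: "0 \<le> \<phi>" "\<phi> < pi" and \<tau>: "0 \<le> \<tau>" "\<tau> \<le> t / 2" "\<tau> \<le> pi - \<phi>"
  shows "ennreal (exp (- \<phi>\<^sup>2 / (4 * t)) * exp (- pi / 4) * (2 * \<phi> * sqrt \<tau> / sqrt (pi - \<phi>))) \<le> abel_gauss t \<phi>"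
proof -
  define c where "c = exp (- \<phi>\<^sup>2 / (4 * t)) * exp (- pi / 4) * (\<phi> / sqrt (pi - \<phi>))"
  have "0 \<le> c" using p by (simp add: c_def)
  have "((\<lambda>s. 1 / sqrt (s - \<phi>)) has_integral 2 * sqrt (\<phi> + \<tau> - \<phi>) - 2 * sqrt (\<phi> - \<phi>)) {\<phi>..\<phi> + \<tau>}"
    using \<tau> by (intro fundamental_theorem_of_calculus_interior)
      (auto intro!: derivative_eq_intros continuous_intros simp: field_simps simp flip: has_real_derivative_iff_has_vector_derivative)
  then have "((\<lambda>s. c * (1 / sqrt (s - \<phi>))) has_integral c * (2 * sqrt \<tau>)) {\<phi>..\<phi> + \<tau>}"
    by (intro has_integral_mult_right) simp
  then have "ennreal (c * (2 * sqrt \<tau>)) = (\<integral>\<^sup>+s. ennreal (indicator {\<phi><..\<phi> + \<tau>} s * (c * (1 / sqrt (s - \<phi>)))) \<partial>lborel)"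
    using \<open>0 \<le> c\<close> by (intro nn_integral_Ioc_eq[symmetric]) auto
  also have "\<dots> \<le> abel_gauss t \<phi>"
    unfolding abel_gauss_def
  proof (intro nn_integral_mono ennreal_leI)
    fix s
    show "indicator {\<phi><..\<phi> + \<tau>} s * (c * (1 / sqrt (s - \<phi>)))
      \<le> indicator {\<phi><..pi} s * (gauss_g t s / sqrt (cos \<phi> - cos s))"
    proof (cases "s \<in> {\<phi><..\<phi> + \<tau>}")
      case True
      then have s: "\<phi> < s" "s \<le> \<phi> + \<tau>" "s \<le> pi" using \<tau> by auto
      have cs: "cos s < cos \<phi>" using s p by (intro cos_monotone_0_pi) auto
      have "sqrt (cos \<phi> - cos s) \<le> sqrt ((s - \<phi>) * (pi - \<phi>))"
        using cos_diff_le(2)[of \<phi> s] s p by (intro real_sqrt_le_mono) auto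
      then have sq: "sqrt (cos \<phi> - cos s) \<le> sqrt (pi - \<phi>) * sqrt (s - \<phi>)"
        by (simp add: real_sqrt_mult mult.commute)
      have "(s - \<phi>) * (s + \<phi>) \<le> t / 2 * (2 * pi)" using s \<tau> p t by (intro mult_mono) auto
      then have "s\<^sup>2 \<le> pi * t + \<phi>\<^sup>2" by (simp add: algebra_simps power2_eq_square)
      then have "s\<^sup>2 / (4 * t) \<le> (pi * t + \<phi>\<^sup>2) / (4 * t)" using t by (intro divide_right_mono) auto
      also have "\<dots> = pi / 4 + \<phi>\<^sup>2 / (4 * t)" using t by (simp add: add_divide_distrib)
      finally have "- \<phi>\<^sup>2 / (4 * t) + - pi / 4 \<le> - s\<^sup>2 / (4 * t)" by simp
      then have "exp (- \<phi>\<^sup>2 / (4 * t)) * exp (- pi / 4) \<le> exp (- s\<^sup>2 / (4 * t))" by (simp flip: exp_add)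
      then have g: "\<phi> * (exp (- \<phi>\<^sup>2 / (4 * t)) * exp (- pi / 4)) \<le> gauss_g t s"
        unfolding gauss_g_def using s p by (intro mult_mono) auto
      have "c * (1 / sqrt (s - \<phi>)) = \<phi> * (exp (- \<phi>\<^sup>2 / (4 * t)) * exp (- pi / 4)) / (sqrt (pi - \<phi>) * sqrt (s - \<phi>))"
        by (simp add: c_def)
      also have "\<dots> \<le> gauss_g t s / sqrt (cos \<phi> - cos s)"
        using g sq cs p by (intro frac_le) (auto simp: gauss_g_def intro: order_trans[of _ "\<phi> * (exp (- \<phi>\<^sup>2 / (4 * t)) * exp (- pi / 4))"])
      finally show ?thesis using True s by simp
    next
      case False
      moreover have "0 \<le> gauss_g t s / sqrt (cos \<phi> - cos s)" if "\<phi> < s" "s \<le> pi"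
        using that p cos_monotone_0_pi_le[of \<phi> s] by (simp add: gauss_g_def)
      ultimately show ?thesis by (auto simp: indicator_def)
    qed
  qed
  finally show ?thesis by (simp add: c_def mult_ac)
qed

text \<open>Below the threshold the trivial bound gauss_int t W \<le> W is used, and \<pi>^2/8 is
  the constant for which it matches the claim with equality. Above it the full Gaussian integral
  sqrt (\<pi> t), the bound W \<ge> sqrt (\<pi> (\<pi> - \<phi>)) and sqrt 8 \<le> \<pi> are
  enough.\<close>

lemma abel_gauss_le:
  assumes t: "t > 0" and p: "0 \<le> \<phi>" "\<phi> < pi"
  shows "abel_gauss t \<phi> \<le> ennreal (pi\<^sup>2 * sqrt t / sqrt (max (pi\<^sup>2 / 8 * t) (pi - \<phi>)) * exp (- \<phi>\<^sup>2 / (4 * t)))"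
proof -
  define \<delta> W where "\<delta> = pi - \<phi>" and "W = sqrt (pi\<^sup>2 - \<phi>\<^sup>2)"
  have d: "0 < \<delta>" using p by (simp add: \<delta>_def)
  have W2: "pi\<^sup>2 - \<phi>\<^sup>2 = \<delta> * (pi + \<phi>)" by (simp add: \<delta>_def power2_eq_square algebra_simps)
  have W: "0 < W" using d p pi_gt_zero by (simp add: W_def W2 add_pos_nonneg)
  note \<Phi> = gauss_int_facts(1,2)[OF t less_imp_le[OF W]]
  have "sqrt 8 * pi / W * gauss_int t W \<le> pi\<^sup>2 * sqrt t / sqrt (max (pi\<^sup>2 / 8 * t) \<delta>)"
  proof (cases "\<delta> \<le> pi\<^sup>2 / 8 * t")
    case True
    have "sqrt 8 * pi / W * gauss_int t W \<le> sqrt 8 * pi / W * W"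
      using \<Phi>(1) W by (intro mult_left_mono) auto
    also have "\<dots> = sqrt 8 * pi" using W by simp
    also have "\<dots> = pi\<^sup>2 * sqrt t / sqrt (pi\<^sup>2 / 8 * t)"
      using t by (simp add: real_sqrt_mult real_sqrt_divide power2_eq_square field_simps)
    finally show ?thesis by (simp only: max.absorb1[OF True])
  next
    case False
    have "sqrt 8 * pi / W * gauss_int t W \<le> sqrt 8 * pi / W * sqrt (pi * t)"
      using \<Phi>(2) W by (intro mult_left_mono) auto
    also have "\<dots> \<le> sqrt 8 * pi / (sqrt \<delta> * sqrt pi) * sqrt (pi * t)"
    proof (intro mult_right_mono divide_left_mono)
      show "sqrt \<delta> * sqrt pi \<le> W"
        unfolding W_def W2 real_sqrt_mult[symmetric] using d p by (intro real_sqrt_le_mono mult_left_mono) auto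
    qed (use W d t in auto)
    also have "\<dots> = (sqrt 8 * pi) * (sqrt t / sqrt \<delta>)" using d by (simp add: real_sqrt_mult)
    also have "\<dots> \<le> (pi * pi) * (sqrt t / sqrt \<delta>)"
    proof -
      have "sqrt 8 \<le> sqrt (3\<^sup>2)" by (intro real_sqrt_le_mono) simp
      then have "sqrt 8 \<le> pi" using pi_gt3 by simp
      then show ?thesis using d t by (intro mult_right_mono) auto
    qed
    finally show ?thesis using False by (simp add: max.absorb2 power2_eq_square)
  qed
  then have "sqrt 8 * pi / W * gauss_int t W * exp (- \<phi>\<^sup>2 / (4 * t))
      \<le> pi\<^sup>2 * sqrt t / sqrt (max (pi\<^sup>2 / 8 * t) \<delta>) * exp (- \<phi>\<^sup>2 / (4 * t))"
    by (intro mult_right_mono) auto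
  then show ?thesis
    using abel_gauss_upper[OF t p] unfolding W_def \<delta>_def
    by (intro order_trans[OF abel_gauss_upper[OF t p] ennreal_leI]) (simp add: mult_ac)
qed

text \<open>With \<delta> = \<pi> - \<phi> and \<tau> = min (t/2) \<delta> the product max (t/2)
  \<delta> \<tau> is t \<delta> / 2, so the claim amounts to the lower bound 4 exp (-\<pi>/4) sqrt
  (\<tau>/\<delta>) exp (-\<phi>^2 / (4 t)). For \<phi> \<ge> 2 the estimate near the antipode
  supplies the factor 2 \<phi> \<ge> 4; otherwise the explicit Abel integral is cut off
  suitably.\<close>

lemma abel_gauss_ge:
  assumes t: "t > 0" and p: "0 \<le> \<phi>" "\<phi> < pi"
  shows "ennreal (2 * sqrt 2 * exp (- pi / 4) * sqrt t / sqrt (max (1 / 2 * t) (pi - \<phi>)) * exp (- \<phi>\<^sup>2 / (4 * t)))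
    \<le> abel_gauss t \<phi>"
proof -
  define \<delta> \<tau> where "\<delta> = pi - \<phi>" and "\<tau> = min (t / 2) \<delta>"
  have d: "0 < \<delta>" "\<delta> \<le> pi" using p by (auto simp: \<delta>_def)
  have \<tau>: "0 < \<tau>" "\<tau> \<le> t / 2" "\<tau> \<le> \<delta>" using t d by (auto simp: \<tau>_def)
  define G where "G = exp (- \<phi>\<^sup>2 / (4 * t))"
  have "max (1 / 2 * t) \<delta> * \<tau> = t / 2 * \<delta>" by (auto simp: \<tau>_def max_def min_def)
  then have "sqrt (max (1 / 2 * t) \<delta>) * sqrt \<tau> = sqrt t / sqrt 2 * sqrt \<delta>"
    unfolding real_sqrt_mult[symmetric] real_sqrt_divide[symmetric] by simp
  then have "sqrt \<tau> / sqrt \<delta> = sqrt t / sqrt 2 / sqrt (max (1 / 2 * t) \<delta>)"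
    using d t by (simp add: field_simps max_def split: if_splits)
  moreover have "2 * sqrt 2 = 4 / sqrt (2 :: real)" by (simp add: field_simps)
  ultimately have V: "2 * sqrt 2 * exp (- pi / 4) * sqrt t / sqrt (max (1 / 2 * t) \<delta>) * G
      = 4 * exp (- pi / 4) * (sqrt \<tau> / sqrt \<delta>) * G"
    by (simp only:) simp
  have W2: "pi\<^sup>2 - \<phi>\<^sup>2 = \<delta> * (2 * pi - \<delta>)" by (simp add: \<delta>_def power2_eq_square algebra_simps)
  \<comment> \<open>Cut off at r = sqrt (k \<tau>): the second condition keeps r inside the range of
    integration, and \<tau> \<le> t/2 gives r^2 / (4 t) \<le> k/8. The condition \<open>A\<close> is
    the square of what remains once the common factors cancel.\<close>
  have far: "ennreal (4 * exp (- pi / 4) * (sqrt \<tau> / sqrt \<delta>) * G) \<le> abel_gauss t \<phi>"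
    if k: "0 \<le> k" "k * \<tau> \<le> \<delta> * (2 * pi - \<delta>)" and A: "16 \<le> 2 * k * \<delta> * (exp (pi / 4 - k / 8))\<^sup>2" for k
  proof -
    define r where "r = sqrt (k * \<tau>)"
    have "r * exp (- r\<^sup>2 / (4 * t)) \<le> gauss_int t (sqrt (pi\<^sup>2 - \<phi>\<^sup>2))"
      unfolding r_def W2 using k \<tau> d by (intro gauss_int_facts(3) t real_sqrt_le_mono) auto
    moreover have "r * exp (- k / 8) \<le> r * exp (- r\<^sup>2 / (4 * t))"
    proof (intro mult_left_mono)
      have "k * \<tau> \<le> k * (t / 2)" using \<tau> k by (intro mult_left_mono) auto
      then show "exp (- k / 8) \<le> exp (- r\<^sup>2 / (4 * t))"
        using t k \<tau> by (simp add: r_def field_simps)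
    qed (use k \<tau> in \<open>simp add: r_def\<close>)
    ultimately have B: "sqrt 2 * (G * (r * exp (- k / 8))) \<le> sqrt 2 * (G * gauss_int t (sqrt (pi\<^sup>2 - \<phi>\<^sup>2)))"
      by (intro mult_left_mono) (auto simp: G_def)
    have "4 \<le> sqrt (2 * k * \<delta>) * exp (pi / 4 - k / 8)"
    proof (rule power2_le_imp_le)
      show "4\<^sup>2 \<le> (sqrt (2 * k * \<delta>) * exp (pi / 4 - k / 8))\<^sup>2"
        using A k d by (simp add: power_mult_distrib)
    qed (use k d in auto)
    then have "4 * (exp (- pi / 4) * (sqrt \<tau> / sqrt \<delta>) * G)
      \<le> sqrt (2 * k * \<delta>) * exp (pi / 4 - k / 8) * (exp (- pi / 4) * (sqrt \<tau> / sqrt \<delta>) * G)"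
      using \<tau> d by (intro mult_right_mono) (auto simp: G_def)
    also have "\<dots> = sqrt 2 * (G * (r * (exp (pi / 4 - k / 8) * exp (- pi / 4))))"
      using d by (simp add: r_def real_sqrt_mult)
    also have "exp (pi / 4 - k / 8) * exp (- pi / 4) = exp (- k / 8)" by (simp flip: exp_add)
    finally have P: "4 * (exp (- pi / 4) * (sqrt \<tau> / sqrt \<delta>) * G) \<le> sqrt 2 * (G * (r * exp (- k / 8)))" .
    from order_trans[OF P B]
    have "4 * exp (- pi / 4) * (sqrt \<tau> / sqrt \<delta>) * G \<le> sqrt 2 * (G * gauss_int t (sqrt (pi\<^sup>2 - \<phi>\<^sup>2)))"
      by (simp only: mult.assoc)
    then show ?thesis by (rule order_trans[OF ennreal_leI abel_gauss_lower_int[OF t p, folded G_def]])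
  qed
  consider "2 \<le> \<phi>" | "\<phi> < 2" "\<delta> \<le> 2" | "2 \<le> \<delta>" by linarith
  then have "ennreal (4 * exp (- pi / 4) * (sqrt \<tau> / sqrt \<delta>) * G) \<le> abel_gauss t \<phi>"
  proof cases
    case 1
    have "4 * (exp (- pi / 4) * (sqrt \<tau> / sqrt \<delta>) * G) \<le> (2 * \<phi>) * (exp (- pi / 4) * (sqrt \<tau> / sqrt \<delta>) * G)"
      using 1 \<tau> d by (intro mult_right_mono) (auto simp: G_def)
    also have "\<dots> = exp (- \<phi>\<^sup>2 / (4 * t)) * exp (- pi / 4) * (2 * \<phi> * sqrt \<tau> / sqrt (pi - \<phi>))"
      by (simp add: G_def \<delta>_def)
    finally have "4 * exp (- pi / 4) * (sqrt \<tau> / sqrt \<delta>) * G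
      \<le> exp (- \<phi>\<^sup>2 / (4 * t)) * exp (- pi / 4) * (2 * \<phi> * sqrt \<tau> / sqrt (pi - \<phi>))"
      by (simp only: mult.assoc)
    then show ?thesis
      by (rule order_trans[OF ennreal_leI abel_gauss_lower_near_antipode[OF t p less_imp_le[OF \<tau>(1)] \<tau>(2) \<tau>(3)[unfolded \<delta>_def]]])
  next
    case 2
    show ?thesis
    proof (rule far)
      \<comment> \<open>Here k = 4, admissible because \<delta> \<le> 2 gives 2 \<pi> - \<delta>
        \<ge> 4. With x = \<pi> - 2 < \<delta>, condition \<open>A\<close> becomes 2 \<le> \<delta>
        exp (x/2). The margin is narrow (1.14 times 1.757 is about 2.003), which dictates the
        decimals.\<close>
      have "4 * \<tau> \<le> 4 * \<delta>" using \<tau> by simp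
      also have "\<dots> \<le> (2 * pi - \<delta>) * \<delta>" using 2 d pi_gt3 by (intro mult_right_mono) auto
      finally show "4 * \<tau> \<le> \<delta> * (2 * pi - \<delta>)" by (simp add: mult.commute)
      define x where "x = pi - 2"
      have x: "114 / 100 \<le> x" using pi_approx by (simp add: x_def)
      have "(1757 / 1000 :: real) \<le> (13256 / 10000)\<^sup>2" by (simp add: power2_eq_square)
      also have "\<dots> \<le> (exp (285 / 1000))\<^sup>2"
        using exp_lower_Taylor_quadratic[of "285 / 1000"] by (intro power_mono) (auto simp: power2_eq_square)
      also have "\<dots> \<le> exp (x / 2)" using x by (simp flip: exp_of_nat_mult)
      finally have e: "1757 / 1000 \<le> exp (x / 2)" .
      have "2 \<le> 114 / 100 * (1757 / 1000 :: real)" by simp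
      also have "\<dots> \<le> \<delta> * exp (x / 2)"
        using x e 2 by (intro mult_mono) (auto simp: x_def \<delta>_def)
      finally have "16 \<le> 8 * (\<delta> * exp (x / 2))" by simp
      moreover have "(exp (pi / 4 - 4 / 8))\<^sup>2 = exp (x / 2)"
        by (simp add: x_def field_simps flip: exp_of_nat_mult)
      ultimately show "16 \<le> 2 * 4 * \<delta> * (exp (pi / 4 - 4 / 8))\<^sup>2" by simp
    qed simp
  next
    case 3
    show ?thesis
    proof (rule far)
      \<comment> \<open>Here k = \<pi>, admissible because \<delta> \<le> \<pi> gives 2 \<pi> -
        \<delta> \<ge> \<pi>.\<close>
      have "pi * \<tau> \<le> pi * \<delta>" using \<tau> by simp
      also have "\<dots> \<le> (2 * pi - \<delta>) * \<delta>" using d by (intro mult_right_mono) auto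
      finally show "pi * \<tau> \<le> \<delta> * (2 * pi - \<delta>)" by (simp add: mult.commute)
      have "(11 / 8)\<^sup>2 \<le> (exp (pi / 4 - pi / 8))\<^sup>2"
      proof (rule power_mono)
        have "11 / 8 \<le> exp (pi / 8)" using exp_ge_add_one_self[of "pi / 8"] pi_gt3 by linarith
        moreover have "pi / 4 - pi / 8 = pi / 8" by simp
        ultimately show "11 / 8 \<le> exp (pi / 4 - pi / 8)" by (simp only:)
      qed simp
      moreover have "12 \<le> 2 * pi * \<delta>" using mult_mono[of 3 pi 2 \<delta>] 3 pi_gt3 by simp
      ultimately have "12 * (11 / 8)\<^sup>2 \<le> 2 * pi * \<delta> * (exp (pi / 4 - pi / 8))\<^sup>2"
        by (intro mult_mono) auto
      then show "16 \<le> 2 * pi * \<delta> * (exp (pi / 4 - pi / 8))\<^sup>2" by (simp add: power2_eq_square)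
    qed simp
  qed
  then show ?thesis using V by (simp add: \<delta>_def G_def)
qed

section \<open>Exchange of the order of integration\<close>

lemma nn_integral_Ico_eq:
  fixes f :: "real \<Rightarrow> real"
  assumes [measurable]: "f \<in> borel_measurable borel" and nn: "\<And>x. x \<in> {a..<b} \<Longrightarrow> 0 \<le> f x"
    and i: "(f has_integral I) {a..b}"
  shows "(\<integral>\<^sup>+x. ennreal (indicator {a..<b} x * f x) \<partial>lborel) = ennreal I"
proof (rule nn_integral_has_integral_lborel)
  have "((\<lambda>x. if x \<in> {a..b} then f x else 0) has_integral I) UNIV"
    using i by (simp only: has_integral_restrict_UNIV)
  then show "((\<lambda>x. indicator {a..<b} x * f x) has_integral I) UNIV"
    by (rule has_integral_spike[of "{b}", rotated 2]) (auto simp: indicator_def)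
qed (use nn in \<open>auto simp: indicator_def\<close>)

text \<open>Both sides are iterated integrals over the triangle 0 \<le> \<phi> < s \<le> \<pi>:
  integrating over \<phi> first produces \<open>abel q s\<close>, integrating over s first produces
  \<open>abel_gauss t \<phi>\<close>.\<close>

lemma gauss_abel_tonelli:
  assumes q: "\<And>y. y \<in> {0..1} \<Longrightarrow> 0 \<le> poly q y"
  shows "ennreal (integral {0..pi} (\<lambda>s. gauss_g t s * abel q s))
    = (\<integral>\<^sup>+\<phi>. ennreal (indicator {0..pi} \<phi> * (poly q ((1 - cos \<phi>) / 2) * sin \<phi>)) * abel_gauss t \<phi> \<partial>lborel)"
proof -
  define w where "w \<phi> = indicator {0..pi} \<phi> * (poly q ((1 - cos \<phi>) / 2) * sin \<phi>)" for \<phi> :: real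
  define k where "k \<phi> s = (if \<phi> < s \<and> s \<le> pi then gauss_g t s / sqrt (cos \<phi> - cos s) else 0)" for \<phi> s :: real
  have [measurable]: "w \<in> borel_measurable borel"
    unfolding w_def[abs_def]
    by (intro borel_measurable_times borel_measurable_indicator borel_measurable_continuous_onI continuous_intros) auto
  have [measurable]: "case_prod k \<in> borel_measurable (borel \<Otimes>\<^sub>M borel)"
    unfolding k_def[abs_def] by measurable
  have y01: "(1 - cos x) / 2 \<in> {0..1}" for x :: real using cos_ge_minus_one[of x] cos_le_one[of x] by auto
  have w0: "0 \<le> w x" for x using q[OF y01[of x]] by (auto simp: w_def indicator_def sin_ge_zero)
  have k0: "0 \<le> k \<phi> s" if "0 \<le> \<phi>" for \<phi> s
    using that cos_monotone_0_pi_le[of \<phi> s] by (auto simp: k_def gauss_g_def)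
  have inner: "(\<integral>\<^sup>+\<phi>. ennreal (w \<phi> * k \<phi> s) \<partial>lborel) = ennreal (indicator {0<..pi} s * (gauss_g t s * abel q s))" for s
  proof (cases "s \<in> {0<..pi}")
    case True
    then have s: "0 \<le> s" "s \<le> pi" "0 < s" by auto
    define f where "f \<phi> = poly q ((1 - cos \<phi>) / 2) * (sin \<phi> / sqrt (cos \<phi> - cos s))" for \<phi>
    have [measurable]: "f \<in> borel_measurable borel"
      unfolding f_def[abs_def] divide_inverse[of "sin _"]
      by (intro borel_measurable_times borel_measurable_inverse borel_measurable_continuous_onI continuous_intros) auto
    have "(\<integral>\<^sup>+\<phi>. ennreal (w \<phi> * k \<phi> s) \<partial>lborel) = (\<integral>\<^sup>+\<phi>. ennreal (indicator {0..<s} \<phi> * (gauss_g t s * f \<phi>)) \<partial>lborel)"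
      using s by (intro nn_integral_cong arg_cong[where f = ennreal]) (auto simp: w_def k_def f_def indicator_def)
    also have "\<dots> = ennreal (gauss_g t s * abel q s)"
    proof (rule nn_integral_Ico_eq)
      show "((\<lambda>\<phi>. gauss_g t s * f \<phi>) has_integral gauss_g t s * abel q s) {0..s}"
        unfolding f_def by (intro has_integral_mult_right abel_has_integral s)
      fix x assume x: "x \<in> {0..<s}"
      then have "0 \<le> sin x" "cos s \<le> cos x" using s by (auto intro!: sin_ge_zero cos_monotone_0_pi_le)
      then show "0 \<le> gauss_g t s * f x" using q[OF y01[of x]] s by (simp add: f_def gauss_g_def)
    qed measurable
    finally show ?thesis using True by simp
  next
    case False
    then have wk: "w \<phi> * k \<phi> s = 0" for \<phi> by (auto simp: w_def k_def indicator_def)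
    show ?thesis unfolding wk using False by simp
  qed
  have "ennreal (integral {0..pi} (\<lambda>s. gauss_g t s * abel q s)) = (\<integral>\<^sup>+s. ennreal (indicator {0<..pi} s * (gauss_g t s * abel q s)) \<partial>lborel)"
  proof (rule nn_integral_Ioc_eq[symmetric])
    show "((\<lambda>s. gauss_g t s * abel q s) has_integral integral {0..pi} (\<lambda>s. gauss_g t s * abel q s)) {0..pi}"
      by (intro integrable_integral integrable_continuous_interval continuous_intros continuous_on_gauss_g continuous_on_abel)
    show "(\<lambda>s. gauss_g t s * abel q s) \<in> borel_measurable borel"
      by (intro borel_measurable_continuous_onI continuous_intros continuous_on_gauss_g continuous_on_abel)
    show "0 \<le> gauss_g t s * abel q s" if "s \<in> {0<..pi}" for s
      using that abel_nonneg[of s q] q by (auto simp: gauss_g_def)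
  qed
  also have "\<dots> = (\<integral>\<^sup>+s. \<integral>\<^sup>+\<phi>. ennreal (w \<phi> * k \<phi> s) \<partial>lborel \<partial>lborel)" unfolding inner ..
  also have "\<dots> = (\<integral>\<^sup>+\<phi>. \<integral>\<^sup>+s. ennreal (w \<phi> * k \<phi> s) \<partial>lborel \<partial>lborel)"
    by (rule lborel_pair.Fubini'[symmetric]) measurable
  also have "\<dots> = (\<integral>\<^sup>+\<phi>. ennreal (w \<phi>) * abel_gauss t \<phi> \<partial>lborel)"
  proof (intro nn_integral_cong)
    fix \<phi> :: real
    have "(\<integral>\<^sup>+s. ennreal (w \<phi> * k \<phi> s) \<partial>lborel) = (\<integral>\<^sup>+s. ennreal (w \<phi>) * ennreal (k \<phi> s) \<partial>lborel)"
      using w0[of \<phi>] by (simp add: ennreal_mult')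
    also have "\<dots> = ennreal (w \<phi>) * (\<integral>\<^sup>+s. ennreal (k \<phi> s) \<partial>lborel)"
      by (intro nn_integral_cmult) measurable
    also have "(\<integral>\<^sup>+s. ennreal (k \<phi> s) \<partial>lborel) = abel_gauss t \<phi>"
      unfolding abel_gauss_def by (intro nn_integral_cong arg_cong[where f = ennreal]) (auto simp: k_def indicator_def)
    finally show "(\<integral>\<^sup>+s. ennreal (w \<phi> * k \<phi> s) \<partial>lborel) = ennreal (w \<phi>) * abel_gauss t \<phi>" .
  qed
  finally show ?thesis by (simp add: w_def)
qed

lemma nn_integral_zonal_weight:
  assumes q: "\<And>y. y \<in> {0..1} \<Longrightarrow> 0 \<le> poly q y"
    and V: "continuous_on {0..pi} V" "\<And>\<phi>. \<phi> \<in> {0..pi} \<Longrightarrow> 0 \<le> V \<phi>"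
  shows "(\<integral>\<^sup>+\<phi>. ennreal (indicator {0..pi} \<phi> * (poly q ((1 - cos \<phi>) / 2) * sin \<phi>)) * ennreal (V \<phi>) \<partial>lborel)
    = ennreal (integral {0..pi} (\<lambda>\<phi>. V \<phi> * poly q ((1 - cos \<phi>) / 2) * sin \<phi>))"
proof -
  define f where "f \<phi> = V \<phi> * poly q ((1 - cos \<phi>) / 2) * sin \<phi>" for \<phi>
  have y01: "(1 - cos x) / 2 \<in> {0..1}" for x :: real using cos_ge_minus_one[of x] cos_le_one[of x] by auto
  have f0: "0 \<le> f x" if "x \<in> {0..pi}" for x using that q[OF y01[of x]] V(2)[OF that] by (auto simp: f_def sin_ge_zero)
  have c: "continuous_on {0..pi} f" unfolding f_def by (intro continuous_intros V) auto
  note si = borel_integrable_atLeastAtMost'[OF c]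
  have "(\<integral>\<^sup>+\<phi>. ennreal (indicator {0..pi} \<phi> * (poly q ((1 - cos \<phi>) / 2) * sin \<phi>)) * ennreal (V \<phi>) \<partial>lborel)
      = (\<integral>\<^sup>+\<phi>. ennreal (indicator {0..pi} \<phi> *\<^sub>R f \<phi>) \<partial>lborel)"
  proof (intro nn_integral_cong)
    fix x
    have e: "indicator {0..pi} x *\<^sub>R f x = (indicator {0..pi} x * (poly q ((1 - cos x) / 2) * sin x)) * V x"
      by (simp add: f_def)
    show "ennreal (indicator {0..pi} x * (poly q ((1 - cos x) / 2) * sin x)) * ennreal (V x) = ennreal (indicator {0..pi} x *\<^sub>R f x)"
    proof (cases "x \<in> {0..pi}")
      case True
      show ?thesis unfolding e using V(2)[OF True] by (rule ennreal_mult''[symmetric])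
    qed simp
  qed
  also have "\<dots> = ennreal (\<integral>\<phi>. indicator {0..pi} \<phi> *\<^sub>R f \<phi> \<partial>lborel)"
    using si f0 unfolding set_integrable_def
    by (intro nn_integral_eq_integral) (auto simp: indicator_def)
  also have "(\<integral>\<phi>. indicator {0..pi} \<phi> *\<^sub>R f \<phi> \<partial>lborel) = integral {0..pi} f"
    using set_borel_integral_eq_integral(2)[OF si] by (simp add: set_lebesgue_integral_def)
  finally show ?thesis by (simp add: f_def[abs_def])
qed

lemma integral_zonal_nonneg:
  assumes q: "\<And>y. y \<in> {0..1} \<Longrightarrow> 0 \<le> poly q y"
    and V: "\<And>\<phi>. \<phi> \<in> {0..pi} \<Longrightarrow> 0 \<le> V \<phi>"
  shows "0 \<le> integral {0..pi} (\<lambda>\<phi>. V \<phi> * poly q ((1 - cos \<phi>) / 2) * sin \<phi>)"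
\<comment> \<open>A non-integrable integrand has integral 0 by convention, so the claim holds in
  that case too.\<close>
proof (cases "(\<lambda>\<phi>. V \<phi> * poly q ((1 - cos \<phi>) / 2) * sin \<phi>) integrable_on {0..pi}")
  case True
  have y01: "(1 - cos x) / 2 \<in> {0..1}" for x :: real using cos_ge_minus_one[of x] cos_le_one[of x] by auto
  show ?thesis using q y01 V by (intro integral_nonneg True) (auto simp: sin_ge_zero)
qed (simp add: not_integrable_integral)

lemma gauss_abel_le:
  assumes q: "\<And>y. y \<in> {0..1} \<Longrightarrow> 0 \<le> poly q y"
    and V: "continuous_on {0..pi} V" "\<And>\<phi>. \<phi> \<in> {0..pi} \<Longrightarrow> 0 \<le> V \<phi>"
    and le: "\<And>\<phi>. 0 \<le> \<phi> \<Longrightarrow> \<phi> < pi \<Longrightarrow> abel_gauss t \<phi> \<le> ennreal (V \<phi>)"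
  shows "integral {0..pi} (\<lambda>s. gauss_g t s * abel q s) \<le> integral {0..pi} (\<lambda>\<phi>. V \<phi> * poly q ((1 - cos \<phi>) / 2) * sin \<phi>)"
proof -
  have tonelli: "ennreal (integral {0..pi} (\<lambda>s. gauss_g t s * abel q s))
    = (\<integral>\<^sup>+\<phi>. ennreal (indicator {0..pi} \<phi> * (poly q ((1 - cos \<phi>) / 2) * sin \<phi>)) * abel_gauss t \<phi> \<partial>lborel)"
    by (rule gauss_abel_tonelli) (rule q)
  have weight: "(\<integral>\<^sup>+\<phi>. ennreal (indicator {0..pi} \<phi> * (poly q ((1 - cos \<phi>) / 2) * sin \<phi>)) * ennreal (V \<phi>) \<partial>lborel)
    = ennreal (integral {0..pi} (\<lambda>\<phi>. V \<phi> * poly q ((1 - cos \<phi>) / 2) * sin \<phi>))"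
    by (rule nn_integral_zonal_weight) (use q V in auto)
  have "ennreal (integral {0..pi} (\<lambda>s. gauss_g t s * abel q s))
    \<le> (\<integral>\<^sup>+\<phi>. ennreal (indicator {0..pi} \<phi> * (poly q ((1 - cos \<phi>) / 2) * sin \<phi>)) * ennreal (V \<phi>) \<partial>lborel)"
    unfolding tonelli
  proof (intro nn_integral_mono)
    fix x
    \<comment> \<open>At x = \<pi>, where the hypothesis \<open>le\<close> is silent, the weight
      vanishes with sin \<pi>.\<close>
    consider "0 \<le> x" "x < pi" | "x = pi" | "x \<notin> {0..pi}" by fastforce
    then show "ennreal (indicator {0..pi} x * (poly q ((1 - cos x) / 2) * sin x)) * abel_gauss t x
      \<le> ennreal (indicator {0..pi} x * (poly q ((1 - cos x) / 2) * sin x)) * ennreal (V x)"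
      by cases (auto intro!: mult_left_mono le)
  qed
  then show ?thesis unfolding weight
    by (subst (asm) ennreal_le_iff) (auto intro: integral_zonal_nonneg q V)
qed

lemma gauss_abel_ge:
  assumes q: "\<And>y. y \<in> {0..1} \<Longrightarrow> 0 \<le> poly q y"
    and V: "continuous_on {0..pi} V" "\<And>\<phi>. \<phi> \<in> {0..pi} \<Longrightarrow> 0 \<le> V \<phi>"
    and ge: "\<And>\<phi>. 0 \<le> \<phi> \<Longrightarrow> \<phi> < pi \<Longrightarrow> ennreal (V \<phi>) \<le> abel_gauss t \<phi>"
  shows "integral {0..pi} (\<lambda>\<phi>. V \<phi> * poly q ((1 - cos \<phi>) / 2) * sin \<phi>) \<le> integral {0..pi} (\<lambda>s. gauss_g t s * abel q s)"
proof -
  have tonelli: "ennreal (integral {0..pi} (\<lambda>s. gauss_g t s * abel q s))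
    = (\<integral>\<^sup>+\<phi>. ennreal (indicator {0..pi} \<phi> * (poly q ((1 - cos \<phi>) / 2) * sin \<phi>)) * abel_gauss t \<phi> \<partial>lborel)"
    by (rule gauss_abel_tonelli) (rule q)
  have weight: "(\<integral>\<^sup>+\<phi>. ennreal (indicator {0..pi} \<phi> * (poly q ((1 - cos \<phi>) / 2) * sin \<phi>)) * ennreal (V \<phi>) \<partial>lborel)
    = ennreal (integral {0..pi} (\<lambda>\<phi>. V \<phi> * poly q ((1 - cos \<phi>) / 2) * sin \<phi>))"
    by (rule nn_integral_zonal_weight) (use q V in auto)
  have "(\<integral>\<^sup>+\<phi>. ennreal (indicator {0..pi} \<phi> * (poly q ((1 - cos \<phi>) / 2) * sin \<phi>)) * ennreal (V \<phi>) \<partial>lborel)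
    \<le> ennreal (integral {0..pi} (\<lambda>s. gauss_g t s * abel q s))"
    unfolding tonelli
  proof (intro nn_integral_mono)
    fix x
    consider "0 \<le> x" "x < pi" | "x = pi" | "x \<notin> {0..pi}" by fastforce
    then show "ennreal (indicator {0..pi} x * (poly q ((1 - cos x) / 2) * sin x)) * ennreal (V x)
      \<le> ennreal (indicator {0..pi} x * (poly q ((1 - cos x) / 2) * sin x)) * abel_gauss t x"
      by cases (auto intro!: mult_left_mono ge)
  qed
  moreover have "0 \<le> integral {0..pi} (\<lambda>s. gauss_g t s * abel q s)"
    using abel_nonneg q
    by (intro integral_nonneg integrable_continuous_interval continuous_intros continuous_on_gauss_g continuous_on_abel)
       (auto simp: gauss_g_def)
  ultimately show ?thesis unfolding weight by simp
qed

section \<open>The heat kernel bounds\<close>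

text \<open>Both sides are linear in q, so Legendre polynomials suffice. There \<open>abel\<close>
  is sqrt 2 / \<beta> times sin (\<beta> s) with \<beta> = n + 1/2, and \<beta>^2 = n (n + 1) + 1/4
  explains the factor exp (t/4) that converts sine moments into Legendre moments.\<close>

lemma abel_functional_tendsto:
  assumes h: "\<And>N. continuous_on {0..pi} (h N)"
    and lim: "\<And>n. (\<lambda>N. integral {0..pi} (\<lambda>s. h N s * sin ((2 * real n + 1) / 2 * s)))
      \<longlonglongrightarrow> 2 * t * ((2 * real n + 1) / 2) * sqrt (pi * t) * exp (- ((2 * real n + 1) / 2)\<^sup>2 * t)"
    and K: "continuous_on {0..pi} k" and t: "t > 0"
    and mom: "\<And>n. 2 * pi * integral {0..pi} (\<lambda>\<phi>. k \<phi> * poly (legendre n) ((1 - cos \<phi>) / 2) * sin \<phi>)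
      = exp (- (real n * (real n + 1)) * t)"
  shows "(\<lambda>N. exp (t / 4) / (2 * sqrt 2 * t * sqrt (pi * t)) * integral {0..pi} (\<lambda>s. h N s * abel q s))
    \<longlonglongrightarrow> 2 * pi * integral {0..pi} (\<lambda>\<phi>. k \<phi> * poly q ((1 - cos \<phi>) / 2) * sin \<phi>)"
proof (induction q rule: poly_legendre_induct)
  case (1 p q)
  have ih: "(\<lambda>s. h N s * abel p s) integrable_on {0..pi}" for N p
    by (intro integrable_continuous_interval continuous_intros h continuous_on_abel)
  have ik: "(\<lambda>\<phi>. k \<phi> * poly p ((1 - cos \<phi>) / 2) * sin \<phi>) integrable_on {0..pi}" for p
    by (intro integrable_continuous_interval continuous_intros K) auto
  have "integral {0..pi} (\<lambda>s. h N s * abel (p + q) s)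
      = integral {0..pi} (\<lambda>s. h N s * abel p s) + integral {0..pi} (\<lambda>s. h N s * abel q s)" for N
  proof -
    have "integral {0..pi} (\<lambda>s. h N s * abel (p + q) s)
      = integral {0..pi} (\<lambda>s. h N s * abel p s + h N s * abel q s)"
      by (intro Henstock_Kurzweil_Integration.integral_cong) (simp add: abel_add distrib_left)
    then show ?thesis by (simp add: Henstock_Kurzweil_Integration.integral_add ih)
  qed
  moreover have "integral {0..pi} (\<lambda>\<phi>. k \<phi> * poly (p + q) ((1 - cos \<phi>) / 2) * sin \<phi>)
    = integral {0..pi} (\<lambda>\<phi>. k \<phi> * poly p ((1 - cos \<phi>) / 2) * sin \<phi>)
      + integral {0..pi} (\<lambda>\<phi>. k \<phi> * poly q ((1 - cos \<phi>) / 2) * sin \<phi>)"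
    by (simp only: poly_add distrib_left distrib_right Henstock_Kurzweil_Integration.integral_add ik)
  ultimately show ?case using tendsto_add[OF 1] by (simp add: distrib_left)
next
  case (2 c p)
  have "integral {0..pi} (\<lambda>s. h N s * abel (smult c p) s) = c * integral {0..pi} (\<lambda>s. h N s * abel p s)" for N
  proof -
    have "integral {0..pi} (\<lambda>s. h N s * abel (smult c p) s) = integral {0..pi} (\<lambda>s. c * (h N s * abel p s))"
      by (intro Henstock_Kurzweil_Integration.integral_cong) (simp add: abel_smult)
    then show ?thesis by simp
  qed
  moreover have "integral {0..pi} (\<lambda>\<phi>. k \<phi> * poly (smult c p) ((1 - cos \<phi>) / 2) * sin \<phi>)
    = c * integral {0..pi} (\<lambda>\<phi>. k \<phi> * poly p ((1 - cos \<phi>) / 2) * sin \<phi>)"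
    by (simp only: poly_smult mult.assoc mult.left_commute[of _ c] integral_mult_right)
  ultimately show ?case using tendsto_mult_left[OF 2, of c] by (simp only: mult.left_commute[of _ c])
next
  case (3 n)
  define \<beta> where "\<beta> = (2 * real n + 1) / 2"
  define C where "C = exp (t / 4) / (2 * sqrt 2 * t * sqrt (pi * t))"
  have b: "\<beta> > 0" by (simp add: \<beta>_def add_pos_nonneg)
  have e: "integral {0..pi} (\<lambda>s. h N s * abel (legendre n) s)
    = sqrt 2 / \<beta> * integral {0..pi} (\<lambda>s. h N s * sin (\<beta> * s))" for N
  proof -
    have "integral {0..pi} (\<lambda>s. h N s * abel (legendre n) s)
      = integral {0..pi} (\<lambda>s. sqrt 2 / \<beta> * (h N s * sin (\<beta> * s)))"
      by (intro Henstock_Kurzweil_Integration.integral_cong) (simp add: abel_legendre \<beta>_def field_simps)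
    then show ?thesis by simp
  qed
  have "(\<lambda>N. C * (sqrt 2 / \<beta> * integral {0..pi} (\<lambda>s. h N s * sin (\<beta> * s))))
    \<longlonglongrightarrow> C * (sqrt 2 / \<beta> * (2 * t * \<beta> * sqrt (pi * t) * exp (- \<beta>\<^sup>2 * t)))"
    unfolding \<beta>_def by (intro tendsto_intros lim)
  also have "C * (sqrt 2 / \<beta> * (2 * t * \<beta> * sqrt (pi * t) * exp (- \<beta>\<^sup>2 * t))) = exp (t / 4) * exp (- \<beta>\<^sup>2 * t)"
    using t b by (simp add: C_def)
  also have "\<dots> = exp (- (real n * (real n + 1)) * t)"
    by (simp add: \<beta>_def power2_eq_square field_simps flip: exp_add)
  finally show ?case unfolding e mom C_def .
qed

text \<open>Nonnegative continuous test functions suffice, and their Bernstein polynomials in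
  \<open>(1 - cos \<phi>) / 2\<close> are again nonnegative.\<close>

lemma le_of_zonal_integrals:
  assumes A: "continuous_on {0..pi} A" and B: "continuous_on {0..pi} B"
    and le: "\<And>q. (\<And>y. y \<in> {0..1} \<Longrightarrow> 0 \<le> poly q y) \<Longrightarrow>
      integral {0..pi} (\<lambda>\<phi>. A \<phi> * poly q ((1 - cos \<phi>) / 2) * sin \<phi>)
      \<le> integral {0..pi} (\<lambda>\<phi>. B \<phi> * poly q ((1 - cos \<phi>) / 2) * sin \<phi>)"
    and x: "x \<in> {0..pi}"
  shows "A x \<le> B x"
proof -
  define D where "D \<phi> = B \<phi> - A \<phi>" for \<phi>
  \<comment> \<open>The negative part of B - A is the decisive test function: D f = - f^2, so a
    nonnegative integral of D f sin forces f = 0.\<close>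
  define f where "f \<phi> = max 0 (- D \<phi>)" for \<phi>
  define g where "g y = f (arccos (1 - 2 * y))" for y
  have cD: "continuous_on {0..pi} D" unfolding D_def by (intro continuous_intros A B)
  have cf: "continuous_on {0..pi} f" unfolding f_def by (intro continuous_intros cD)
  have "continuous_on {0..1} (\<lambda>y::real. arccos (1 - 2 * y))"
    by (intro continuous_on_arccos continuous_intros) auto
  then have cg: "continuous_on {0..1} g"
    unfolding g_def by (rule continuous_on_compose2[OF cf]) (auto intro!: arccos_lbound arccos_ubound)
  have gf: "g ((1 - cos \<phi>) / 2) = f \<phi>" if "\<phi> \<in> {0..pi}" for \<phi>
    using that by (simp add: g_def arccos_cos field_simps)
  have y01: "(1 - cos x) / 2 \<in> {0..1}" for x :: real using cos_ge_minus_one[of x] cos_le_one[of x] by auto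
  \<comment> \<open>The Bernstein polynomials of \<open>g\<close>, which is \<open>f\<close> in the
    variable y; nonnegative values of \<open>g\<close> make them nonnegative on [0, 1], hence
    admissible in \<open>le\<close>.\<close>
  define r where "r n = (\<Sum>k\<le>n. smult (g (k / n) * real (n choose k)) (monom 1 k * [:1, -1:] ^ (n - k)))" for n :: nat
  have pr: "poly (r n) y = (\<Sum>k\<le>n. g (k / n) * Bernstein n k y)" for n y
    by (simp add: r_def poly_sum poly_monom Bernstein_def mult.assoc)
  have ug: "uniform_limit {0..1} (\<lambda>n. poly (r n)) g sequentially"
    unfolding uniform_limit_iff eventually_sequentially
  proof (intro allI impI)
    fix e :: real assume "0 < e"
    from Bernstein_Weierstrass[OF cg this] obtain N
      where N: "\<And>n x. N \<le> n \<Longrightarrow> x \<in> {0..1} \<Longrightarrow> \<bar>g x - (\<Sum>k\<le>n. g (k / n) * Bernstein n k x)\<bar> < e"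
      by blast
    show "\<exists>N. \<forall>n\<ge>N. \<forall>x\<in>{0..1}. dist (poly (r n) x) (g x) < e"
    proof (intro exI allI impI ballI)
      fix n and x :: real assume "N \<le> n" "x \<in> {0..1}"
      then show "dist (poly (r n) x) (g x) < e"
        using N by (simp only: pr dist_real_def abs_minus_commute)
    qed
  qed
  have u: "uniform_limit {0..pi} (\<lambda>n \<phi>. poly (r n) ((1 - cos \<phi>) / 2)) f sequentially"
  proof (rule uniform_limitI)
    fix e :: real assume e: "e > 0"
    from uniform_limitD[OF ug e] show "\<forall>\<^sub>F n in sequentially. \<forall>\<phi>\<in>{0..pi}. dist (poly (r n) ((1 - cos \<phi>) / 2)) (f \<phi>) < e"
    proof eventually_elim
      case (elim n)
      then show ?case using y01 gf by metis
    qed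
  qed
  have bD: "bounded (D ` {0..pi})"
    by (intro compact_imp_bounded compact_continuous_image cD) auto
  have bf: "bounded (f ` {0..pi})"
    by (intro compact_imp_bounded compact_continuous_image cf) auto
  have bs: "bounded (sin ` {0..pi})"
    by (intro compact_imp_bounded compact_continuous_image continuous_intros) auto
  have bDf: "bounded ((\<lambda>\<phi>. D \<phi> * f \<phi>) ` {0..pi})"
    by (intro compact_imp_bounded compact_continuous_image continuous_intros cD cf) auto
  have "uniform_limit {0..pi} (\<lambda>n \<phi>. D \<phi> * poly (r n) ((1 - cos \<phi>) / 2) * sin \<phi>) (\<lambda>\<phi>. D \<phi> * f \<phi> * sin \<phi>) sequentially"
    using bD bf bs bDf
    by (intro bounded_bilinear.bounded_uniform_limit[OF bounded_bilinear_mult] u uniform_limit_const)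
  then obtain I J where I: "\<And>n. ((\<lambda>\<phi>. D \<phi> * poly (r n) ((1 - cos \<phi>) / 2) * sin \<phi>) has_integral I n) {0..pi}"
    and J: "((\<lambda>\<phi>. D \<phi> * f \<phi> * sin \<phi>) has_integral J) {0..pi}" and IJ: "I \<longlonglongrightarrow> J"
  proof (rule uniform_limit_integral)
    show "continuous_on {0..pi} (\<lambda>\<phi>. D \<phi> * poly (r n) ((1 - cos \<phi>) / 2) * sin \<phi>)" for n
      by (intro continuous_intros cD) auto
  qed auto
  have lim: "(\<lambda>n. integral {0..pi} (\<lambda>\<phi>. D \<phi> * poly (r n) ((1 - cos \<phi>) / 2) * sin \<phi>)) \<longlonglongrightarrow> integral {0..pi} (\<lambda>\<phi>. D \<phi> * f \<phi> * sin \<phi>)"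
    using IJ by (simp only: integral_unique[OF I] integral_unique[OF J])
  have "0 \<le> integral {0..pi} (\<lambda>\<phi>. D \<phi> * poly (r n) ((1 - cos \<phi>) / 2) * sin \<phi>)" for n
  proof -
    have i: "(\<lambda>\<phi>. F \<phi> * poly (r n) ((1 - cos \<phi>) / 2) * sin \<phi>) integrable_on {0..pi}" if "continuous_on {0..pi} F" for F
      by (intro integrable_continuous_interval continuous_intros that) auto
    have "0 \<le> poly (r n) y" if "y \<in> {0..1}" for y
      unfolding pr using that by (intro sum_nonneg mult_nonneg_nonneg Bernstein_nonneg) (auto simp: g_def f_def)
    from le[OF this] show ?thesis
      by (simp add: D_def left_diff_distrib Henstock_Kurzweil_Integration.integral_diff i A B)
  qed
  then have nn: "0 \<le> integral {0..pi} (\<lambda>\<phi>. D \<phi> * f \<phi> * sin \<phi>)"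
    by (intro LIMSEQ_le_const[OF lim]) auto
  have c2: "continuous_on {0..pi} (\<lambda>\<phi>. f \<phi> * f \<phi> * sin \<phi>)" by (intro continuous_intros cf)
  have Df: "D \<phi> * f \<phi> * sin \<phi> = - (f \<phi> * f \<phi> * sin \<phi>)" for \<phi> by (simp add: f_def max_def)
  have "integral {0..pi} (\<lambda>\<phi>. f \<phi> * f \<phi> * sin \<phi>) \<le> 0" using nn unfolding Df by simp
  moreover have "0 \<le> integral {0..pi} (\<lambda>\<phi>. f \<phi> * f \<phi> * sin \<phi>)"
    by (intro integral_nonneg integrable_continuous_interval c2) (auto simp: sin_ge_zero)
  ultimately have "((\<lambda>\<phi>. f \<phi> * f \<phi> * sin \<phi>) has_integral 0) {0..pi}"
    using integrable_integral[OF integrable_continuous_interval[OF c2]] by simp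
  then have z: "f y * f y * sin y = 0" if "y \<in> {0..pi}" for y
    using has_integral_0_cbox_imp_0[of 0 pi "\<lambda>\<phi>. f \<phi> * f \<phi> * sin \<phi>" y] c2 that
    by (auto simp: sin_ge_zero not_le)
  \<comment> \<open>The factor sin y hides the endpoints; these are recovered by continuity.\<close>
  have f0: "f y = 0" if "y \<in> {0<..<pi}" for y
    using z[of y] sin_gt_zero[of y] that by auto
  have "f x = 0"
  proof (rule continuous_constant_on_closure[of "{0<..<pi}" f 0 x])
    show "continuous_on (closure {0<..<pi}) f" using cf by simp
  qed (use f0 x in auto)
  then show ?thesis by (simp add: f_def D_def max_def split: if_splits)
qed

text \<open>The bound on \<open>image_sum\<close> is uniform in N and \<open>abel q\<close> is
  nonnegative, so the comparison survives the limit. Its factor 2 against the 2 \<pi> of the moments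
  leaves 1 / \<pi>.\<close>

lemma heat_kernel_profile_upper:
  assumes K: "heat_kernel_profile K" and t: "0 < t" "t \<le> 2 * pi\<^sup>2" and p: "\<phi> \<in> {0..pi}"
  shows "K t \<phi> \<le> exp (t / 4) / (2 * sqrt 2 * t * sqrt (pi * t)) / pi *
    (pi\<^sup>2 * sqrt t / sqrt (max (pi\<^sup>2 / 8 * t) (pi - \<phi>)) * exp (- \<phi>\<^sup>2 / (4 * t)))"
proof -
  define C where "C = exp (t / 4) / (2 * sqrt 2 * t * sqrt (pi * t))"
  define V where "V \<phi> = pi\<^sup>2 * sqrt t / sqrt (max (pi\<^sup>2 / 8 * t) (pi - \<phi>)) * exp (- \<phi>\<^sup>2 / (4 * t))" for \<phi>
  have C: "0 < C" using t by (simp add: C_def)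
  have m: "0 < max (pi\<^sup>2 / 8 * t) (pi - \<phi>)" for \<phi> using t by (simp add: less_max_iff_disj)
  then have cV: "continuous_on A V" for A
    unfolding V_def using t by (intro continuous_intros) (auto simp: less_imp_neq[symmetric] simp del: less_max_iff_disj)
  have V0: "0 \<le> V \<phi>" for \<phi> unfolding V_def using t
    by (intro mult_nonneg_nonneg divide_nonneg_nonneg) (auto simp: le_max_iff_disj)
  note cK = heat_kernel_profile_continuous[OF K t(1)]
  have "K t \<phi> \<le> C / pi * V \<phi>"
  proof (rule le_of_zonal_integrals[OF cK _ _ p])
    show "continuous_on {0..pi} (\<lambda>\<phi>. C / pi * V \<phi>)" by (intro continuous_intros cV)
    fix q :: "real poly" assume q: "\<And>y. y \<in> {0..1} \<Longrightarrow> 0 \<le> poly q y"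
    have "C * integral {0..pi} (\<lambda>s. image_sum t N s * abel q s) \<le> C * (2 * integral {0..pi} (\<lambda>s. gauss_g t s * abel q s))" for N
    proof (intro mult_left_mono)
      have "integral {0..pi} (\<lambda>s. image_sum t N s * abel q s) \<le> integral {0..pi} (\<lambda>s. 2 * gauss_g t s * abel q s)"
        using image_sum_upper[OF t] abel_nonneg q
        by (intro integral_le integrable_continuous_interval continuous_intros continuous_on_gauss_g continuous_on_image_sum
              continuous_on_abel mult_right_mono) auto
      then show "integral {0..pi} (\<lambda>s. image_sum t N s * abel q s) \<le> 2 * integral {0..pi} (\<lambda>s. gauss_g t s * abel q s)"
        by (simp add: mult.assoc)
    qed (use C in simp)
    then have "2 * pi * integral {0..pi} (\<lambda>\<phi>. K t \<phi> * poly q ((1 - cos \<phi>) / 2) * sin \<phi>)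
      \<le> C * (2 * integral {0..pi} (\<lambda>s. gauss_g t s * abel q s))"
      unfolding C_def
      by (intro LIMSEQ_le_const2[OF abel_functional_tendsto[OF continuous_on_image_sum image_sum_sin_tendsto[OF t(1)] cK t(1)
            heat_kernel_profile_legendre_moment[OF K t(1)]]]) auto
    also have "\<dots> \<le> C * (2 * integral {0..pi} (\<lambda>\<phi>. V \<phi> * poly q ((1 - cos \<phi>) / 2) * sin \<phi>))"
      using C abel_gauss_le[OF t(1)] unfolding V_def[symmetric]
      by (intro mult_left_mono gauss_abel_le q cV V0) auto
    finally have "integral {0..pi} (\<lambda>\<phi>. K t \<phi> * poly q ((1 - cos \<phi>) / 2) * sin \<phi>)
      \<le> C / pi * integral {0..pi} (\<lambda>\<phi>. V \<phi> * poly q ((1 - cos \<phi>) / 2) * sin \<phi>)"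
      by (simp add: field_simps)
    also have "\<dots> = integral {0..pi} (\<lambda>\<phi>. C / pi * V \<phi> * poly q ((1 - cos \<phi>) / 2) * sin \<phi>)"
      by (simp only: mult.assoc integral_mult_right)
    finally show "integral {0..pi} (\<lambda>\<phi>. K t \<phi> * poly q ((1 - cos \<phi>) / 2) * sin \<phi>)
      \<le> integral {0..pi} (\<lambda>\<phi>. C / pi * V \<phi> * poly q ((1 - cos \<phi>) / 2) * sin \<phi>)" .
  qed
  then show ?thesis by (simp add: C_def V_def)
qed

lemma heat_kernel_profile_lower:
  assumes K: "heat_kernel_profile K" and t: "0 < t" and p: "\<phi> \<in> {0..pi}"
  shows "exp (t / 4) / (2 * sqrt 2 * t * sqrt (pi * t)) * exp (- t / 4) / (2 * pi) *
    (2 * sqrt 2 * exp (- pi / 4) * sqrt t / sqrt (max (1 / 2 * t) (pi - \<phi>)) * exp (- \<phi>\<^sup>2 / (4 * t))) \<le> K t \<phi>"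
proof -
  define C where "C = exp (t / 4) / (2 * sqrt 2 * t * sqrt (pi * t))"
  define V where "V \<phi> = 2 * sqrt 2 * exp (- pi / 4) * sqrt t / sqrt (max (1 / 2 * t) (pi - \<phi>)) * exp (- \<phi>\<^sup>2 / (4 * t))" for \<phi>
  define c where "c = C * exp (- t / 4) / (2 * pi)"
  have C: "0 < C" using t by (simp add: C_def)
  have m: "0 < max (1 / 2 * t) (pi - \<phi>)" for \<phi> using t by (simp add: less_max_iff_disj)
  then have cV: "continuous_on A V" for A
    unfolding V_def using t by (intro continuous_intros) (auto simp: less_imp_neq[symmetric] simp del: less_max_iff_disj)
  have V0: "0 \<le> V \<phi>" for \<phi> unfolding V_def using t
    by (intro mult_nonneg_nonneg divide_nonneg_nonneg) (auto simp: le_max_iff_disj)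
  note cK = heat_kernel_profile_continuous[OF K t]
  \<comment> \<open>Image sums serve for t \<le> \<pi>, sine sums beyond. The common lower bound
    contains exp (-t/4) in both ranges, which later cancels the exp (t/4) inside
    \<open>C\<close>.\<close>
  obtain h where h: "\<And>N. continuous_on {0..pi} (h N)"
    and lim: "\<And>n. (\<lambda>N. integral {0..pi} (\<lambda>s. h N s * sin ((2 * real n + 1) / 2 * s)))
      \<longlonglongrightarrow> 2 * t * ((2 * real n + 1) / 2) * sqrt (pi * t) * exp (- ((2 * real n + 1) / 2)\<^sup>2 * t)"
    and hg: "\<And>N s. 0 \<le> s \<Longrightarrow> s \<le> pi \<Longrightarrow> exp (- t / 4) * gauss_g t s \<le> h N s"
  proof (cases "t \<le> pi")
    case True
    have "exp (- t / 4) * gauss_g t s \<le> image_sum t N s" if "0 \<le> s" "s \<le> pi" for N s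
    proof -
      have "exp (- t / 4) * gauss_g t s \<le> 1 * gauss_g t s"
        using t that by (intro mult_right_mono) (auto simp: gauss_g_def)
      then show ?thesis using image_sum_lower[OF t True that, of N] by simp
    qed
    then show ?thesis using that[OF continuous_on_image_sum image_sum_sin_tendsto[OF t]] by blast
  next
    case False
    then show ?thesis using that[OF continuous_on_sine_sum sine_sum_sin_tendsto] sine_sum_lower[of t] by simp
  qed
  have "c * V \<phi> \<le> K t \<phi>"
  proof (rule le_of_zonal_integrals[OF _ cK _ p])
    show "continuous_on {0..pi} (\<lambda>\<phi>. c * V \<phi>)" by (intro continuous_intros cV)
    fix q :: "real poly" assume q: "\<And>y. y \<in> {0..1} \<Longrightarrow> 0 \<le> poly q y"
    have "C * (exp (- t / 4) * integral {0..pi} (\<lambda>s. gauss_g t s * abel q s)) \<le> C * integral {0..pi} (\<lambda>s. h N s * abel q s)" for N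
    proof (intro mult_left_mono)
      have "integral {0..pi} (\<lambda>s. exp (- t / 4) * gauss_g t s * abel q s) \<le> integral {0..pi} (\<lambda>s. h N s * abel q s)"
        using hg abel_nonneg q
        by (intro integral_le integrable_continuous_interval continuous_intros continuous_on_gauss_g h
              continuous_on_abel mult_right_mono) auto
      then show "exp (- t / 4) * integral {0..pi} (\<lambda>s. gauss_g t s * abel q s) \<le> integral {0..pi} (\<lambda>s. h N s * abel q s)"
        by (simp add: mult.assoc)
    qed (use C in simp)
    then have up: "C * (exp (- t / 4) * integral {0..pi} (\<lambda>s. gauss_g t s * abel q s))
      \<le> 2 * pi * integral {0..pi} (\<lambda>\<phi>. K t \<phi> * poly q ((1 - cos \<phi>) / 2) * sin \<phi>)"
      unfolding C_def
      by (intro LIMSEQ_le_const[OF abel_functional_tendsto[OF h lim cK t heat_kernel_profile_legendre_moment[OF K t]]]) auto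
    have "C * (exp (- t / 4) * integral {0..pi} (\<lambda>\<phi>. V \<phi> * poly q ((1 - cos \<phi>) / 2) * sin \<phi>))
      \<le> C * (exp (- t / 4) * integral {0..pi} (\<lambda>s. gauss_g t s * abel q s))"
      using C abel_gauss_ge[OF t] unfolding V_def[symmetric]
      by (intro mult_left_mono gauss_abel_ge q cV V0) auto
    then have "c * integral {0..pi} (\<lambda>\<phi>. V \<phi> * poly q ((1 - cos \<phi>) / 2) * sin \<phi>)
      \<le> integral {0..pi} (\<lambda>\<phi>. K t \<phi> * poly q ((1 - cos \<phi>) / 2) * sin \<phi>)"
      using up by (simp add: c_def field_simps)
    moreover have "c * integral {0..pi} (\<lambda>\<phi>. V \<phi> * poly q ((1 - cos \<phi>) / 2) * sin \<phi>)
      = integral {0..pi} (\<lambda>\<phi>. c * V \<phi> * poly q ((1 - cos \<phi>) / 2) * sin \<phi>)"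
      by (simp only: mult.assoc integral_mult_right)
    ultimately show "integral {0..pi} (\<lambda>\<phi>. c * V \<phi> * poly q ((1 - cos \<phi>) / 2) * sin \<phi>)
      \<le> integral {0..pi} (\<lambda>\<phi>. K t \<phi> * poly q ((1 - cos \<phi>) / 2) * sin \<phi>)" by simp
  qed
  then show ?thesis by (simp add: c_def C_def V_def)
qed

theorem theorem4:
  fixes K :: "real \<Rightarrow> real \<Rightarrow> real" and T t \<phi> :: real
  assumes "heat_kernel_profile K"
    and "0 < T" and "T \<le> 2 * pi\<^sup>2"
    and "\<phi> \<in> {0..pi}" and "0 < t" and "t \<le> T"
  shows "2 * pi powr (-1/2) * exp (- pi / 4) / sqrt (max (1/2 * t) (pi - \<phi>))
           * (1 / (4 * pi * t)) * exp (- \<phi>\<^sup>2 / (4 * t)) \<le> K t \<phi>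
       \<and> K t \<phi> \<le> sqrt 2 * pi powr (3/2) * exp (T / 4) / sqrt (max (pi\<^sup>2 / 8 * t) (pi - \<phi>))
           * (1 / (4 * pi * t)) * exp (- \<phi>\<^sup>2 / (4 * t))"
proof
  define R G where "R = sqrt (max (1/2 * t) (pi - \<phi>))" and "G = exp (- \<phi>\<^sup>2 / (4 * t))"
  have p1: "pi powr (-1/2) = 1 / sqrt pi" by (simp add: powr_minus powr_half_sqrt field_simps)
  have p3: "pi powr (3/2) = pi * sqrt pi"
    using powr_add[of pi 1 "1/2"] by (simp add: powr_half_sqrt)
  have ee: "exp (t / 4) * exp (- t / 4) = 1" by (simp flip: exp_add)
  have "exp (t / 4) / (2 * sqrt 2 * t * sqrt (pi * t)) * exp (- t / 4) / (2 * pi) *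
      (2 * sqrt 2 * exp (- pi / 4) * sqrt t / R * G)
    = (exp (t / 4) * exp (- t / 4)) * exp (- pi / 4) / (2 * pi * sqrt pi * t * R) * G"
    using assms by (simp add: real_sqrt_mult mult_ac)
  also have "\<dots> = 2 * pi powr (-1/2) * exp (- pi / 4) / R * (1 / (4 * pi * t)) * G"
    unfolding ee p1 using assms by simp
  finally show "2 * pi powr (-1/2) * exp (- pi / 4) / sqrt (max (1/2 * t) (pi - \<phi>))
           * (1 / (4 * pi * t)) * exp (- \<phi>\<^sup>2 / (4 * t)) \<le> K t \<phi>"
    using heat_kernel_profile_lower[of K t \<phi>] assms unfolding R_def G_def by simp
  define R' where "R' = sqrt (max (pi\<^sup>2 / 8 * t) (pi - \<phi>))"
  have R': "0 < R'" using assms by (simp add: R'_def less_max_iff_disj)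
  \<comment> \<open>The roots of \<pi>, t and 2 become plain variables, so that the identity is
    rational up to the one relation a * a = 2.\<close>
  have "E / (2 * a * t * (u * w)) / (u * u) * ((u * u)\<^sup>2 * w / R' * G)
      = a * ((u * u) * u) * E / R' * (1 / (4 * (u * u) * t)) * G"
    if "0 < u" "0 < w" "0 < a" and a: "a * a = 2" for E u w a
  proof -
    have "E / (2 * a * t * (u * w)) / (u * u) * ((u * u)\<^sup>2 * w / R' * G) = E * (u * a / (2 * (a * a) * t * R')) * G"
      using that(1-3) R' assms by (simp add: power2_eq_square field_simps)
    also have "\<dots> = a * ((u * u) * u) * E / R' * (1 / (4 * (u * u) * t)) * G"
      unfolding a using that(1-3) by (simp add: field_simps)
    finally show ?thesis .
  qed
  from this[of "sqrt pi" "sqrt t" "sqrt 2" "exp (t / 4)"]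
  have "exp (t / 4) / (2 * sqrt 2 * t * sqrt (pi * t)) / pi * (pi\<^sup>2 * sqrt t / R' * G)
    = sqrt 2 * pi powr (3/2) * exp (t / 4) / R' * (1 / (4 * pi * t)) * G"
    unfolding p3 real_sqrt_mult using assms by simp
  also have "\<dots> \<le> sqrt 2 * pi powr (3/2) * exp (T / 4) / R' * (1 / (4 * pi * t)) * G"
    using assms R' by (intro mult_right_mono divide_right_mono mult_left_mono) (auto simp: G_def)
  finally show "K t \<phi> \<le> sqrt 2 * pi powr (3/2) * exp (T / 4) / sqrt (max (pi\<^sup>2 / 8 * t) (pi - \<phi>))
           * (1 / (4 * pi * t)) * exp (- \<phi>\<^sup>2 / (4 * t))"
    using heat_kernel_profile_upper[of K t \<phi>] assms unfolding R'_def G_def by simp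
qed

end
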